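(* Assume that Assumption (E) (defined in the context) holds true. Then there exist a constant $C>0$, a constant $\alpha\in(0,1)$ and a probability measure $\nu_{QSD}$ on $E$ such that $\nu_{QSD}(K)>0$ and $$\left\|\frac{\mu P_n}{\mu P_n\mathbf{1}_E}-\nu_{QSD}\right\|_{TV(\varphi_1)}\le C\,\alpha^n\,\frac{\mu(\varphi_1)}{\mu(\varphi_2)},\qquad\forall n\ge0,$$ for all probability measures $\mu$ on $E$ such that $\mu(\varphi_1)<\infty$ and $\mu(\varphi_2)>0$. In addition, $\nu_{QSD}$ is the unique quasi-stationary distribution satisfying $\nu_{QSD}(\varphi_2)>0$ and $\nu_{QSD}(\varphi_1)<\infty$.
   Context: Setting. $E$ is a measurable space, $\partial\notin E$, $I$ is $\mathbb{R}_+$ or $\frac1k\mathbb{Z}_+$ for some $k\in\mathbb{N}=\{1,2,\ldots\}$, and $(X_t)_{t\in I}$ is a time-homogeneous Markov process in $E\cup\{\partial\}$, with law $\mathbb{P}_x$ when started from $x$, and $\mathbb{P}_\mu=\int\mathbb{P}_x\,\mu(\mathrm dx)$. The point $\partial$ is absorbing: $X_t=\partial$ for all $t\ge\tau_\partial:=\inf\{t\in I:X_t=\partial\}$ almost surely. The process is considered at integer times: for $n\in\mathbb{Z}_+$, $P_nf(x)=\mathbb{E}_x(f(X_n)\mathbf{1}_{n<\tau_\partial})$ for bounded or nonnegative measurable $f$ on $E$, and $\mu P_nf=\int_EP_nf\,\mathrm d\mu$. Also $\mu(f)=\int f\,\mathrm d\mu$. Assumption (E). There exist a positive integer $n_1$,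 positive real constants $\theta_1,\theta_2,c_1,c_2,c_3$, two measurable functions $\varphi_1,\varphi_2:E\to\mathbb{R}_+$ and a probability measure $\nu$ on a measurable subset $K\subset E$ such that: - (E1) for all $x\in K$, $\mathbb{P}_x(X_{n_1}\in\cdot)\ge c_1\nu(\cdot\cap K)$. - (E2) $\theta_1<\theta_2$, $\inf_E\varphi_1\ge1$, $\sup_K\varphi_1<\infty$, $\inf_K\varphi_2>0$, $\sup_E\varphi_2\le1$, and for all $x\in E$, $P_1\varphi_1(x)\le\theta_1\varphi_1(x)+c_2\mathbf{1}_K(x)$ and $P_1\varphi_2(x)\ge\theta_2\varphi_2(x)$. - (E3) $\displaystyle\sup_{n\in\mathbb{Z}_+}\frac{\sup_{y\in K}\mathbb{P}_y(n<\tau_\partial)}{\inf_{y\in K}\mathbb{P}_y(n<\tau_\partial)}\le c_3$. - (E4) for all $x\in K$ there exists $n_4(x)$ such that $\mathbb{P}_x(X_n\in K)>0$ for all $n\ge n_4(x)$. A quasi-stationary distribution (for the process at integer times) is a probability measure $\nu'$ on $E$ such that $\mathbb{P}_{\nu'}(X_n\in\cdot\mid n<\tau_\partial)=\nu'$ for all $n\in\mathbb{Z}_+$. Finally $\|\mu_1-\mu_2\|_{TV(\varphi_1)}=\sup\{|\mu_1(f)-\mu_2(f)|:f:E\to\mathbb{R}\text{ measurable},\ |f|\le\varphi_1\}$. *)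

theory Defs
  imports "HOL-Probability.Probability"
begin

text \<open>
  The measurable space \<open>E \<union> {\<partial>}\<close>: the sigma-algebra generated by that of \<open>E\<close> and by \<open>{\<partial>}\<close>.
\<close>

definition with_cemetery :: "'a measure \<Rightarrow> 'a \<Rightarrow> 'a measure" where
  "with_cemetery E cem = sigma (insert cem (space E)) (insert {cem} (sets E))"

text \<open>Time is a set of reals; the infimum is \<open>\<infinity>\<close> if \<open>\<partial>\<close> is never reached.\<close>

definition absorption_time :: "'a \<Rightarrow> real set \<Rightarrow> (real \<Rightarrow> 'w \<Rightarrow> 'a) \<Rightarrow> 'w \<Rightarrow> ereal" where
  "absorption_time cem I X \<omega> = Inf (ereal ` {t \<in> I. X t \<omega> = cem})"

definition natural_sigma ::
    "'a measure \<Rightarrow> real set \<Rightarrow> 'w measure \<Rightarrow> (real \<Rightarrow> 'w \<Rightarrow> 'a) \<Rightarrow> real \<Rightarrow> 'w measure" where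
  "natural_sigma S I \<Omega> X s =
     sigma (space \<Omega>) {X u -` A \<inter> space \<Omega> | u A. u \<in> I \<and> u \<le> s \<and> A \<in> sets S}"

text \<open>
  Time-homogeneous Markov process in \<open>E \<union> {\<partial>}\<close>, absorbed at \<open>\<partial>\<close>. The initial condition is stated
  through the law of \<open>X\<^sub>0\<close> since singletons of \<open>E\<close> need not be measurable. For continuous time and no
  path regularity, measurability of the events \<open>{n < \<tau>}\<close> does not follow from the other axioms, so it is
  required for their probabilities to make sense.
\<close>

locale absorbed_markov_process =
  fixes E :: "'a measure" and cem :: 'a and I :: "real set"
    and \<Omega> :: "'w measure" and P :: "'a \<Rightarrow> 'w measure" and X :: "real \<Rightarrow> 'w \<Rightarrow> 'a"
  assumes cem_notin: "cem \<notin> space E"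
    and time_set: "I = {0..} \<or> (\<exists>k::nat. k \<ge> 1 \<and> I = range (\<lambda>m::nat. real m / real k))"
    and X_measurable: "\<And>t. t \<in> I \<Longrightarrow> X t \<in> measurable \<Omega> (with_cemetery E cem)"
    and P_kernel: "P \<in> measurable (with_cemetery E cem) (prob_algebra \<Omega>)"
    and initial_law: "\<And>x. x \<in> space (with_cemetery E cem) \<Longrightarrow>
          distr (P x) (with_cemetery E cem) (X 0) = return (with_cemetery E cem) x"
    and markov: "\<And>x s t A. x \<in> space (with_cemetery E cem) \<Longrightarrow> s \<in> I \<Longrightarrow> t \<in> I \<Longrightarrow>
          A \<in> sets (with_cemetery E cem) \<Longrightarrow>
          AE \<omega> in P x.
            real_cond_exp (P x) (natural_sigma (with_cemetery E cem) I \<Omega> X s)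
              (indicator (X (s + t) -` A \<inter> space \<Omega>)) \<omega>
            = \<P>(\<omega>' in P (X s \<omega>). X t \<omega>' \<in> A)"
    and absorption_event: "\<And>n::nat.
          {\<omega> \<in> space \<Omega>. ereal (real n) < absorption_time cem I X \<omega>} \<in> sets \<Omega>"
    and absorbing: "\<And>x. x \<in> space (with_cemetery E cem) \<Longrightarrow>
          AE \<omega> in P x. \<forall>t\<in>I. absorption_time cem I X \<omega> \<le> ereal t \<longrightarrow> X t \<omega> = cem"
begin

abbreviation survives :: "nat \<Rightarrow> 'w \<Rightarrow> bool" where
  "survives n \<omega> \<equiv> ereal (real n) < absorption_time cem I X \<omega>"

text \<open>\<open>P\<^sub>n f(x)\<close> for nonnegative \<open>f\<close>; the value of \<open>f\<close> at \<open>\<partial>\<close> is irrelevant.\<close>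

definition Pn :: "nat \<Rightarrow> ('a \<Rightarrow> ennreal) \<Rightarrow> 'a \<Rightarrow> ennreal" where
  "Pn n f x = (\<integral>\<^sup>+ \<omega>. f (X (real n) \<omega>) * indicator {\<omega>. survives n \<omega>} \<omega> \<partial>P x)"

definition muPn :: "'a measure \<Rightarrow> nat \<Rightarrow> 'a measure" where
  "muPn \<mu> n = measure_of (space E) (sets E) (\<lambda>A. \<integral>\<^sup>+ x. Pn n (indicator A) x \<partial>\<mu>)"

definition normalized_muPn :: "'a measure \<Rightarrow> nat \<Rightarrow> 'a measure" where
  "normalized_muPn \<mu> n = scale_measure (inverse (emeasure (muPn \<mu> n) (space E))) (muPn \<mu> n)"

text \<open>
  \<open>\<mu> \<bind> P\<close> is \<open>\<integral> P\<^sub>x \<mu>(dx)\<close>. As \<open>cond_prob\<close> is 0 when conditioning on a null event, taking \<open>A = space E\<close>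
  shows that survival has positive probability under a quasi-stationary distribution.
\<close>

definition quasi_stationary :: "'a measure \<Rightarrow> bool" where
  "quasi_stationary \<mu> \<longleftrightarrow> \<mu> \<in> space (prob_algebra E) \<and>
     (\<forall>n. \<forall>A\<in>sets E. \<P>(\<omega> in \<mu> \<bind> P. X (real n) \<omega> \<in> A \<bar> survives n \<omega>) = measure \<mu> A)"

end

text \<open>
  In E3 the quotient is taken in \<open>ennreal\<close>, where \<open>x / 0 = \<infinity>\<close> for \<open>x > 0\<close>; E2 makes the
  denominators positive.
\<close>

locale assumption_E = absorbed_markov_process E cem I \<Omega> P X
  for E :: "'a measure" and cem :: 'a and I :: "real set"
    and \<Omega> :: "'w measure" and P :: "'a \<Rightarrow> 'w measure" and X :: "real \<Rightarrow> 'w \<Rightarrow> 'a" +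
  fixes K :: "'a set" and \<nu> :: "'a measure" and n\<^sub>1 :: nat
    and \<theta>\<^sub>1 \<theta>\<^sub>2 c\<^sub>1 c\<^sub>2 c\<^sub>3 :: real and \<phi>\<^sub>1 \<phi>\<^sub>2 :: "'a \<Rightarrow> real"
  assumes K_sets: "K \<in> sets E"
    and nu_prob: "\<nu> \<in> space (prob_algebra (restrict_space E K))"
    and n1_pos: "n\<^sub>1 > 0"
    and constants_pos: "\<theta>\<^sub>1 > 0" "\<theta>\<^sub>2 > 0" "c\<^sub>1 > 0" "c\<^sub>2 > 0" "c\<^sub>3 > 0"
    and phi_measurable: "\<phi>\<^sub>1 \<in> borel_measurable E" "\<phi>\<^sub>2 \<in> borel_measurable E"
    and phi_nonneg: "\<And>x. x \<in> space E \<Longrightarrow> 0 \<le> \<phi>\<^sub>1 x" "\<And>x. x \<in> space E \<Longrightarrow> 0 \<le> \<phi>\<^sub>2 x"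
    and E1: "\<And>x A. x \<in> K \<Longrightarrow> A \<in> sets E \<Longrightarrow>
          \<P>(\<omega> in P x. X (real n\<^sub>1) \<omega> \<in> A) \<ge> c\<^sub>1 * measure \<nu> (A \<inter> K)"
    and E2_theta: "\<theta>\<^sub>1 < \<theta>\<^sub>2"
    and E2_phi1: "\<And>x. x \<in> space E \<Longrightarrow> 1 \<le> \<phi>\<^sub>1 x" "bdd_above (\<phi>\<^sub>1 ` K)"
    and E2_phi2: "(INF x\<in>K. \<phi>\<^sub>2 x) > 0" "\<And>x. x \<in> space E \<Longrightarrow> \<phi>\<^sub>2 x \<le> 1"
    and E2_upper: "\<And>x. x \<in> space E \<Longrightarrow>
          Pn 1 (\<lambda>y. ennreal (\<phi>\<^sub>1 y)) x \<le> ennreal (\<theta>\<^sub>1 * \<phi>\<^sub>1 x + c\<^sub>2 * indicator K x)"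
    and E2_lower: "\<And>x. x \<in> space E \<Longrightarrow>
          Pn 1 (\<lambda>y. ennreal (\<phi>\<^sub>2 y)) x \<ge> ennreal (\<theta>\<^sub>2 * \<phi>\<^sub>2 x)"
    and E3: "(SUP n. (SUP y\<in>K. emeasure (P y) {\<omega> \<in> space (P y). survives n \<omega>})
               / (INF y\<in>K. emeasure (P y) {\<omega> \<in> space (P y). survives n \<omega>})) \<le> ennreal c\<^sub>3"
    and E4: "\<And>x. x \<in> K \<Longrightarrow> \<exists>n\<^sub>4::nat. \<forall>n\<ge>n\<^sub>4. \<P>(\<omega> in P x. X (real n) \<omega> \<in> K) > 0"

text \<open>
  The weighted distance is meaningful for measures integrating \<open>\<phi>\<close>, so that every Bochner integral
  below converges.
\<close>

definition tv_dist :: "'a measure \<Rightarrow> ('a \<Rightarrow> real) \<Rightarrow> 'a measure \<Rightarrow> 'a measure \<Rightarrow> ennreal" where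
  "tv_dist E \<phi> \<mu>\<^sub>1 \<mu>\<^sub>2 =
     (SUP f\<in>{f \<in> borel_measurable E. \<forall>x\<in>space E. \<bar>f x\<bar> \<le> \<phi> x}.
        ennreal \<bar>(\<integral>x. f x \<partial>\<mu>\<^sub>1) - (\<integral>x. f x \<partial>\<mu>\<^sub>2)\<bar>)"

end

theory Submission
  imports Defs "HOL-Real_Asymp.Real_Asymp"
begin

text \<open>
  Write \<open>V = \<phi>\<^sub>1\<close>, \<open>\<psi> = \<phi>\<^sub>2\<close>, let \<open>P\<close> be the one-step operator \<open>P\<^sub>1\<close> and \<open>m\<^sub>n = P\<^sup>n 1\<close> the survival probability. The
  law at time \<open>n\<close> conditioned on survival is \<open>\<mu>(P\<^sup>n f) / \<mu>(m\<^sub>n)\<close>, so two initial laws are compared by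
  bounding \<open>P\<^sup>n f(x) m\<^sub>n(y) - m\<^sub>n(x) P\<^sup>n f(y)\<close>. This is the product operator \<open>P\<^sup>n \<otimes> P\<^sup>n\<close> applied to the
  antisymmetric function \<open>f \<otimes> 1 - 1 \<otimes> f\<close>. If \<open>P\<^sup>T(x,\<cdot>) \<ge> a \<nu>\<close> and \<open>P\<^sup>T(y,\<cdot>) \<ge> b \<nu>\<close>, then the part \<open>a b \<nu> \<otimes> \<nu>\<close> of
  \<open>P\<^sup>T \<otimes> P\<^sup>T\<close> annihilates antisymmetric functions and can be subtracted without changing the result
  (\<open>antisymmetric_minorization\<close>). Hence a bound by a positive weight improves by what \<open>a b \<nu> \<otimes> \<nu>\<close> takes
  away from that weight.

  Fix \<open>z \<in> K\<close> and let \<open>s\<^sub>n = m\<^sub>n(z)\<close>, which by (E3) is comparable to \<open>m\<^sub>n\<close> on all of \<open>K\<close>. The weight is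
  \<open>s\<^sub>r (V \<otimes> m\<^sub>r + m\<^sub>r \<otimes> V) + A m\<^sub>r \<otimes> m\<^sub>r\<close>, where \<open>r\<close> counts the remaining steps. Three facts make it contract
  (\<open>contraction_step\<close>). First, \<open>s\<close> decays strictly more slowly than \<open>\<theta>\<^sub>1\<^sup>n\<close>, because \<open>P\<^sup>n V \<ge> P\<^sup>n \<psi> \<ge> \<theta>\<^sub>2\<^sup>n \<psi>\<close>
  while the Lyapunov inequality lets \<open>P\<^sup>n V\<close> exceed \<open>\<theta>\<^sub>1\<^sup>n V\<close> only through visits to \<open>K\<close>
  (\<open>survival_growth\<close>). Second, the Lyapunov inequality therefore survives normalization:
  \<open>s\<^sub>r P\<^sup>T V\<close> is at most a small multiple of \<open>s\<^sub>r\<^sub>+\<^sub>T V\<close> plus a constant, independent of \<open>r\<close> and \<open>T\<close>, times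
  \<open>m\<^sub>r\<^sub>+\<^sub>T\<close> (\<open>normalized_lyapunov\<close>). Third, a point with \<open>s\<^sub>r V \<le> R m\<^sub>r\<close> must reach \<open>K\<close> soon, since surviving
  off \<open>K\<close> is too costly; from there (E1) and (E4) give a minorization by \<open>\<nu>\<close> of size comparable to
  \<open>m\<^sub>r/s\<^sub>r\<close> (\<open>small_set_minorization\<close>).

  Contraction makes the conditioned laws started from \<open>z\<close> a Cauchy sequence, uniformly over \<open>\<bar>f\<bar> \<le> V\<close>.
  The limit functional is continuous under dominated pointwise convergence because the convergence is uniform, so it is
  integration against a probability measure (\<open>daniell_representation\<close>); passing to the limit in
  the semigroup identity shows that this measure is quasi-stationary. For a general initial law, the
  factor \<open>\<mu>(V)/\<mu>(\<psi>)\<close> is the price of waiting: after about \<open>log (\<mu>(V)/\<mu>(\<psi>)) / log (\<theta>\<^sub>2/\<theta>\<^sub>1)\<close> steps the law has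
  forgotten its start enough for the contraction to act with universal constants
  (\<open>persistent_iter_of_late\<close>, \<open>convergence_to_\<xi>\<close>). Uniqueness is the convergence applied to a law
  that conditioning leaves fixed.
\<close>

section \<open>Positive functionals on functions of weighted growth\<close>

text \<open>
  The domain of all functionals and operators below. Its elements need not be bounded, but they are
  integrable wherever \<open>V\<close> is.
\<close>

definition weighted_space :: "'a measure \<Rightarrow> ('a \<Rightarrow> real) \<Rightarrow> ('a \<Rightarrow> real) set" where
  "weighted_space E V = {f \<in> borel_measurable E. \<exists>c. \<forall>x\<in>space E. \<bar>f x\<bar> \<le> c * V x}"

lemma weighted_spaceI:
  assumes "f \<in> borel_measurable E" "\<And>x. x \<in> space E \<Longrightarrow> \<bar>f x\<bar> \<le> c * V x"
  shows "f \<in> weighted_space E V"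
  using assms by (auto simp: weighted_space_def)

lemma weighted_space_measurable: "f \<in> weighted_space E V \<Longrightarrow> f \<in> borel_measurable E"
  by (simp add: weighted_space_def)

lemma weighted_space_scale:
  assumes "f \<in> weighted_space E V"
  shows "(\<lambda>x. c * f x) \<in> weighted_space E V"
proof -
  obtain b where b: "\<And>x. x \<in> space E \<Longrightarrow> \<bar>f x\<bar> \<le> b * V x" and [measurable]: "f \<in> borel_measurable E"
    using assms by (auto simp: weighted_space_def)
  show ?thesis
  proof (rule weighted_spaceI[where c = "\<bar>c\<bar> * b"])
    fix x assume "x \<in> space E"
    from mult_left_mono[OF b[OF this], of "\<bar>c\<bar>"] show "\<bar>c * f x\<bar> \<le> \<bar>c\<bar> * b * V x"
      by (simp add: abs_mult mult.assoc)
  qed simp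
qed

lemma weighted_space_add:
  assumes "f \<in> weighted_space E V" "g \<in> weighted_space E V"
  shows "(\<lambda>x. f x + g x) \<in> weighted_space E V"
proof -
  obtain a where a: "\<And>x. x \<in> space E \<Longrightarrow> \<bar>f x\<bar> \<le> a * V x" and [measurable]: "f \<in> borel_measurable E"
    using assms by (auto simp: weighted_space_def)
  obtain b where b: "\<And>x. x \<in> space E \<Longrightarrow> \<bar>g x\<bar> \<le> b * V x" and [measurable]: "g \<in> borel_measurable E"
    using assms by (auto simp: weighted_space_def)
  show ?thesis
  proof (rule weighted_spaceI[where c = "a + b"])
    fix x assume "x \<in> space E"
    from a[OF this] b[OF this] show "\<bar>f x + g x\<bar> \<le> (a + b) * V x"
      by (simp add: distrib_right)
  qed simp
qed

lemma weighted_space_sum: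
  assumes "\<And>i. i \<in> J \<Longrightarrow> f i \<in> weighted_space E V" 
  shows "(\<lambda>x. \<Sum>i\<in>J. f i x) \<in> weighted_space E V"
  using assms
proof (induction J rule: infinite_finite_induct)
  case (insert i J)
  then show ?case using weighted_space_add[of "f i" E V "\<lambda>x. \<Sum>i\<in>J. f i x"] by simp
qed (auto intro!: weighted_spaceI[where c = 0])

lemma weighted_space_bounded:
  assumes "f \<in> borel_measurable E" "\<And>x. x \<in> space E \<Longrightarrow> 1 \<le> V x"
    "\<And>x. x \<in> space E \<Longrightarrow> \<bar>f x\<bar> \<le> c"
  shows "f \<in> weighted_space E V"
proof (rule weighted_spaceI[where c = c])
  fix x assume x: "x \<in> space E"
  then have "0 \<le> c" using assms(3)[of x] by linarith
  then have "c * 1 \<le> c * V x" using assms(2)[OF x] by (intro mult_left_mono) auto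
  then show "\<bar>f x\<bar> \<le> c * V x" using assms(3)[OF x] by linarith
qed (use assms in auto)

lemma weighted_space_mult_bounded:
  assumes f: "f \<in> weighted_space E V" and u: "u \<in> borel_measurable E" "\<And>x. x \<in> space E \<Longrightarrow> \<bar>u x\<bar> \<le> 1"
  shows "(\<lambda>x. u x * f x) \<in> weighted_space E V"
proof -
  obtain b where b: "\<And>x. x \<in> space E \<Longrightarrow> \<bar>f x\<bar> \<le> b * V x" and [measurable]: "f \<in> borel_measurable E"
    using f by (auto simp: weighted_space_def)
  show ?thesis
  proof (rule weighted_spaceI[where c = b])
    fix x assume x: "x \<in> space E"
    have "\<bar>u x * f x\<bar> \<le> 1 * (b * V x)"
      unfolding abs_mult using u(2)[OF x] b[OF x] by (intro mult_mono) auto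
    then show "\<bar>u x * f x\<bar> \<le> b * V x" by simp
  qed (use u in simp)
qed

text \<open>
  Initial laws, laws at a later time and the limit of the conditioned laws are all treated as
  functionals. The limit is at first available in this form only.
  Monotonicity refers to \<open>space E\<close> only, so values outside it never matter.
\<close>

definition pos_linear :: "'a measure \<Rightarrow> ('a \<Rightarrow> real) \<Rightarrow> (('a \<Rightarrow> real) \<Rightarrow> real) \<Rightarrow> bool" where
  "pos_linear E V p \<longleftrightarrow>
     (\<forall>f\<in>weighted_space E V. \<forall>g\<in>weighted_space E V. p (\<lambda>x. f x + g x) = p f + p g) \<and>
     (\<forall>f\<in>weighted_space E V. \<forall>c. p (\<lambda>x. c * f x) = c * p f) \<and>
     (\<forall>f\<in>weighted_space E V. \<forall>g\<in>weighted_space E V. (\<forall>x\<in>space E. f x \<le> g x) \<longrightarrow> p f \<le> p g)"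

context
  fixes E :: "'a measure" and V :: "'a \<Rightarrow> real" and p :: "('a \<Rightarrow> real) \<Rightarrow> real"
  assumes p: "pos_linear E V p"
begin

lemma pos_linear_add:
  "f \<in> weighted_space E V \<Longrightarrow> g \<in> weighted_space E V \<Longrightarrow> p (\<lambda>x. f x + g x) = p f + p g"
  using p by (simp add: pos_linear_def)

lemma pos_linear_scale: "f \<in> weighted_space E V \<Longrightarrow> p (\<lambda>x. c * f x) = c * p f"
  using p by (simp add: pos_linear_def)

lemma pos_linear_mono:
  "f \<in> weighted_space E V \<Longrightarrow> g \<in> weighted_space E V \<Longrightarrow> (\<And>x. x \<in> space E \<Longrightarrow> f x \<le> g x) \<Longrightarrow> p f \<le> p g"
  using p by (simp add: pos_linear_def)

lemma pos_linear_cong: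
  "f \<in> weighted_space E V \<Longrightarrow> g \<in> weighted_space E V \<Longrightarrow> (\<And>x. x \<in> space E \<Longrightarrow> f x = g x) \<Longrightarrow> p f = p g"
  by (intro antisym pos_linear_mono) auto

lemma pos_linear_zero: "p (\<lambda>x. 0) = 0"
proof -
  have "(\<lambda>x. 0) \<in> weighted_space E V" by (auto intro!: weighted_spaceI[where c = 0])
  from pos_linear_scale[OF this, of 0] show ?thesis by simp
qed

lemma pos_linear_nonneg:
  assumes "f \<in> weighted_space E V" "\<And>x. x \<in> space E \<Longrightarrow> 0 \<le> f x"
  shows "0 \<le> p f"
proof -
  have "(\<lambda>x. 0) \<in> weighted_space E V" by (auto intro!: weighted_spaceI[where c = 0])
  from pos_linear_mono[OF this assms] show ?thesis by (simp add: pos_linear_zero)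
qed

lemma pos_linear_combination:
  assumes "f \<in> weighted_space E V" "g \<in> weighted_space E V"
  shows "p (\<lambda>x. a * f x + b * g x) = a * p f + b * p g"
  using assms by (simp add: pos_linear_add pos_linear_scale weighted_space_scale)

lemma pos_linear_combination3:
  assumes "f \<in> weighted_space E V" "g \<in> weighted_space E V" "h \<in> weighted_space E V"
  shows "p (\<lambda>x. a * f x + b * g x + c * h x) = a * p f + b * p g + c * p h"
  using assms by (simp add: pos_linear_add pos_linear_scale weighted_space_scale weighted_space_add)

lemma pos_linear_sum:
  assumes "\<And>i. i \<in> J \<Longrightarrow> f i \<in> weighted_space E V"
  shows "p (\<lambda>x. \<Sum>i\<in>J. f i x) = (\<Sum>i\<in>J. p (f i))"
  using assms
proof (induction J rule: infinite_finite_induct)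
  case (insert i J)
  then show ?case
    using pos_linear_add[of "f i" "\<lambda>x. \<Sum>i\<in>J. f i x"] by (simp add: weighted_space_sum)
qed (auto simp: pos_linear_zero)

lemma pos_linear_abs_le:
  assumes "f \<in> weighted_space E V" "g \<in> weighted_space E V" "\<And>x. x \<in> space E \<Longrightarrow> \<bar>f x\<bar> \<le> g x"
  shows "\<bar>p f\<bar> \<le> p g"
proof -
  have "p f \<le> p g" using assms by (intro pos_linear_mono) (auto simp: abs_le_iff)
  moreover have "p (\<lambda>x. -1 * f x) \<le> p g"
    using assms by (intro pos_linear_mono weighted_space_scale) (auto simp: abs_le_iff)
  ultimately show ?thesis using pos_linear_scale[OF assms(1), of "-1"] by simp
qed

end

lemma pos_linear_compose:
  assumes p: "pos_linear E V p"
    and Q: "\<And>x. x \<in> space E \<Longrightarrow> pos_linear E V (\<lambda>f. Q f x)"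
    and Q_weighted: "\<And>f. f \<in> weighted_space E V \<Longrightarrow> Q f \<in> weighted_space E V"
  shows "pos_linear E V (\<lambda>f. p (Q f))"
  unfolding pos_linear_def
proof (intro conjI ballI allI impI)
  fix f g assume fg: "f \<in> weighted_space E V" "g \<in> weighted_space E V"
  have "p (Q (\<lambda>x. f x + g x)) = p (\<lambda>x. Q f x + Q g x)"
    using fg by (intro pos_linear_cong[OF p] Q_weighted weighted_space_add pos_linear_add[OF Q]) auto
  then show "p (Q (\<lambda>x. f x + g x)) = p (Q f) + p (Q g)"
    using fg by (simp add: pos_linear_add[OF p] Q_weighted)
next
  fix f and c :: real assume f: "f \<in> weighted_space E V"
  have "p (Q (\<lambda>x. c * f x)) = p (\<lambda>x. c * Q f x)"
    using f by (intro pos_linear_cong[OF p] Q_weighted weighted_space_scale pos_linear_scale[OF Q]) auto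
  then show "p (Q (\<lambda>x. c * f x)) = c * p (Q f)"
    using f by (simp add: pos_linear_scale[OF p] Q_weighted)
next
  fix f g assume "f \<in> weighted_space E V" "g \<in> weighted_space E V" "\<forall>x\<in>space E. f x \<le> g x"
  then show "p (Q f) \<le> p (Q g)"
    by (intro pos_linear_mono[OF p] Q_weighted pos_linear_mono[OF Q]) auto
qed

lemma pos_linear_eval: "x \<in> space E \<Longrightarrow> pos_linear E V (\<lambda>f. f x)"
  by (simp add: pos_linear_def)

lemma pos_linear_divide:
  assumes p: "pos_linear E V p" and c: "0 \<le> c"
  shows "pos_linear E V (\<lambda>f. p f / c)"
  unfolding pos_linear_def using c
  by (auto simp: pos_linear_add[OF p] pos_linear_scale[OF p] add_divide_distrib
      intro!: divide_right_mono pos_linear_mono[OF p])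

text \<open>
  Here \<open>h x * m y - m x * h y\<close> is antisymmetric, so \<open>\<nu> \<otimes> \<nu>\<close> maps it to \<open>0\<close>. Applied to the nonnegative
  function obtained by adding it to its bound, \<open>p \<otimes> p' \<ge> a b \<nu> \<otimes> \<nu>\<close> therefore gains \<open>a b \<nu> \<otimes> \<nu>\<close> of the
  bound alone. Since all functions of two variables involved are sums of products, the two
  minorizations can be applied one variable at a time, without a product measure.
\<close>

lemma antisymmetric_minorization:
  assumes p: "pos_linear E V p" and p': "pos_linear E V p'" and \<nu>: "pos_linear E V \<nu>"
    and h: "h \<in> weighted_space E V" and m: "m \<in> weighted_space E V" and v: "v \<in> weighted_space E V"
    and a: "0 \<le> a" "\<And>f. f \<in> weighted_space E V \<Longrightarrow> (\<And>x. x \<in> space E \<Longrightarrow> 0 \<le> f x) \<Longrightarrow> a * \<nu> f \<le> p f"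
    and b: "0 \<le> b" "\<And>f. f \<in> weighted_space E V \<Longrightarrow> (\<And>x. x \<in> space E \<Longrightarrow> 0 \<le> f x) \<Longrightarrow> b * \<nu> f \<le> p' f"
    and bound: "\<And>x y. x \<in> space E \<Longrightarrow> y \<in> space E \<Longrightarrow>
        \<bar>h x * m y - m x * h y\<bar> \<le> v x * m y + m x * v y + A * (m x * m y)"
  shows "\<bar>p h * p' m - p m * p' h\<bar>
      \<le> p v * p' m + p m * p' v + A * (p m * p' m) - a * b * (2 * (\<nu> v * \<nu> m) + A * (\<nu> m)\<^sup>2)"
proof -
  have one_sign: "e * (p h * p' m - p m * p' h)
      \<le> p v * p' m + p m * p' v + A * (p m * p' m) - a * b * (2 * (\<nu> v * \<nu> m) + A * (\<nu> m)\<^sup>2)"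
    if e: "e = 1 \<or> e = -1" for e :: real
  proof -
    \<comment> \<open>\<open>G \<mu> x\<close> is the value of \<open>\<mu>\<close> at the slice \<open>y \<mapsto> bound(x,y) - e * difference(x,y)\<close>.\<close>
    define G where "G \<mu> x = \<mu> m * v x + (A * \<mu> m + \<mu> v + e * \<mu> h) * m x + (- e * \<mu> m) * h x"
      for \<mu> :: "('a \<Rightarrow> real) \<Rightarrow> real" and x
    note w = h m v weighted_space_add weighted_space_scale
    have pG: "q (G \<mu>) = \<mu> m * q v + (A * \<mu> m + \<mu> v + e * \<mu> h) * q m + (- e * \<mu> m) * q h"
      if "pos_linear E V q" for q \<mu>
      unfolding G_def by (rule pos_linear_combination3[OF that v m h])
    have Gw: "G \<mu> \<in> weighted_space E V" for \<mu> unfolding G_def by (intro w)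
    have slice: "(\<lambda>y. (v x + A * m x - e * h x) * m y + m x * v y + e * m x * h y) \<in> weighted_space E V" for x
      by (intro w)
    have slice_nonneg: "0 \<le> (v x + A * m x - e * h x) * m y + m x * v y + e * m x * h y"
      if "x \<in> space E" "y \<in> space E" for x y
    proof -
      have "e * (h x * m y - m x * h y) \<le> \<bar>h x * m y - m x * h y\<bar>" using e by auto
      with bound[OF that] show ?thesis by (simp add: algebra_simps)
    qed
    have eqG: "q (\<lambda>y. (v x + A * m x - e * h x) * m y + m x * v y + e * m x * h y) = G q x"
      if "pos_linear E V q" for q x
      using pos_linear_combination3[OF that m v h, of "v x + A * m x - e * h x" "m x" "e * m x"]
      by (simp add: G_def algebra_simps)
    have G\<nu>: "0 \<le> G \<nu> x" if "x \<in> space E" for x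
      using pos_linear_nonneg[OF \<nu> slice, of x] slice_nonneg that eqG[OF \<nu>] by simp
    have Gp': "b * G \<nu> x \<le> G p' x" if "x \<in> space E" for x
      using b(2)[OF slice, of x] slice_nonneg that eqG[OF \<nu>] eqG[OF p'] by simp
    have "b * p (G \<nu>) \<le> p (G p')"
      using pos_linear_mono[OF p weighted_space_scale[OF Gw] Gw Gp'] pos_linear_scale[OF p Gw] by simp
    moreover have "b * (a * \<nu> (G \<nu>)) \<le> b * p (G \<nu>)"
      using a(2)[OF Gw G\<nu>] b(1) by (intro mult_left_mono) auto
    ultimately have "a * b * \<nu> (G \<nu>) \<le> p (G p')" by (simp add: mult_ac)
    then show ?thesis
      unfolding pG[OF p] pG[OF \<nu>] by (simp add: algebra_simps power2_eq_square)
  qed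
  from one_sign[of 1] one_sign[of "-1"] show ?thesis by (auto simp: abs_le_iff)
qed

section \<open>Survival probabilities of an operator with a Lyapunov pair\<close>

lemma geometric_sum_le:
  fixes \<tau> :: real
  assumes "0 < \<tau>" "\<tau> < 1"
  shows "(\<Sum>j<n. \<tau> ^ (n - 1 - j)) \<le> 1 / (1 - \<tau>)"
proof -
  have "(\<Sum>j<n. \<tau> ^ (n - 1 - j)) = (\<Sum>j<n. \<tau> ^ j)"
    using sum.nat_diff_reindex[of "\<lambda>j. \<tau> ^ j" n] by simp
  also have "\<dots> = (1 - \<tau> ^ n) / (1 - \<tau>)"
    using sum_gp_strict[of \<tau> n] assms by simp
  also have "\<dots> \<le> 1 / (1 - \<tau>)"
    using assms by (intro divide_right_mono) auto
  finally show ?thesis .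
qed

text \<open>
  The analytic content of assumption (E). The probability \<open>\<nu>\<close> enters as a functional, and (E4) enters through its
  consequence that the law started from \<open>\<nu>\<close> charges \<open>K\<close> at all late times. The point \<open>z\<close> is an arbitrary reference point
  of \<open>K\<close>.
\<close>

locale lyapunov_doeblin_operator =
  fixes E :: "'a measure" and V \<psi> :: "'a \<Rightarrow> real" and K :: "'a set" and z :: 'a
    and P :: "('a \<Rightarrow> real) \<Rightarrow> 'a \<Rightarrow> real" and \<nu> :: "('a \<Rightarrow> real) \<Rightarrow> real"
    and \<theta>\<^sub>1 \<theta>\<^sub>2 c\<^sub>1 c\<^sub>2 c\<^sub>3 \<delta> :: real and n\<^sub>1 N :: nat
  assumes V_measurable: "V \<in> borel_measurable E"
    and \<psi>_measurable: "\<psi> \<in> borel_measurable E"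
    and K_sets: "K \<in> sets E"
    and z_in_K: "z \<in> K"
    and V_ge_1: "\<And>x. x \<in> space E \<Longrightarrow> 1 \<le> V x"
    and \<psi>_nonneg: "\<And>x. x \<in> space E \<Longrightarrow> 0 \<le> \<psi> x"
    and \<psi>_le_1: "\<And>x. x \<in> space E \<Longrightarrow> \<psi> x \<le> 1"
    and \<psi>_on_K: "\<And>x. x \<in> K \<Longrightarrow> \<delta> \<le> \<psi> x"
    and constants: "0 < \<theta>\<^sub>1" "\<theta>\<^sub>1 < \<theta>\<^sub>2" "0 < c\<^sub>1" "0 < c\<^sub>2" "0 < \<delta>"
    and P_weighted: "\<And>f. f \<in> weighted_space E V \<Longrightarrow> P f \<in> weighted_space E V"
    and P_pos_linear: "\<And>x. x \<in> space E \<Longrightarrow> pos_linear E V (\<lambda>f. P f x)"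
    and P_one: "\<And>x. x \<in> space E \<Longrightarrow> P (\<lambda>_. 1) x \<le> 1"
    and P_V: "\<And>x. x \<in> space E \<Longrightarrow> P V x \<le> \<theta>\<^sub>1 * V x + c\<^sub>2 * indicator K x"
    and P_\<psi>: "\<And>x. x \<in> space E \<Longrightarrow> \<theta>\<^sub>2 * \<psi> x \<le> P \<psi> x"
    and survival_comparable:
      "\<And>n x y. x \<in> K \<Longrightarrow> y \<in> K \<Longrightarrow> (P ^^ n) (\<lambda>_. 1) x \<le> c\<^sub>3 * (P ^^ n) (\<lambda>_. 1) y"
    and \<nu>_pos_linear: "pos_linear E V \<nu>"
    and \<nu>_K: "\<nu> (indicator K) = 1"
    and minorization: "\<And>x f. x \<in> K \<Longrightarrow> f \<in> weighted_space E V \<Longrightarrow> (\<And>y. y \<in> space E \<Longrightarrow> 0 \<le> f y) \<Longrightarrow>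
          c\<^sub>1 * \<nu> f \<le> (P ^^ n\<^sub>1) f x"
    and aperiodic: "\<And>n. N \<le> n \<Longrightarrow> 0 < \<nu> ((P ^^ n) (indicator K))"
begin

abbreviation D :: "('a \<Rightarrow> real) set" where "D \<equiv> weighted_space E V"

definition survival :: "nat \<Rightarrow> 'a \<Rightarrow> real" where "survival n = (P ^^ n) (\<lambda>_. 1)"

text \<open>
  The normalization: by (E3), \<open>s n\<close> is within a factor \<open>c\<^sub>3\<close> of the survival probability from any
  point of \<open>K\<close>.
\<close>

definition s :: "nat \<Rightarrow> real" where "s n = survival n z"

text \<open>
  Visits to \<open>K\<close> before time \<open>k\<close>. The weight is the factor by which the Lyapunov inequality reduces, until time
  \<open>k\<close>, the \<open>V\<close>-mass that a visit at time \<open>j\<close> may add.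
\<close>

definition occupation :: "nat \<Rightarrow> 'a \<Rightarrow> real" where
  "occupation k x = (\<Sum>j<k. \<theta>\<^sub>1 ^ (k - 1 - j) * (P ^^ j) (indicator K) x)"

lemma K_subset: "x \<in> K \<Longrightarrow> x \<in> space E"
  using sets.sets_into_space[OF K_sets] by auto

lemma z_space: "z \<in> space E"
  using K_subset z_in_K by blast

lemma V_weighted: "V \<in> D"
  using V_measurable V_ge_1 by (intro weighted_spaceI[where c = 1]) force+

lemma one_weighted: "(\<lambda>_. 1) \<in> D"
  by (rule weighted_space_bounded[where c = 1]) (auto simp: V_ge_1)

lemma indicator_weighted: "A \<in> sets E \<Longrightarrow> indicator A \<in> D"
  by (rule weighted_space_bounded[where c = 1]) (auto simp: V_ge_1 indicator_def)

lemma indicator_K_weighted: "indicator K \<in> D"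
  by (rule indicator_weighted[OF K_sets])

lemma \<psi>_weighted: "\<psi> \<in> D"
  by (rule weighted_space_bounded[where c = 1]) (auto simp: V_ge_1 \<psi>_measurable \<psi>_nonneg \<psi>_le_1)

lemma V_nonneg: "x \<in> space E \<Longrightarrow> 0 \<le> V x"
  using V_ge_1 by force

lemma iter_weighted: "f \<in> D \<Longrightarrow> (P ^^ n) f \<in> D"
  by (induction n) (auto intro: P_weighted)

lemma pos_linear_iter: "pos_linear E V p \<Longrightarrow> pos_linear E V (\<lambda>f. p ((P ^^ n) f))"
proof (induction n arbitrary: p)
  case (Suc n)
  show ?case
    using Suc.IH[OF pos_linear_compose[OF Suc.prems P_pos_linear P_weighted]] by simp
qed simp

lemma iter_pos_linear: "x \<in> space E \<Longrightarrow> pos_linear E V (\<lambda>f. (P ^^ n) f x)"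
  by (rule pos_linear_iter[OF pos_linear_eval])

lemma iter_add: "(P ^^ (m + n)) f = (P ^^ m) ((P ^^ n) f)"
  by (simp add: funpow_add)

lemma survival_weighted: "survival n \<in> D"
  by (simp add: survival_def iter_weighted one_weighted)

lemma iter_survival: "(P ^^ n) (survival r) = survival (n + r)"
  by (simp add: survival_def iter_add)

lemma P_survival: "P (survival r) = survival (Suc r)"
  using iter_survival[of 1 r] by simp

lemma survival_0: "survival 0 x = 1"
  by (simp add: survival_def)

lemma s_0: "s 0 = 1"
  by (simp add: s_def survival_0)

lemma iter_\<psi>: "x \<in> space E \<Longrightarrow> \<theta>\<^sub>2 ^ n * \<psi> x \<le> (P ^^ n) \<psi> x"
proof (induction n arbitrary: x)
  case (Suc n)
  have "P (\<lambda>y. \<theta>\<^sub>2 ^ n * \<psi> y) x \<le> P ((P ^^ n) \<psi>) x"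
    using Suc by (intro pos_linear_mono[OF P_pos_linear] weighted_space_scale iter_weighted \<psi>_weighted)
  then have "\<theta>\<^sub>2 ^ n * P \<psi> x \<le> P ((P ^^ n) \<psi>) x"
    using Suc.prems by (simp add: pos_linear_scale[OF P_pos_linear] \<psi>_weighted)
  moreover have "\<theta>\<^sub>2 ^ n * (\<theta>\<^sub>2 * \<psi> x) \<le> \<theta>\<^sub>2 ^ n * P \<psi> x"
    using P_\<psi>[OF Suc.prems] constants by (intro mult_left_mono) auto
  ultimately show ?case by (simp add: mult_ac)
qed simp

lemma survival_ge_\<psi>:
  assumes "x \<in> space E" shows "\<theta>\<^sub>2 ^ n * \<psi> x \<le> survival n x"
  using iter_\<psi>[OF assms, of n]
    pos_linear_mono[OF iter_pos_linear[OF assms] \<psi>_weighted one_weighted \<psi>_le_1, of n]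
  by (simp add: survival_def)

lemma survival_nonneg: "x \<in> space E \<Longrightarrow> 0 \<le> survival n x"
  unfolding survival_def by (rule pos_linear_nonneg[OF iter_pos_linear one_weighted]) auto

lemma survival_pos: "x \<in> space E \<Longrightarrow> 0 < \<psi> x \<Longrightarrow> 0 < survival n x"
  using survival_ge_\<psi>[of x n] constants
  by (meson less_le_trans mult_pos_pos order.strict_trans zero_less_power)

lemma s_pos: "0 < s n"
  using survival_pos[OF z_space] \<psi>_on_K[OF z_in_K] constants by (simp add: s_def)

lemma survival_Suc_le: "x \<in> space E \<Longrightarrow> survival (Suc n) x \<le> survival n x"
  using pos_linear_mono[OF iter_pos_linear P_weighted[OF one_weighted] one_weighted P_one, of x n]
  by (simp add: survival_def funpow_swap1)

lemma survival_decreasing: "x \<in> space E \<Longrightarrow> n \<le> k \<Longrightarrow> survival k x \<le> survival n x"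
  by (rule lift_Suc_antimono_le[of "\<lambda>n. survival n x"]) (simp_all add: survival_Suc_le)

lemma s_decreasing: "n \<le> k \<Longrightarrow> s k \<le> s n"
  by (simp add: s_def survival_decreasing z_space)

lemma survival_le_s: "x \<in> K \<Longrightarrow> survival n x \<le> c\<^sub>3 * s n"
  using survival_comparable[OF _ z_in_K] by (simp add: survival_def s_def)

lemma s_le_survival: "x \<in> K \<Longrightarrow> s n \<le> c\<^sub>3 * survival n x"
  using survival_comparable[OF z_in_K] by (simp add: survival_def s_def)

lemma c3_ge_1: "1 \<le> c\<^sub>3"
  using survival_le_s[OF z_in_K, of 0] by (simp add: survival_0 s_0)

lemma occupation_weighted: "occupation k \<in> D"
  unfolding occupation_def[abs_def]
  by (intro weighted_space_sum weighted_space_scale iter_weighted indicator_K_weighted)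

lemma iter_V_le:
  assumes x: "x \<in> space E"
  shows "(P ^^ k) V x \<le> \<theta>\<^sub>1 ^ k * V x + c\<^sub>2 * occupation k x"
proof (induction k)
  case (Suc k)
  have "(P ^^ Suc k) V x = (P ^^ k) (P V) x" by (simp add: funpow_swap1)
  also have "\<dots> \<le> (P ^^ k) (\<lambda>y. \<theta>\<^sub>1 * V y + c\<^sub>2 * indicator K y) x"
    by (intro pos_linear_mono[OF iter_pos_linear[OF x]] P_weighted P_V weighted_space_add
          weighted_space_scale V_weighted indicator_K_weighted)
  also have "\<dots> = \<theta>\<^sub>1 * (P ^^ k) V x + c\<^sub>2 * (P ^^ k) (indicator K) x"
    by (rule pos_linear_combination[OF iter_pos_linear[OF x] V_weighted indicator_K_weighted])
  also have "\<dots> \<le> \<theta>\<^sub>1 * (\<theta>\<^sub>1 ^ k * V x + c\<^sub>2 * occupation k x) + c\<^sub>2 * (P ^^ k) (indicator K) x"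
    using Suc.IH constants by simp
  also have "\<dots> = \<theta>\<^sub>1 ^ Suc k * V x + c\<^sub>2 * (\<theta>\<^sub>1 * occupation k x + (P ^^ k) (indicator K) x)"
    by (simp add: algebra_simps)
  also have "\<theta>\<^sub>1 * occupation k x = (\<Sum>j<k. \<theta>\<^sub>1 ^ (k - j) * (P ^^ j) (indicator K) x)"
    unfolding occupation_def sum_distrib_left
  proof (rule sum.cong)
    fix j assume "j \<in> {..<k}"
    then have "k - j = Suc (k - 1 - j)" by auto
    then show "\<theta>\<^sub>1 * (\<theta>\<^sub>1 ^ (k - 1 - j) * (P ^^ j) (indicator K) x) = \<theta>\<^sub>1 ^ (k - j) * (P ^^ j) (indicator K) x"
      by simp
  qed simp
  also have "\<dots> + (P ^^ k) (indicator K) x = occupation (Suc k) x"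
    by (simp add: occupation_def)
  finally show ?case .
qed (simp add: occupation_def)

text \<open>
  Whoever is in \<open>K\<close> at time \<open>j\<close> survives another \<open>r\<close> steps with probability comparable to \<open>s r\<close>.
\<close>

lemma visit_le_survival:
  assumes "x \<in> space E"
  shows "s r * (P ^^ j) (indicator K) x \<le> c\<^sub>3 * survival (j + r) x"
proof -
  have "(P ^^ j) (\<lambda>y. s r * indicator K y) x \<le> (P ^^ j) (\<lambda>y. c\<^sub>3 * survival r y) x"
    using assms s_le_survival c3_ge_1 survival_nonneg
    by (intro pos_linear_mono[OF iter_pos_linear] weighted_space_scale indicator_K_weighted
          survival_weighted) (auto simp: indicator_def)
  then show ?thesis
    using assms by (simp add: pos_linear_scale[OF iter_pos_linear] indicator_K_weighted
        survival_weighted iter_survival)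
qed

text \<open>
  Over \<open>k\<close> steps \<open>P\<^sup>k V(z)\<close> must reach \<open>\<theta>\<^sub>2\<^sup>k \<psi>(z)\<close>, and beyond \<open>\<theta>\<^sub>1\<^sup>k V(z)\<close> it can only gain by visits to \<open>K\<close>.
  Every visit at time \<open>j\<close> is paid for by survival, so if \<open>s (n + j)\<close> stayed below \<open>2 \<theta>\<^sub>1\<^sup>j s n\<close> for all
  \<open>j < k\<close>, the gain would be at most linear in \<open>k\<close> relative to \<open>\<theta>\<^sub>1\<^sup>k\<close>, against the exponential \<open>(\<theta>\<^sub>2/\<theta>\<^sub>1)\<^sup>k\<close>.
\<close>

lemma survival_revival:
  obtains k where "0 < k" "\<And>n. \<exists>j. 0 < j \<and> j < k \<and> 2 * \<theta>\<^sub>1 ^ j * s n \<le> s (n + j)"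
proof -
  define q where "q = \<theta>\<^sub>2 / \<theta>\<^sub>1"
  have q: "1 < q" using constants by (simp add: q_def)
  have \<psi>z: "0 < \<psi> z" using \<psi>_on_K[OF z_in_K] constants by simp
  define b where "b = 2 * c\<^sub>2 * c\<^sub>3 / \<theta>\<^sub>1"
  have "filterlim (\<lambda>k::nat. q ^ k * \<psi> z - b * real k) at_top at_top"
    using q \<psi>z by real_asymp
  then have "eventually (\<lambda>k::nat. q ^ k * \<psi> z - b * real k > V z) at_top"
    by (simp add: filterlim_at_top_dense)
  then have "eventually (\<lambda>k::nat. 0 < k \<and> q ^ k * \<psi> z - b * real k > V z) at_top"
    using eventually_gt_at_top[of 0] by eventually_elim simp
  then obtain k where k: "0 < k" "q ^ k * \<psi> z - b * real k > V z"
    by (auto simp: eventually_at_top_linorder)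
  have "\<exists>j. 0 < j \<and> j < k \<and> 2 * \<theta>\<^sub>1 ^ j * s n \<le> s (n + j)" for n
  proof (rule ccontr)
    assume "\<not> ?thesis"
    then have small: "s (n + j) \<le> 2 * \<theta>\<^sub>1 ^ j * s n" if "j < k" for j
      using that s_pos[of n] by (cases "j = 0") (auto simp: not_le dest: less_imp_le)
    have "\<theta>\<^sub>2 ^ k * \<psi> z \<le> (P ^^ k) V z"
      using iter_\<psi>[OF z_space, of k] order_trans[OF \<psi>_le_1 V_ge_1]
        pos_linear_mono[OF iter_pos_linear[OF z_space] \<psi>_weighted V_weighted, of k] by force
    also note iter_V_le[OF z_space]
    finally have "s n * (\<theta>\<^sub>2 ^ k * \<psi> z) \<le> s n * (\<theta>\<^sub>1 ^ k * V z + c\<^sub>2 * occupation k z)"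
      using s_pos[of n] by simp
    moreover have "s n * occupation k z \<le> (\<Sum>j<k. 2 * c\<^sub>3 * \<theta>\<^sub>1 ^ (k - 1) * s n)"
      unfolding occupation_def sum_distrib_left
    proof (rule sum_mono)
      fix j assume j: "j \<in> {..<k}"
      have "\<theta>\<^sub>1 ^ (k - 1 - j) * (s n * (P ^^ j) (indicator K) z) \<le> \<theta>\<^sub>1 ^ (k - 1 - j) * (c\<^sub>3 * s (j + n))"
        using visit_le_survival[OF z_space, of n j] constants by (intro mult_left_mono) (auto simp: s_def)
      also have "\<dots> \<le> \<theta>\<^sub>1 ^ (k - 1 - j) * (c\<^sub>3 * (2 * \<theta>\<^sub>1 ^ j * s n))"
        using small[of j] j constants c3_ge_1 by (intro mult_left_mono) (auto simp: add.commute)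
      also have "\<dots> = 2 * c\<^sub>3 * (\<theta>\<^sub>1 ^ (k - 1 - j) * \<theta>\<^sub>1 ^ j) * s n" by simp
      also have "\<theta>\<^sub>1 ^ (k - 1 - j) * \<theta>\<^sub>1 ^ j = \<theta>\<^sub>1 ^ (k - 1)"
        using j by (simp flip: power_add)
      finally show "s n * (\<theta>\<^sub>1 ^ (k - 1 - j) * (P ^^ j) (indicator K) z) \<le> 2 * c\<^sub>3 * \<theta>\<^sub>1 ^ (k - 1) * s n"
        by (simp add: mult_ac)
    qed
    then have "c\<^sub>2 * (s n * occupation k z) \<le> c\<^sub>2 * (real k * (2 * c\<^sub>3 * \<theta>\<^sub>1 ^ (k - 1) * s n))"
      using constants by (intro mult_left_mono) auto
    ultimately have "s n * (\<theta>\<^sub>2 ^ k * \<psi> z) \<le> s n * (\<theta>\<^sub>1 ^ k * V z + c\<^sub>2 * (real k * (2 * c\<^sub>3 * \<theta>\<^sub>1 ^ (k - 1))))"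
      by (simp add: algebra_simps)
    then have "\<theta>\<^sub>2 ^ k * \<psi> z \<le> \<theta>\<^sub>1 ^ k * V z + c\<^sub>2 * (real k * (2 * c\<^sub>3 * \<theta>\<^sub>1 ^ (k - 1)))"
      using s_pos[of n] by simp
    also have "\<theta>\<^sub>1 ^ (k - 1) = \<theta>\<^sub>1 ^ k / \<theta>\<^sub>1"
      using k constants by (simp add: power_diff)
    finally have "\<theta>\<^sub>2 ^ k * \<psi> z \<le> \<theta>\<^sub>1 ^ k * (V z + b * real k)"
      by (simp add: b_def algebra_simps)
    then have "q ^ k * \<psi> z \<le> V z + b * real k"
      using constants by (simp add: q_def power_divide field_simps)
    with k show False by simp
  qed
  with k(1) that show thesis by blast
qed

text \<open>
  The survival probability \<open>s\<close> decays at a rate strictly slower than \<open>\<theta>\<^sub>1\<close>: by \<open>survival_revival\<close> the ratio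
  \<open>s (n + i) / \<theta>\<^sub>1\<^sup>i\<close> doubles after fewer than \<open>k\<close> steps, again and again, and \<open>s\<close> is decreasing in between.
\<close>

lemma survival_growth:
  obtains a \<tau> where "1 \<le> a" "0 < \<tau>" "\<tau> < 1" "\<And>n i. \<theta>\<^sub>1 ^ i * s n \<le> a * \<tau> ^ i * s (n + i)"
proof -
  obtain k where k: "0 < k" "\<And>n. \<exists>j. 0 < j \<and> j < k \<and> 2 * \<theta>\<^sub>1 ^ j * s n \<le> s (n + j)"
    using survival_revival by metis
  \<comment> \<open>As \<open>\<tau>\<^sup>k = 1/2\<close>, doubling within fewer than \<open>k\<close> steps is worth a factor \<open>1/\<tau>\<close> for each of them.\<close>
  define \<tau> :: real where "\<tau> = (1/2) powr (1 / real k)"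
  have \<tau>_pos: "0 < \<tau>" by (simp add: \<tau>_def)
  have \<tau>k: "\<tau> ^ k = 1/2"
    using k(1) \<tau>_pos by (simp add: \<tau>_def powr_powr flip: powr_realpow)
  have \<tau>: "0 < \<tau>" "\<tau> < 1"
    using \<tau>_pos \<tau>k one_le_power[of \<tau> k] by (auto simp: not_less[symmetric])
  define b where "b = max 1 (1 / \<theta>\<^sub>1)"
  have b: "1 \<le> b" "1 \<le> b * \<theta>\<^sub>1" using constants by (auto simp: b_def max_def field_simps)
  define a where "a = b ^ k / \<tau> ^ k"
  have a: "1 \<le> a" unfolding a_def \<tau>k using one_le_power[OF b(1), of k] by simp
  have half: "1/2 \<le> \<tau> ^ j" if "j < k" for j
    using power_decreasing[of j k \<tau>] that \<tau> \<tau>k by simp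
  have "\<theta>\<^sub>1 ^ i * s n \<le> a * \<tau> ^ i * s (n + i)" for n i
  proof (induction i arbitrary: n rule: less_induct)
    case (less i)
    obtain j where j: "0 < j" "j < k" "2 * \<theta>\<^sub>1 ^ j * s n \<le> s (n + j)" using k(2) by blast
    show ?case
    proof (cases "i \<le> j")
      case True
      have "\<theta>\<^sub>1 ^ i * s n \<le> \<theta>\<^sub>1 ^ i * s n * (b * \<theta>\<^sub>1) ^ (j - i)"
        using mult_left_mono[OF one_le_power[OF b(2), of "j - i"], of "\<theta>\<^sub>1 ^ i * s n"] s_pos[of n] constants
        by simp
      also have "\<dots> = b ^ (j - i) * (\<theta>\<^sub>1 ^ (i + (j - i)) * s n)"
        by (simp add: power_mult_distrib power_add mult_ac)
      also have "\<dots> \<le> b ^ k * s (n + j)"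
        using j True s_pos[of n] s_pos[of "n + j"] b constants
        by (intro mult_mono power_increasing) auto
      also have "\<dots> \<le> b ^ k * s (n + i)"
        using True b by (intro mult_left_mono s_decreasing) auto
      also have "b ^ k \<le> a * \<tau> ^ i"
        using power_decreasing[of i k \<tau>] True j \<tau> b by (simp add: a_def field_simps)
      finally show ?thesis using s_pos[of "n + i"] by simp
    next
      case False
      then have i: "i = j + (i - j)" by simp
      have "\<theta>\<^sub>1 ^ i * s n = \<theta>\<^sub>1 ^ (i - j) * (\<theta>\<^sub>1 ^ j * s n)"
        by (subst i) (simp only: power_add mult_ac)
      also have "\<dots> \<le> \<theta>\<^sub>1 ^ (i - j) * (\<tau> ^ j * s (n + j))"
      proof -
        have "\<theta>\<^sub>1 ^ j * s n \<le> 1/2 * s (n + j)" using j by simp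
        also have "\<dots> \<le> \<tau> ^ j * s (n + j)" using half[OF j(2)] s_pos[of "n + j"] by (intro mult_right_mono) auto
        finally show ?thesis using constants by (intro mult_left_mono) auto
      qed
      also have "\<dots> = \<tau> ^ j * (\<theta>\<^sub>1 ^ (i - j) * s (n + j))" by simp
      also have "\<dots> \<le> \<tau> ^ j * (a * \<tau> ^ (i - j) * s (n + j + (i - j)))"
        using False j \<tau> by (intro mult_left_mono less.IH) auto
      also have "\<dots> = a * \<tau> ^ (j + (i - j)) * s (n + (j + (i - j)))"
        by (simp only: power_add mult_ac add.assoc)
      finally show ?thesis using i by simp
    qed
  qed
  with a \<tau> that show thesis by blast
qed

end

section \<open>Contraction of antisymmetric functions\<close>

context lyapunov_doeblin_operator
begin

text \<open>
  \<open>hit t x\<close> is the probability that \<open>K\<close> is visited at one of the times \<open>0, \<dots>, t\<close>.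
\<close>

primrec hit :: "nat \<Rightarrow> 'a \<Rightarrow> real" where
  "hit 0 = indicator K"
| "hit (Suc t) = (\<lambda>x. indicator K x + (1 - indicator K x) * P (hit t) x)"

lemma hit_weighted: "hit t \<in> D"
proof (induction t)
  case (Suc t)
  have "(\<lambda>x. (1 - indicator K x) * P (hit t) x) \<in> D"
    using K_sets by (intro weighted_space_mult_bounded P_weighted Suc) (auto simp: indicator_def)
  then show ?case
    using weighted_space_add[OF indicator_K_weighted] by simp
qed (simp add: indicator_K_weighted)

text \<open>
  (E1) is used twice: the first \<open>n\<^sub>1\<close> steps reset the starting point in \<open>K\<close> to \<open>\<nu>\<close>, after which \<open>K\<close> is charged at
  every late time, and the last \<open>n\<^sub>1\<close> steps produce \<open>\<nu>\<close> again. In this way every late time is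
  reached, and not just multiples of \<open>n\<^sub>1\<close>.
\<close>

lemma iter_minorization:
  assumes n: "n\<^sub>1 + n\<^sub>1 + N \<le> n"
  obtains \<kappa> where "0 < \<kappa>"
    "\<And>x f. x \<in> K \<Longrightarrow> f \<in> D \<Longrightarrow> (\<And>y. y \<in> space E \<Longrightarrow> 0 \<le> f y) \<Longrightarrow> \<kappa> * \<nu> f \<le> (P ^^ n) f x"
proof -
  define k where "k = n - n\<^sub>1 - n\<^sub>1"
  have nk: "n = n\<^sub>1 + (k + n\<^sub>1)" "N \<le> k" using n by (auto simp: k_def)
  show thesis
  proof (rule that)
    show "0 < c\<^sub>1 * c\<^sub>1 * \<nu> ((P ^^ k) (indicator K))"
      using aperiodic[OF nk(2)] constants by simp
    fix x f assume x: "x \<in> K" and f: "f \<in> D" and f0: "\<And>y. y \<in> space E \<Longrightarrow> 0 \<le> f y"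
    have nonneg: "0 \<le> (P ^^ i) g y" if "g \<in> D" "\<And>y. y \<in> space E \<Longrightarrow> 0 \<le> g y" "y \<in> space E" for i g y
      using pos_linear_nonneg[OF iter_pos_linear] that by blast
    have "c\<^sub>1 * \<nu> f * indicator K y \<le> (P ^^ n\<^sub>1) f y" if "y \<in> space E" for y
      using minorization[OF _ f f0] nonneg[OF f f0 that] by (auto simp: indicator_def)
    then have "\<nu> ((P ^^ k) (\<lambda>y. c\<^sub>1 * \<nu> f * indicator K y)) \<le> \<nu> ((P ^^ k) ((P ^^ n\<^sub>1) f))"
      by (intro pos_linear_mono[OF pos_linear_iter[OF \<nu>_pos_linear]] iter_weighted f
           weighted_space_scale indicator_K_weighted)
    then have "c\<^sub>1 * (c\<^sub>1 * \<nu> f * \<nu> ((P ^^ k) (indicator K))) \<le> c\<^sub>1 * \<nu> ((P ^^ (k + n\<^sub>1)) f)"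
      using constants by (simp add: pos_linear_scale[OF pos_linear_iter[OF \<nu>_pos_linear]]
          indicator_K_weighted iter_add)
    also have "\<dots> \<le> (P ^^ n) f x"
      unfolding nk(1) iter_add[of n\<^sub>1]
      by (intro minorization x iter_weighted f nonneg f0)
    finally show "c\<^sub>1 * c\<^sub>1 * \<nu> ((P ^^ k) (indicator K)) * \<nu> f \<le> (P ^^ n) f x"
      by (simp add: mult_ac)
  qed
qed

text \<open>
  After a first visit to \<open>K\<close> at some time in \<open>0, \<dots>, T\<close>, between \<open>n\<^sub>1 + n\<^sub>1 + N\<close> and \<open>n\<^sub>1 + n\<^sub>1 + N + T\<close> steps remain. Only finitely many constants of \<open>iter_minorization\<close> are involved, so their minimum serves.
\<close>

lemma hit_minorization:
  obtains \<kappa> where "0 < \<kappa>"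
    "\<And>x f. x \<in> space E \<Longrightarrow> f \<in> D \<Longrightarrow> (\<And>y. y \<in> space E \<Longrightarrow> 0 \<le> f y) \<Longrightarrow>
       \<kappa> * \<nu> f * hit T x \<le> (P ^^ (n\<^sub>1 + n\<^sub>1 + N + T)) f x"
proof -
  define N\<^sub>0 where "N\<^sub>0 = n\<^sub>1 + n\<^sub>1 + N"
  have "\<forall>n\<in>{N\<^sub>0..N\<^sub>0 + T}. \<exists>\<kappa>>0. \<forall>x f. x \<in> K \<longrightarrow> f \<in> D \<longrightarrow> (\<forall>y\<in>space E. 0 \<le> f y) \<longrightarrow> \<kappa> * \<nu> f \<le> (P ^^ n) f x"
  proof
    fix n assume "n \<in> {N\<^sub>0..N\<^sub>0 + T}"
    then have "n\<^sub>1 + n\<^sub>1 + N \<le> n" by (simp add: N\<^sub>0_def)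
    then show "\<exists>\<kappa>>0. \<forall>x f. x \<in> K \<longrightarrow> f \<in> D \<longrightarrow> (\<forall>y\<in>space E. 0 \<le> f y) \<longrightarrow> \<kappa> * \<nu> f \<le> (P ^^ n) f x"
      by (rule iter_minorization) blast
  qed
  then obtain k where k: "\<And>n. n \<in> {N\<^sub>0..N\<^sub>0 + T} \<Longrightarrow> 0 < k n"
    "\<And>n x f. n \<in> {N\<^sub>0..N\<^sub>0 + T} \<Longrightarrow> x \<in> K \<Longrightarrow> f \<in> D \<Longrightarrow> (\<forall>y\<in>space E. 0 \<le> f y) \<Longrightarrow> k n * \<nu> f \<le> (P ^^ n) f x"
    by (metis (no_types, lifting))
  define \<kappa> where "\<kappa> = Min (k ` {N\<^sub>0..N\<^sub>0 + T})"
  have \<kappa>_pos: "0 < \<kappa>" using k(1) by (simp add: \<kappa>_def)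
  show thesis
  proof (rule that[OF \<kappa>_pos])
    fix x f assume x: "x \<in> space E" and f: "f \<in> D" and f0: "\<And>y. y \<in> space E \<Longrightarrow> 0 \<le> f y"
    have \<nu>f: "0 \<le> \<nu> f" by (rule pos_linear_nonneg[OF \<nu>_pos_linear f f0])
    have on_K: "\<kappa> * \<nu> f \<le> (P ^^ n) f x" if "n \<in> {N\<^sub>0..N\<^sub>0 + T}" "x \<in> K" for n x
    proof -
      have "\<kappa> \<le> k n" using that by (simp add: \<kappa>_def)
      then have "\<kappa> * \<nu> f \<le> k n * \<nu> f" using \<nu>f by (rule mult_right_mono)
      also have "\<dots> \<le> (P ^^ n) f x" using k(2)[OF that f] f0 by blast
      finally show ?thesis .
    qed
    have "\<kappa> * \<nu> f * hit t x \<le> (P ^^ n) f x" if "x \<in> space E" "N\<^sub>0 + t \<le> n" "n \<le> N\<^sub>0 + T" for t n x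
      using that
    proof (induction t arbitrary: n x)
      case 0
      then show ?case
        using on_K[of n x] pos_linear_nonneg[OF iter_pos_linear f f0] by (simp add: indicator_def)
    next
      case (Suc t)
      show ?case
      proof (cases "x \<in> K")
        case True
        then show ?thesis using on_K[of n x] Suc.prems by simp
      next
        case False
        obtain n' where n': "n = Suc n'" using Suc.prems by (cases n) auto
        have "P (\<lambda>y. \<kappa> * \<nu> f * hit t y) x \<le> P ((P ^^ n') f) x"
          using Suc.prems n' by (intro pos_linear_mono[OF P_pos_linear] weighted_space_scale hit_weighted
              iter_weighted f Suc.IH) auto
        then show ?thesis
          using False Suc.prems n' by (simp add: pos_linear_scale[OF P_pos_linear] hit_weighted)
      qed
    qed
    from this[of x T "N\<^sub>0 + T"] x show "\<kappa> * \<nu> f * hit T x \<le> (P ^^ (n\<^sub>1 + n\<^sub>1 + N + T)) f x"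
      by (simp add: N\<^sub>0_def)
  qed
qed

text \<open>
  The weight on pairs that contracts; \<open>r\<close> is the number of steps that remain.
\<close>

definition pair_weight :: "real \<Rightarrow> nat \<Rightarrow> 'a \<Rightarrow> 'a \<Rightarrow> real" where
  "pair_weight A r x y =
     s r * (V x * survival r y + survival r x * V y) + A * (survival r x * survival r y)"

context
  fixes a \<tau> :: real
  assumes a: "1 \<le> a" and \<tau>: "0 < \<tau>" "\<tau> < 1"
    and growth: "\<And>n i. \<theta>\<^sub>1 ^ i * s n \<le> a * \<tau> ^ i * s (n + i)"
begin

definition c\<^sub>L :: real where "c\<^sub>L = c\<^sub>2 * c\<^sub>3 * a / (\<theta>\<^sub>1 * (1 - \<tau>))"

lemma c\<^sub>L_pos: "0 < c\<^sub>L"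
  using a \<tau> constants c3_ge_1 by (auto simp: c\<^sub>L_def)

text \<open>
  The growth bound turns the weights \<open>\<theta>\<^sub>1\<^sup>T\<^sup>-\<^sup>j s\<^sub>r\<close> into a geometric sequence times \<open>s\<^sub>r\<^sub>+\<^sub>T\<^sub>-\<^sub>j\<close>, and a
  visit to \<open>K\<close> at time \<open>j\<close> followed by \<open>r + T - j\<close> steps of survival is a part of the survival up to time \<open>T + r\<close>. Hence
  the constant depends neither on \<open>T\<close> nor on \<open>r\<close>.
\<close>

lemma occupation_le_survival:
  assumes x: "x \<in> space E"
  shows "s r * (c\<^sub>2 * occupation T x) \<le> c\<^sub>L * survival (T + r) x"
proof -
  have "\<theta>\<^sub>1 * (s r * occupation T x) \<le> (\<Sum>j<T. a * c\<^sub>3 * survival (T + r) x * \<tau> ^ (T - 1 - j))"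
    unfolding occupation_def sum_distrib_left
  proof (rule sum_mono)
    fix j assume j: "j \<in> {..<T}"
    then have Tj: "T - j = Suc (T - 1 - j)" by auto
    have visit: "0 \<le> (P ^^ j) (indicator K) x"
      by (rule pos_linear_nonneg[OF iter_pos_linear[OF x] indicator_K_weighted]) simp
    have "\<theta>\<^sub>1 * (s r * (\<theta>\<^sub>1 ^ (T - 1 - j) * (P ^^ j) (indicator K) x))
        = \<theta>\<^sub>1 ^ (T - j) * s r * (P ^^ j) (indicator K) x"
      unfolding Tj by simp
    also have "\<dots> \<le> a * \<tau> ^ (T - j) * s (r + (T - j)) * (P ^^ j) (indicator K) x"
      by (intro mult_right_mono growth visit)
    also have "\<dots> = a * \<tau> ^ (T - j) * (s (r + (T - j)) * (P ^^ j) (indicator K) x)" by simp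
    also have "\<dots> \<le> a * \<tau> ^ (T - j) * (c\<^sub>3 * survival (j + (r + (T - j))) x)"
      using a \<tau> by (intro mult_left_mono visit_le_survival x) auto
    also have "j + (r + (T - j)) = T + r" using j by auto
    also have "a * \<tau> ^ (T - j) * (c\<^sub>3 * survival (T + r) x) \<le> a * \<tau> ^ (T - 1 - j) * (c\<^sub>3 * survival (T + r) x)"
      using a \<tau> c3_ge_1 survival_nonneg[OF x]
      by (intro mult_right_mono mult_left_mono power_decreasing) auto
    finally show "\<theta>\<^sub>1 * (s r * (\<theta>\<^sub>1 ^ (T - 1 - j) * (P ^^ j) (indicator K) x))
        \<le> a * c\<^sub>3 * survival (T + r) x * \<tau> ^ (T - 1 - j)" by (simp add: mult_ac)
  qed
  also have "\<dots> = a * c\<^sub>3 * survival (T + r) x * (\<Sum>j<T. \<tau> ^ (T - 1 - j))"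
    by (simp add: sum_distrib_left)
  also have "\<dots> \<le> a * c\<^sub>3 * survival (T + r) x * (1 / (1 - \<tau>))"
    using a c3_ge_1 survival_nonneg[OF x] by (intro mult_left_mono geometric_sum_le \<tau>) auto
  finally have "s r * occupation T x \<le> a * c\<^sub>3 * survival (T + r) x * (1 / (1 - \<tau>)) / \<theta>\<^sub>1"
    using constants by (simp only: pos_le_divide_eq mult.commute)
  then have "c\<^sub>2 * (s r * occupation T x) \<le> c\<^sub>2 * (a * c\<^sub>3 * survival (T + r) x * (1 / (1 - \<tau>)) / \<theta>\<^sub>1)"
    using constants by (intro mult_left_mono) auto
  then show ?thesis by (simp add: c\<^sub>L_def mult_ac)
qed

lemma normalized_lyapunov:
  assumes x: "x \<in> space E"
  shows "s r * (P ^^ T) V x \<le> a * \<tau> ^ T * (s (r + T) * V x) + c\<^sub>L * survival (T + r) x"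
proof -
  have "s r * (P ^^ T) V x \<le> s r * (\<theta>\<^sub>1 ^ T * V x + c\<^sub>2 * occupation T x)"
    using iter_V_le[OF x] s_pos[of r] by (intro mult_left_mono) auto
  also have "\<dots> = \<theta>\<^sub>1 ^ T * s r * V x + s r * (c\<^sub>2 * occupation T x)" by (simp add: algebra_simps)
  also have "\<dots> \<le> a * \<tau> ^ T * s (r + T) * V x + c\<^sub>L * survival (T + r) x"
    by (intro add_mono mult_right_mono growth occupation_le_survival V_nonneg x)
  finally show ?thesis by (simp add: mult_ac)
qed

definition c\<^sub>U :: real where "c\<^sub>U = c\<^sub>3 * a / (1 - \<tau>)"

lemma c\<^sub>U_pos: "0 < c\<^sub>U"
  using a \<tau> c3_ge_1 by (auto simp: c\<^sub>U_def)

text \<open>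
  Off \<open>K\<close> the function \<open>V\<close> decays at rate \<open>\<theta>\<^sub>1\<close>, faster than \<open>s\<close>, and in \<open>K\<close> survival is comparable to
  \<open>s\<close>. So a starting point can exceed \<open>s\<^sub>r\<close> only in proportion to its \<open>V\<close>.
\<close>

lemma survival_le_V:
  assumes x: "x \<in> space E"
  shows "survival r x \<le> c\<^sub>U * s r * V x"
proof -
  define b where "b r = (\<Sum>j<Suc r. \<theta>\<^sub>1 ^ (Suc r - 1 - j) * s j)" for r
  have b_Suc: "b (Suc r) = \<theta>\<^sub>1 * b r + s (Suc r)" for r
  proof -
    have "\<theta>\<^sub>1 * b r = (\<Sum>j<Suc r. \<theta>\<^sub>1 ^ (Suc r - j) * s j)"
      unfolding b_def sum_distrib_left
    proof (rule sum.cong)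
      fix j assume "j \<in> {..<Suc r}"
      then have "Suc r - j = Suc (Suc r - 1 - j)" by auto
      then show "\<theta>\<^sub>1 * (\<theta>\<^sub>1 ^ (Suc r - 1 - j) * s j) = \<theta>\<^sub>1 ^ (Suc r - j) * s j" by simp
    qed simp
    then show ?thesis by (simp add: b_def)
  qed
  have b_nonneg: "0 \<le> b r" for r
    unfolding b_def using s_pos constants by (intro sum_nonneg) (auto intro: less_imp_le)
  have bound: "survival r x \<le> c\<^sub>3 * b r * V x"
    using x
  proof (induction r arbitrary: x)
    case 0
    then show ?case
      using mult_mono[OF c3_ge_1 V_ge_1[OF 0]] c3_ge_1 by (simp add: b_def s_0 survival_0)
  next
    case (Suc r)
    have mid: "0 \<le> \<theta>\<^sub>1 * b r" using b_nonneg[of r] constants by simp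
    show ?case
    proof (cases "x \<in> K")
      case True
      have "survival (Suc r) x \<le> c\<^sub>3 * s (Suc r)" by (rule survival_le_s[OF True])
      also have "\<dots> \<le> c\<^sub>3 * b (Suc r)" using mid c3_ge_1 by (simp add: b_Suc)
      also have "\<dots> \<le> c\<^sub>3 * b (Suc r) * V x"
        using mult_left_mono[OF V_ge_1[OF Suc.prems], of "c\<^sub>3 * b (Suc r)"] b_nonneg[of "Suc r"] c3_ge_1
        by simp
      finally show ?thesis .
    next
      case False
      have "survival (Suc r) x \<le> P (\<lambda>y. c\<^sub>3 * b r * V y) x"
        unfolding P_survival[symmetric]
        by (intro pos_linear_mono[OF P_pos_linear] survival_weighted weighted_space_scale V_weighted
            Suc.IH Suc.prems)
      also have "\<dots> = c\<^sub>3 * b r * P V x"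
        by (rule pos_linear_scale[OF P_pos_linear[OF Suc.prems] V_weighted])
      also have "\<dots> \<le> c\<^sub>3 * b r * (\<theta>\<^sub>1 * V x)"
        using P_V[OF Suc.prems] False b_nonneg[of r] c3_ge_1 by (intro mult_left_mono) auto
      also have "\<dots> \<le> c\<^sub>3 * b (Suc r) * V x"
        using s_pos[of "Suc r"] c3_ge_1 V_nonneg[OF Suc.prems] by (simp add: b_Suc algebra_simps)
      finally show ?thesis .
    qed
  qed
  have "b r \<le> (\<Sum>j<Suc r. a * s r * \<tau> ^ (Suc r - 1 - j))"
    unfolding b_def
  proof (rule sum_mono)
    fix j assume "j \<in> {..<Suc r}"
    then show "\<theta>\<^sub>1 ^ (Suc r - 1 - j) * s j \<le> a * s r * \<tau> ^ (Suc r - 1 - j)"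
      using growth[of "r - j" j] by (simp add: mult_ac)
  qed
  also have "\<dots> = a * s r * (\<Sum>j<Suc r. \<tau> ^ (Suc r - 1 - j))"
    by (simp only: sum_distrib_left)
  also have "\<dots> \<le> a * s r * (1 / (1 - \<tau>))"
    using a s_pos[of r] by (intro mult_left_mono geometric_sum_le \<tau>) auto
  finally have "c\<^sub>3 * b r * V x \<le> c\<^sub>3 * (a * s r * (1 / (1 - \<tau>))) * V x"
    using c3_ge_1 V_nonneg[OF x] by (intro mult_right_mono mult_left_mono) auto
  with bound show ?thesis by (simp add: c\<^sub>U_def mult_ac)
qed

text \<open>
  Survival for \<open>t + r\<close> steps either avoids \<open>K\<close> for the first \<open>t\<close> steps, where \<open>V\<close> controls it, or visits \<open>K\<close> and then
  survives at least \<open>r\<close> more steps.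
\<close>

lemma survival_le_hit:
  assumes "x \<in> space E"
  shows "survival (t + r) x \<le> c\<^sub>U * s r * \<theta>\<^sub>1 ^ t * V x + c\<^sub>3 * s r * hit t x"
  using assms
proof (induction t arbitrary: x)
  case 0
  then show ?case
    using survival_le_V[OF 0, of r] s_pos[of r] c3_ge_1 by (simp add: indicator_def add_increasing2)
next
  case (Suc t)
  show ?case
  proof (cases "x \<in> K")
    case True
    have "survival (Suc t + r) x \<le> c\<^sub>3 * s (Suc t + r)" by (rule survival_le_s[OF True])
    also have "\<dots> \<le> c\<^sub>3 * s r" using c3_ge_1 by (intro mult_left_mono s_decreasing) auto
    finally show ?thesis
      using True c\<^sub>U_pos s_pos[of r] V_nonneg[OF Suc.prems] constants
      by (simp add: add_increasing)
  next
    case False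
    have "P (survival (t + r)) x \<le> P (\<lambda>y. c\<^sub>U * s r * \<theta>\<^sub>1 ^ t * V y + c\<^sub>3 * s r * hit t y) x"
      by (intro pos_linear_mono[OF P_pos_linear] survival_weighted weighted_space_add weighted_space_scale
          V_weighted hit_weighted Suc.IH Suc.prems)
    also have "\<dots> = c\<^sub>U * s r * \<theta>\<^sub>1 ^ t * P V x + c\<^sub>3 * s r * P (hit t) x"
      by (rule pos_linear_combination[OF P_pos_linear[OF Suc.prems] V_weighted hit_weighted])
    also have "\<dots> \<le> c\<^sub>U * s r * \<theta>\<^sub>1 ^ t * (\<theta>\<^sub>1 * V x) + c\<^sub>3 * s r * P (hit t) x"
      using P_V[OF Suc.prems] False c\<^sub>U_pos s_pos[of r] constants
      by (intro add_right_mono mult_left_mono) auto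
    finally show ?thesis using False by (simp add: P_survival mult_ac)
  qed
qed

text \<open>
  Where \<open>s V \<le> R m\<close>, avoiding \<open>K\<close> for \<open>t\<close> steps accounts for at most half of the survival probability once \<open>t\<close> is
  large, so the probability of hitting \<open>K\<close> is at least of order \<open>m / s\<close>. The sublevel sets of \<open>V\<close> alone would not do:
  a point with small \<open>V\<close> may be arbitrarily unlikely to survive.
\<close>

lemma small_set_minorization:
  assumes R: "0 < R"
  obtains T\<^sub>0 where "\<And>T. T\<^sub>0 \<le> T \<Longrightarrow> \<exists>\<kappa>>0. \<forall>r. \<forall>x\<in>space E. s (T + r) * V x \<le> R * survival (T + r) x \<longrightarrow>
      (\<forall>f\<in>D. (\<forall>y\<in>space E. 0 \<le> f y) \<longrightarrow> \<kappa> * survival (T + r) x * \<nu> f \<le> s (T + r) * (P ^^ T) f x)"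
proof -
  define N\<^sub>0 where "N\<^sub>0 = n\<^sub>1 + n\<^sub>1 + N"
  have "(\<lambda>t. c\<^sub>U * a * R * \<tau> ^ t) \<longlonglongrightarrow> c\<^sub>U * a * R * 0"
    using \<tau> by (intro tendsto_intros LIMSEQ_power_zero) auto
  then have "eventually (\<lambda>t. c\<^sub>U * a * R * \<tau> ^ t < 1/2) at_top"
    by (intro order_tendstoD(2)[where y = 0]) auto
  then obtain t\<^sub>0 where t0: "\<And>t. t\<^sub>0 \<le> t \<Longrightarrow> c\<^sub>U * a * R * \<tau> ^ t < 1/2"
    by (auto simp: eventually_at_top_linorder)
  show thesis
  proof (rule that)
    fix T assume "N\<^sub>0 + t\<^sub>0 \<le> T"
    then obtain t where t: "T = N\<^sub>0 + t" "t\<^sub>0 \<le> t"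
      using le_Suc_ex by (metis add.assoc le_add1)
    obtain \<kappa> where \<kappa>: "0 < \<kappa>" "\<And>x f. x \<in> space E \<Longrightarrow> f \<in> D \<Longrightarrow> (\<And>y. y \<in> space E \<Longrightarrow> 0 \<le> f y) \<Longrightarrow>
       \<kappa> * \<nu> f * hit t x \<le> (P ^^ T) f x"
      using hit_minorization[of t] unfolding t(1) N\<^sub>0_def by metis
    define \<kappa>' where "\<kappa>' = \<kappa> * \<theta>\<^sub>1 ^ t / (2 * c\<^sub>3 * a * \<tau> ^ t)"
    have "0 < \<kappa>'" using \<kappa>(1) constants c3_ge_1 a \<tau> by (simp add: \<kappa>'_def)
    moreover have "\<kappa>' * survival (T + r) x * \<nu> f \<le> s (T + r) * (P ^^ T) f x"
      if x: "x \<in> space E" and small: "s (T + r) * V x \<le> R * survival (T + r) x"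
        and f: "f \<in> D" and f0: "\<forall>y\<in>space E. 0 \<le> f y" for r x f
    proof -
      have shift: "T + r = t + (N\<^sub>0 + r)" by (simp add: t)
      have grow: "\<theta>\<^sub>1 ^ t * s (N\<^sub>0 + r) \<le> a * \<tau> ^ t * s (T + r)"
        using growth[of t "N\<^sub>0 + r"] by (simp add: t add_ac)
      have "survival (T + r) x \<le> c\<^sub>U * s (N\<^sub>0 + r) * \<theta>\<^sub>1 ^ t * V x + c\<^sub>3 * s (N\<^sub>0 + r) * hit t x"
        unfolding shift by (rule survival_le_hit[OF x])
      also have "c\<^sub>U * s (N\<^sub>0 + r) * \<theta>\<^sub>1 ^ t * V x = c\<^sub>U * V x * (\<theta>\<^sub>1 ^ t * s (N\<^sub>0 + r))" by simp
      also have "\<dots> \<le> c\<^sub>U * V x * (a * \<tau> ^ t * s (T + r))"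
        using c\<^sub>U_pos V_nonneg[OF x] by (intro mult_left_mono grow) auto
      also have "\<dots> = c\<^sub>U * a * \<tau> ^ t * (s (T + r) * V x)" by simp
      also have "\<dots> \<le> c\<^sub>U * a * \<tau> ^ t * (R * survival (T + r) x)"
        using c\<^sub>U_pos a \<tau> by (intro mult_left_mono small) auto
      also have "\<dots> = (c\<^sub>U * a * R * \<tau> ^ t) * survival (T + r) x" by simp
      also have "\<dots> \<le> 1/2 * survival (T + r) x"
        using t0[OF t(2)] survival_nonneg[OF x] by (intro mult_right_mono) auto
      finally have half: "survival (T + r) x \<le> 2 * c\<^sub>3 * s (N\<^sub>0 + r) * hit t x" by simp
      have \<nu>f: "0 \<le> \<nu> f" using f f0 by (intro pos_linear_nonneg[OF \<nu>_pos_linear]) auto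
      have "\<theta>\<^sub>1 ^ t * survival (T + r) x \<le> \<theta>\<^sub>1 ^ t * (2 * c\<^sub>3 * s (N\<^sub>0 + r) * hit t x)"
        using half constants by (intro mult_left_mono) auto
      also have "\<dots> = 2 * c\<^sub>3 * hit t x * (\<theta>\<^sub>1 ^ t * s (N\<^sub>0 + r))" by simp
      also have "\<dots> \<le> 2 * c\<^sub>3 * hit t x * (a * \<tau> ^ t * s (T + r))"
      proof (intro mult_left_mono grow)
        have "0 \<le> 2 * c\<^sub>3 * s (N\<^sub>0 + r) * hit t x" using half survival_nonneg[OF x, of "T + r"] by linarith
        moreover have "0 < 2 * c\<^sub>3 * s (N\<^sub>0 + r)" using s_pos[of "N\<^sub>0 + r"] c3_ge_1 by simp
        ultimately have "0 \<le> hit t x" by (metis zero_le_mult_iff not_le)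
        then show "0 \<le> 2 * c\<^sub>3 * hit t x" using c3_ge_1 by simp
      qed
      finally have "\<kappa> * \<nu> f * (\<theta>\<^sub>1 ^ t * survival (T + r) x)
          \<le> \<kappa> * \<nu> f * (2 * c\<^sub>3 * hit t x * (a * \<tau> ^ t * s (T + r)))"
        using \<kappa>(1) \<nu>f by (intro mult_left_mono) auto
      also have "\<dots> = 2 * c\<^sub>3 * a * \<tau> ^ t * s (T + r) * (\<kappa> * \<nu> f * hit t x)" by simp
      also have "\<dots> \<le> 2 * c\<^sub>3 * a * \<tau> ^ t * s (T + r) * (P ^^ T) f x"
        using \<kappa>(2)[OF x f] f0 c3_ge_1 a \<tau> s_pos[of "T + r"] by (intro mult_left_mono) auto
      finally show ?thesis
        using c3_ge_1 a \<tau> by (simp add: \<kappa>'_def field_simps)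
    qed
    ultimately show "\<exists>\<kappa>>0. \<forall>r. \<forall>x\<in>space E. s (T + r) * V x \<le> R * survival (T + r) x \<longrightarrow>
      (\<forall>f\<in>D. (\<forall>y\<in>space E. 0 \<le> f y) \<longrightarrow> \<kappa> * survival (T + r) x * \<nu> f \<le> s (T + r) * (P ^^ T) f x)"
      by blast
  qed
qed

text \<open>
  One round of the argument. The Lyapunov inequality shrinks the mixed terms of the weight to a
  quarter, and adds \<open>2 c\<^sub>L m \<otimes> m\<close>. On pairs of small points this addition is absorbed by the subtracted
  \<open>\<nu> \<otimes> \<nu>\<close> part; on the other pairs \<open>m \<otimes> m\<close> is itself at most \<open>1/(16 c\<^sub>L)\<close> times a mixed term. The order
  of choice matters: \<open>R = 16 c\<^sub>L\<close> first, then \<open>T\<close>, then the minorization constant, and only then \<open>\<epsilon>\<close> and \<open>A\<close>.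
\<close>

lemma contraction_step:
  obtains T \<epsilon> A where "0 < T" "0 < \<epsilon>" "\<epsilon> < 1" "2 * c\<^sub>L \<le> A"
    "\<And>r h B x y. 0 \<le> B \<Longrightarrow> h \<in> D \<Longrightarrow>
      (\<And>x y. x \<in> space E \<Longrightarrow> y \<in> space E \<Longrightarrow>
         \<bar>h x * survival r y - survival r x * h y\<bar> \<le> B * pair_weight A r x y) \<Longrightarrow>
      x \<in> space E \<Longrightarrow> y \<in> space E \<Longrightarrow>
      \<bar>(P ^^ T) h x * survival (T + r) y - survival (T + r) x * (P ^^ T) h y\<bar>
        \<le> (1 - \<epsilon>) * B * pair_weight A (T + r) x y"
proof -
  have "0 < 16 * c\<^sub>L" using c\<^sub>L_pos by simp
  then obtain T\<^sub>0 where T0: "\<And>T. T\<^sub>0 \<le> T \<Longrightarrow> \<exists>\<kappa>>0. \<forall>r. \<forall>x\<in>space E. s (T + r) * V x \<le> 16 * c\<^sub>L * survival (T + r) x \<longrightarrow>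
      (\<forall>f\<in>D. (\<forall>y\<in>space E. 0 \<le> f y) \<longrightarrow> \<kappa> * survival (T + r) x * \<nu> f \<le> s (T + r) * (P ^^ T) f x)"
    using small_set_minorization by metis
  have "(\<lambda>t. a * \<tau> ^ t) \<longlonglongrightarrow> a * 0"
    using \<tau> by (intro tendsto_intros LIMSEQ_power_zero) auto
  then have "eventually (\<lambda>t. a * \<tau> ^ t < 1/4) at_top"
    by (intro order_tendstoD(2)[where y = 0]) auto
  then have "eventually (\<lambda>t. a * \<tau> ^ t < 1/4 \<and> max 1 T\<^sub>0 \<le> t) at_top"
    using eventually_ge_at_top by (rule eventually_conj)
  then obtain T where T: "a * \<tau> ^ T < 1/4" "0 < T" "T\<^sub>0 \<le> T"
    by (auto simp: eventually_at_top_linorder)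
  obtain \<kappa> where \<kappa>: "0 < \<kappa>" "\<And>r x f. x \<in> space E \<Longrightarrow> s (T + r) * V x \<le> 16 * c\<^sub>L * survival (T + r) x \<Longrightarrow>
      f \<in> D \<Longrightarrow> (\<forall>y\<in>space E. 0 \<le> f y) \<Longrightarrow> \<kappa> * survival (T + r) x * \<nu> f \<le> s (T + r) * (P ^^ T) f x"
    using T0[OF T(3)] by blast
  define \<kappa>\<^sub>1 where "\<kappa>\<^sub>1 = min 1 ((\<kappa> / c\<^sub>3)\<^sup>2)"
  have \<kappa>1: "0 < \<kappa>\<^sub>1" "\<kappa>\<^sub>1 \<le> 1" "\<kappa>\<^sub>1 \<le> (\<kappa> / c\<^sub>3)\<^sup>2"
    using \<kappa>(1) c3_ge_1 by (auto simp: \<kappa>\<^sub>1_def)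
  define \<epsilon> where "\<epsilon> = \<kappa>\<^sub>1 / 2"
  define A where "A = 4 * c\<^sub>L / \<kappa>\<^sub>1"
  have A: "A * \<kappa>\<^sub>1 = 4 * c\<^sub>L" using \<kappa>1 by (simp add: A_def)
  have A_pos: "0 < A" using c\<^sub>L_pos \<kappa>1 by (simp add: A_def)
  have \<epsilon>: "0 < \<epsilon>" "\<epsilon> \<le> 1/2" "\<epsilon> * A = 2 * c\<^sub>L" using \<kappa>1 A by (auto simp: \<epsilon>_def mult.commute)
  show thesis
  proof (rule that[OF T(2) \<epsilon>(1)])
    show "\<epsilon> < 1" using \<epsilon>(2) by simp
    show "2 * c\<^sub>L \<le> A" using A \<kappa>1 A_pos c\<^sub>L_pos mult_left_le[of \<kappa>\<^sub>1 A] by linarith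
    fix r h B x y
    assume B: "0 \<le> B" and h: "h \<in> D"
      and bound: "\<And>x y. x \<in> space E \<Longrightarrow> y \<in> space E \<Longrightarrow>
         \<bar>h x * survival r y - survival r x * h y\<bar> \<le> B * pair_weight A r x y"
      and x: "x \<in> space E" and y: "y \<in> space E"
    let ?r = "T + r"
    define small where "small x \<longleftrightarrow> s ?r * V x \<le> 16 * c\<^sub>L * survival ?r x" for x
    \<comment> \<open>The size of the minorization of \<open>P\<^sup>T(x,\<cdot>)\<close> by \<open>\<nu>\<close>; none is available off the small set.\<close>
    define w where "w x = (if small x then \<kappa> * survival ?r x / s ?r else 0)" for x
    have w_nonneg: "0 \<le> w x" if "x \<in> space E" for x
      using \<kappa>(1) survival_nonneg[OF that] s_pos[of ?r] by (simp add: w_def)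
    have w_minorizes: "w x * \<nu> f \<le> (P ^^ T) f x"
      if "x \<in> space E" "f \<in> D" "\<And>y. y \<in> space E \<Longrightarrow> 0 \<le> f y" for x f
      using \<kappa>(2)[OF that(1), of r f] that pos_linear_nonneg[OF iter_pos_linear that(2), of x T] s_pos[of ?r]
      by (auto simp: w_def small_def field_simps)
    have \<nu>_survival: "s ?r \<le> c\<^sub>3 * \<nu> (survival r)"
    proof -
      have "\<nu> (\<lambda>x. s r * indicator K x) \<le> \<nu> (\<lambda>x. c\<^sub>3 * survival r x)"
        using s_le_survival survival_nonneg c3_ge_1
        by (intro pos_linear_mono[OF \<nu>_pos_linear] weighted_space_scale indicator_K_weighted survival_weighted)
           (auto simp: indicator_def)
      then have "s r \<le> c\<^sub>3 * \<nu> (survival r)"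
        by (simp add: pos_linear_scale[OF \<nu>_pos_linear] indicator_K_weighted survival_weighted \<nu>_K)
      moreover have "s ?r \<le> s r" by (rule s_decreasing) simp
      ultimately show ?thesis by simp
    qed
    define v where "v x = B * s r * V x" for x
    have v: "v \<in> D" unfolding v_def by (intro weighted_space_scale V_weighted)
    have v_nonneg: "0 \<le> v x" if "x \<in> space E" for x
      using B s_pos[of r] V_nonneg[OF that] by (simp add: v_def)
    define mx where "mx = survival ?r x"
    define my where "my = survival ?r y"
    define vx where "vx = s ?r * V x"
    define vy where "vy = s ?r * V y"
    have nonneg: "0 \<le> mx" "0 \<le> my" "0 \<le> vx" "0 \<le> vy"
      using survival_nonneg V_nonneg x y s_pos[of ?r] by (auto simp: mx_def my_def vx_def vy_def)
    have Pv: "(P ^^ T) v u \<le> B * (1/4 * (s ?r * V u) + c\<^sub>L * survival ?r u)" if "u \<in> space E" for u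
    proof -
      have "a * \<tau> ^ T * (s (r + T) * V u) \<le> 1/4 * (s (r + T) * V u)"
        using T(1) s_pos[of "r + T"] V_nonneg[OF that] by (intro mult_right_mono) auto
      with normalized_lyapunov[OF that, of r T]
      have "s r * (P ^^ T) V u \<le> 1/4 * (s ?r * V u) + c\<^sub>L * survival ?r u"
        by (simp add: add.commute)
      moreover have "(P ^^ T) v u = B * (s r * (P ^^ T) V u)"
        unfolding v_def using pos_linear_scale[OF iter_pos_linear[OF that] V_weighted] by simp
      ultimately show ?thesis using B by (simp add: mult_left_mono)
    qed
    have "\<bar>(P ^^ T) h x * (P ^^ T) (survival r) y - (P ^^ T) (survival r) x * (P ^^ T) h y\<bar>
        \<le> (P ^^ T) v x * (P ^^ T) (survival r) y + (P ^^ T) (survival r) x * (P ^^ T) v y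
          + B * A * ((P ^^ T) (survival r) x * (P ^^ T) (survival r) y)
          - w x * w y * (2 * (\<nu> v * \<nu> (survival r)) + B * A * (\<nu> (survival r))\<^sup>2)"
    proof (rule antisymmetric_minorization[OF iter_pos_linear[OF x] iter_pos_linear[OF y] \<nu>_pos_linear h
          survival_weighted v])
      fix x y assume "x \<in> space E" "y \<in> space E"
      from bound[OF this] show "\<bar>h x * survival r y - survival r x * h y\<bar>
          \<le> v x * survival r y + survival r x * v y + B * A * (survival r x * survival r y)"
        by (simp add: pair_weight_def v_def algebra_simps)
    qed (use w_nonneg w_minorizes x y in auto)
    then have "\<bar>(P ^^ T) h x * my - mx * (P ^^ T) h y\<bar>
        \<le> (P ^^ T) v x * my + mx * (P ^^ T) v y + B * A * (mx * my)
          - w x * w y * (2 * (\<nu> v * \<nu> (survival r)) + B * A * (\<nu> (survival r))\<^sup>2)"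
      by (simp add: iter_survival mx_def my_def)
    also have "\<dots> \<le> B * (1/4 * vx + c\<^sub>L * mx) * my + mx * (B * (1/4 * vy + c\<^sub>L * my)) + B * A * (mx * my)
          - w x * w y * (B * A * (\<nu> (survival r))\<^sup>2)"
    proof -
      have "(P ^^ T) v x * my \<le> B * (1/4 * vx + c\<^sub>L * mx) * my"
        using Pv[OF x] nonneg by (intro mult_right_mono) (auto simp: vx_def mx_def)
      moreover have "mx * (P ^^ T) v y \<le> mx * (B * (1/4 * vy + c\<^sub>L * my))"
        using Pv[OF y] nonneg by (intro mult_left_mono) (auto simp: vy_def my_def)
      moreover have "w x * w y * (B * A * (\<nu> (survival r))\<^sup>2)
          \<le> w x * w y * (2 * (\<nu> v * \<nu> (survival r)) + B * A * (\<nu> (survival r))\<^sup>2)"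
        using w_nonneg[OF x] w_nonneg[OF y] pos_linear_nonneg[OF \<nu>_pos_linear v v_nonneg]
          pos_linear_nonneg[OF \<nu>_pos_linear survival_weighted survival_nonneg, of r]
        by (intro mult_left_mono) auto
      ultimately show ?thesis by linarith
    qed
    also have "\<dots> = B * (1/4 * (vx * my + mx * vy) + (2 * c\<^sub>L + A) * (mx * my)
          - A * (w x * w y * (\<nu> (survival r))\<^sup>2))"
      by (simp add: algebra_simps)
    also have "\<dots> \<le> B * ((1 - \<epsilon>) * (vx * my + mx * vy) + (1 - \<epsilon>) * A * (mx * my))"
    proof (intro mult_left_mono B)
      have cross: "0 \<le> vx * my" "0 \<le> mx * vy" "0 \<le> mx * my" using nonneg by auto
      have half: "1/2 * (vx * my + mx * vy) \<le> (1 - \<epsilon>) * (vx * my + mx * vy)"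
        using cross \<epsilon>(2) by (intro mult_right_mono) auto
      have split: "(2 * c\<^sub>L + A) * (mx * my) = (1 - \<epsilon>) * A * (mx * my) + 4 * c\<^sub>L * (mx * my)"
        using \<epsilon>(3) by (simp add: algebra_simps)
      have combine: "q + X - W \<le> H + Y" if "X = Y + Z" "Z \<le> W + q" "2 * q \<le> H" for q X Y Z W H :: real
        using that by linarith
      note combine = combine[OF split]
      have half: "2 * (1/4 * (vx * my + mx * vy)) \<le> (1 - \<epsilon>) * (vx * my + mx * vy)" using half by simp
      consider (both) "small x" "small y" | (x) "\<not> small x" | (y) "\<not> small y" by blast
      then show "1/4 * (vx * my + mx * vy) + (2 * c\<^sub>L + A) * (mx * my) - A * (w x * w y * (\<nu> (survival r))\<^sup>2)
          \<le> (1 - \<epsilon>) * (vx * my + mx * vy) + (1 - \<epsilon>) * A * (mx * my)"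
      proof cases
        case both
        have "1 \<le> c\<^sub>3 * \<nu> (survival r) / s ?r"
          using \<nu>_survival s_pos[of ?r] by simp
        then have "1 \<le> (c\<^sub>3 * \<nu> (survival r) / s ?r)\<^sup>2" by (rule one_le_power)
        then have "(\<kappa> / c\<^sub>3)\<^sup>2 * (mx * my) * 1 \<le> (\<kappa> / c\<^sub>3)\<^sup>2 * (mx * my) * (c\<^sub>3 * \<nu> (survival r) / s ?r)\<^sup>2"
          using cross by (intro mult_left_mono) auto
        also have "\<dots> = w x * w y * (\<nu> (survival r))\<^sup>2"
          using both c3_ge_1 s_pos[of ?r] by (simp add: w_def mx_def my_def power2_eq_square field_simps)
        finally have "(\<kappa> / c\<^sub>3)\<^sup>2 * (mx * my) \<le> w x * w y * (\<nu> (survival r))\<^sup>2" by simp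
        moreover have "\<kappa>\<^sub>1 * (mx * my) \<le> (\<kappa> / c\<^sub>3)\<^sup>2 * (mx * my)"
          using \<kappa>1 cross by (intro mult_right_mono) auto
        ultimately have "A * (\<kappa>\<^sub>1 * (mx * my)) \<le> A * (w x * w y * (\<nu> (survival r))\<^sup>2)"
          using A_pos by (intro mult_left_mono) auto
        then have "4 * c\<^sub>L * (mx * my) \<le> A * (w x * w y * (\<nu> (survival r))\<^sup>2)"
          using A by (simp add: mult.assoc[symmetric])
        moreover have "0 \<le> 1/4 * (vx * my + mx * vy)" using cross by simp
        ultimately show ?thesis by (intro combine half) linarith
      next
        case x
        then have "16 * c\<^sub>L * mx \<le> vx" by (simp add: small_def vx_def mx_def)
        then have "16 * c\<^sub>L * mx * my \<le> vx * my" using nonneg by (intro mult_right_mono) auto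
        then have "4 * c\<^sub>L * (mx * my) \<le> 1/4 * (vx * my + mx * vy)" using cross by simp
        moreover have "A * (w x * w y * (\<nu> (survival r))\<^sup>2) = 0" using x by (simp add: w_def)
        ultimately show ?thesis by (intro combine half) linarith
      next
        case y
        then have "16 * c\<^sub>L * my \<le> vy" by (simp add: small_def vy_def my_def)
        then have "mx * (16 * c\<^sub>L * my) \<le> mx * vy" using nonneg by (intro mult_left_mono) auto
        then have "16 * (c\<^sub>L * (mx * my)) \<le> mx * vy" by (simp only: mult_ac)
        moreover have "4 * Z \<le> 1/4 * (p + q)" if "16 * Z \<le> q" "0 \<le> p" for p q Z :: real
          using that by (simp add: field_simps)
        ultimately have "4 * c\<^sub>L * (mx * my) \<le> 1/4 * (vx * my + mx * vy)"
          using cross(1) unfolding mult.assoc by blast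
        moreover have "A * (w x * w y * (\<nu> (survival r))\<^sup>2) = 0" using y by (simp add: w_def)
        ultimately show ?thesis by (intro combine half) linarith
      qed
    qed
    also have "\<dots> = (1 - \<epsilon>) * B * pair_weight A ?r x y"
      by (simp add: pair_weight_def vx_def vy_def mx_def my_def algebra_simps)
    finally show "\<bar>(P ^^ T) h x * survival ?r y - survival ?r x * (P ^^ T) h y\<bar>
        \<le> (1 - \<epsilon>) * B * pair_weight A ?r x y"
      by (simp add: mx_def my_def)
  qed
qed

text \<open>
  Contraction by \<open>1 - \<epsilon>\<close> over \<open>T\<close> steps, iterated. The induction starts at all \<open>r < T\<close>, where the weight already
  dominates by \<open>normalized_lyapunov\<close>; the factor \<open>\<beta>\<^sup>-\<^sup>T\<close> pays for the incomplete round.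
\<close>

lemma geometric_contraction:
  obtains C \<beta> where "0 < C" "0 < \<beta>" "\<beta> < 1"
    "\<And>r f x y. f \<in> borel_measurable E \<Longrightarrow> (\<And>x. x \<in> space E \<Longrightarrow> \<bar>f x\<bar> \<le> V x) \<Longrightarrow> x \<in> space E \<Longrightarrow> y \<in> space E \<Longrightarrow>
      \<bar>(P ^^ r) f x * survival r y - survival r x * (P ^^ r) f y\<bar> \<le> C * \<beta> ^ r * pair_weight 1 r x y"
proof -
  obtain T \<epsilon> A where T: "0 < T" and \<epsilon>: "0 < \<epsilon>" "\<epsilon> < 1" and A: "2 * c\<^sub>L \<le> A" and step:
    "\<And>r h B x y. 0 \<le> B \<Longrightarrow> h \<in> D \<Longrightarrow>
      (\<And>x y. x \<in> space E \<Longrightarrow> y \<in> space E \<Longrightarrow>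
         \<bar>h x * survival r y - survival r x * h y\<bar> \<le> B * pair_weight A r x y) \<Longrightarrow>
      x \<in> space E \<Longrightarrow> y \<in> space E \<Longrightarrow>
      \<bar>(P ^^ T) h x * survival (T + r) y - survival (T + r) x * (P ^^ T) h y\<bar>
        \<le> (1 - \<epsilon>) * B * pair_weight A (T + r) x y"
    using contraction_step by metis
  define \<beta> where "\<beta> = (1 - \<epsilon>) powr (1 / real T)"
  have \<beta>_pos: "0 < \<beta>" using \<epsilon> by (simp add: \<beta>_def)
  have \<beta>T: "\<beta> ^ T = 1 - \<epsilon>"
    using T \<epsilon> \<beta>_pos by (simp add: \<beta>_def powr_powr flip: powr_realpow)
  have \<beta>_less: "\<beta> < 1"
    using \<beta>_pos \<beta>T \<epsilon> one_le_power[of \<beta> T] by (auto simp: not_less[symmetric])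
  have A_pos: "0 < A" using A c\<^sub>L_pos by simp
  define B where "B r = (a + 1) * \<beta> ^ r / \<beta> ^ T" for r
  have B_pos: "0 < B r" for r using a \<beta>_pos by (simp add: B_def)
  have claim: "\<bar>(P ^^ r) f x * survival r y - survival r x * (P ^^ r) f y\<bar> \<le> B r * pair_weight A r x y"
    if f: "f \<in> borel_measurable E" "\<And>x. x \<in> space E \<Longrightarrow> \<bar>f x\<bar> \<le> V x" and "x \<in> space E" "y \<in> space E" for r f x y
    using that(3,4)
  proof (induction r arbitrary: x y rule: less_induct)
    case (less r)
    have fD: "f \<in> D" using f by (intro weighted_spaceI[where c = 1]) auto
    show ?case
    proof (cases "r < T")
      case True
      have Pf: "\<bar>(P ^^ r) f u\<bar> \<le> a * (s r * V u) + c\<^sub>L * survival r u" if u: "u \<in> space E" for u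
      proof -
        have "\<bar>(P ^^ r) f u\<bar> \<le> (P ^^ r) V u"
          by (intro pos_linear_abs_le[OF iter_pos_linear[OF u]] fD V_weighted f)
        also have "\<dots> \<le> a * \<tau> ^ r * (s r * V u) + c\<^sub>L * survival r u"
          using normalized_lyapunov[OF u, of 0 r] by (simp add: s_0)
        also have "a * \<tau> ^ r * (s r * V u) \<le> a * 1 * (s r * V u)"
          using a \<tau> s_pos[of r] V_nonneg[OF u] power_le_one[of \<tau> r] by (intro mult_right_mono mult_left_mono) auto
        finally show ?thesis by simp
      qed
      note m0 = survival_nonneg[OF less.prems(1), of r] survival_nonneg[OF less.prems(2), of r]
      have "\<bar>(P ^^ r) f x * survival r y - survival r x * (P ^^ r) f y\<bar>
          \<le> \<bar>(P ^^ r) f x\<bar> * survival r y + survival r x * \<bar>(P ^^ r) f y\<bar>"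
        using m0 by (auto simp: abs_mult intro: order_trans[OF abs_triangle_ineq4])
      also have "\<dots> \<le> (a * (s r * V x) + c\<^sub>L * survival r x) * survival r y
          + survival r x * (a * (s r * V y) + c\<^sub>L * survival r y)"
        using less.prems m0 by (intro add_mono mult_right_mono mult_left_mono Pf) auto
      also have "\<dots> = a * (s r * (V x * survival r y + survival r x * V y)) + 2 * c\<^sub>L * (survival r x * survival r y)"
        by (simp add: algebra_simps)
      also have "\<dots> \<le> (a + 1) * (s r * (V x * survival r y + survival r x * V y)) + (a + 1) * A * (survival r x * survival r y)"
      proof (intro add_mono mult_right_mono)
        have "1 * A \<le> (a + 1) * A" using a A_pos by (intro mult_right_mono) auto
        then show "2 * c\<^sub>L \<le> (a + 1) * A" using A by simp
      qed (use m0 V_nonneg less.prems s_pos[of r] in auto)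
      also have "\<dots> = (a + 1) * pair_weight A r x y" by (simp add: pair_weight_def algebra_simps)
      also have "\<dots> \<le> B r * pair_weight A r x y"
      proof (rule mult_right_mono)
        have "\<beta> ^ T \<le> \<beta> ^ r" using True \<beta>_pos \<beta>_less by (intro power_decreasing) auto
        then have "1 \<le> \<beta> ^ r / \<beta> ^ T" using \<beta>_pos by simp
        then show "a + 1 \<le> B r"
          using mult_left_mono[of 1 "\<beta> ^ r / \<beta> ^ T" "a + 1"] a by (simp add: B_def)
      qed (use m0 V_nonneg less.prems s_pos[of r] A_pos in \<open>auto simp: pair_weight_def\<close>)
      finally show ?thesis .
    next
      case False
      define r' where "r' = r - T"
      have r: "r = T + r'" "r' < r" using False T by (auto simp: r'_def)
      have "\<bar>(P ^^ T) ((P ^^ r') f) x * survival (T + r') y - survival (T + r') x * (P ^^ T) ((P ^^ r') f) y\<bar>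
        \<le> (1 - \<epsilon>) * B r' * pair_weight A (T + r') x y"
        using less.IH[OF r(2)] less.prems B_pos[of r'] by (intro step iter_weighted fD) auto
      moreover have "(1 - \<epsilon>) * B r' = B r"
        unfolding \<beta>T[symmetric] by (simp add: B_def r power_add)
      ultimately show ?thesis using r by (simp add: iter_add)
    qed
  qed
  show thesis
  proof (rule that)
    show "0 < (A + 1) * (a + 1) / \<beta> ^ T" using A_pos a \<beta>_pos by simp
    fix r f x y
    assume f: "f \<in> borel_measurable E" "\<And>x. x \<in> space E \<Longrightarrow> \<bar>f x\<bar> \<le> V x" and x: "x \<in> space E" and y: "y \<in> space E"
    have "pair_weight A r x y \<le> (A + 1) * pair_weight 1 r x y"
      using A_pos s_pos[of r] survival_nonneg[OF x, of r] survival_nonneg[OF y, of r] V_nonneg[OF x] V_nonneg[OF y]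
      by (simp add: pair_weight_def algebra_simps)
    then have "B r * pair_weight A r x y \<le> B r * ((A + 1) * pair_weight 1 r x y)"
      using B_pos[of r] by (intro mult_left_mono) auto
    also have "\<dots> = (A + 1) * (a + 1) / \<beta> ^ T * \<beta> ^ r * pair_weight 1 r x y" by (simp add: B_def)
    finally show "\<bar>(P ^^ r) f x * survival r y - survival r x * (P ^^ r) f y\<bar>
        \<le> (A + 1) * (a + 1) / \<beta> ^ T * \<beta> ^ r * pair_weight 1 r x y"
      using claim[OF f x y, of r] by linarith
  qed (use \<beta>_pos \<beta>_less in auto)
qed

end

end

section \<open>The limiting functional and the rate of convergence\<close>

definition normalized :: "((('a \<Rightarrow> real) \<Rightarrow> 'a \<Rightarrow> real)) \<Rightarrow> (('a \<Rightarrow> real) \<Rightarrow> real) \<Rightarrow> nat \<Rightarrow> ('a \<Rightarrow> real) \<Rightarrow> real" where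
  "normalized P p n f = p ((P ^^ n) f) / p ((P ^^ n) (\<lambda>_. 1))"

context lyapunov_doeblin_operator
begin

text \<open>
  The laws for which the contraction acts at once: in proportion to their \<open>V\<close>-mass they survive at least as
  well as \<open>z\<close>, up to a constant. In the normalized difference of two such laws the
  mixed terms of the weight are bounded.
\<close>

definition persistent :: "real \<Rightarrow> (('a \<Rightarrow> real) \<Rightarrow> real) \<Rightarrow> bool" where
  "persistent c p \<longleftrightarrow> pos_linear E V p \<and> 0 < p V \<and> (\<forall>r. s r * p V \<le> c * p (survival r))"

lemma persistent_survival_pos:
  assumes "persistent c p" shows "0 < p (survival r)"
proof -
  have p: "pos_linear E V p" "0 < p V" "s r * p V \<le> c * p (survival r)"
    using assms by (auto simp: persistent_def)
  have "0 < s r * p V" using p s_pos by simp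
  then have "0 < c * p (survival r)" using p by simp
  moreover have "0 \<le> p (survival r)"
    by (rule pos_linear_nonneg[OF p(1) survival_weighted survival_nonneg])
  ultimately show ?thesis by (auto simp: zero_less_mult_iff)
qed

lemma normalized_survival: "normalized P p n f = p ((P ^^ n) f) / p (survival n)"
  by (simp add: normalized_def survival_def)

lemma V_bounded_weighted: "f \<in> borel_measurable E \<Longrightarrow> (\<And>x. x \<in> space E \<Longrightarrow> \<bar>f x\<bar> \<le> V x) \<Longrightarrow> f \<in> D"
  by (rule weighted_spaceI[where c = 1]) auto

end

text \<open>
  Collects the estimates obtained so far, with their constants fixed.
\<close>

locale contracting_operator = lyapunov_doeblin_operator +
  fixes a \<tau> L C \<beta> :: real
  assumes a: "1 \<le> a" and \<tau>: "0 < \<tau>" "\<tau> < 1" and L: "0 < L" and C: "0 < C" and \<beta>: "0 < \<beta>" "\<beta> < 1"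
    and growth: "\<And>n i. \<theta>\<^sub>1 ^ i * s n \<le> a * \<tau> ^ i * s (n + i)"
    and occupation: "\<And>r T x. x \<in> space E \<Longrightarrow> s r * (c\<^sub>2 * occupation T x) \<le> L * survival (T + r) x"
    and lyapunov: "\<And>r T x. x \<in> space E \<Longrightarrow>
          s r * (P ^^ T) V x \<le> a * \<tau> ^ T * (s (r + T) * V x) + L * survival (T + r) x"
    and contraction: "\<And>r f x y. f \<in> borel_measurable E \<Longrightarrow> (\<And>x. x \<in> space E \<Longrightarrow> \<bar>f x\<bar> \<le> V x) \<Longrightarrow>
      x \<in> space E \<Longrightarrow> y \<in> space E \<Longrightarrow>
      \<bar>(P ^^ r) f x * survival r y - survival r x * (P ^^ r) f y\<bar> \<le> C * \<beta> ^ r * pair_weight 1 r x y"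
begin

lemma normalized_contraction:
  assumes p: "persistent c p" and p': "persistent c' p'"
    and f: "f \<in> borel_measurable E" "\<And>x. x \<in> space E \<Longrightarrow> \<bar>f x\<bar> \<le> V x"
  shows "\<bar>normalized P p r f - normalized P p' r f\<bar> \<le> C * (c + c' + 1) * \<beta> ^ r"
proof -
  have lin: "pos_linear E V p" "pos_linear E V p'" using p p' by (auto simp: persistent_def)
  note fD = V_bounded_weighted[OF f]
  let ?m = "survival r" and ?b = "C * \<beta> ^ r"
  have m: "0 < p ?m" "0 < p' ?m" using p p' by (auto intro: persistent_survival_pos)
  have b: "0 \<le> ?b" using C \<beta> by simp
  have "\<bar>p ((P ^^ r) f) * p' ?m - p ?m * p' ((P ^^ r) f)\<bar>
      \<le> p (\<lambda>x. ?b * s r * V x) * p' ?m + p ?m * p' (\<lambda>x. ?b * s r * V x) + ?b * (p ?m * p' ?m)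
        - 0 * 0 * (2 * (p (\<lambda>x. ?b * s r * V x) * p ?m) + ?b * (p ?m)\<^sup>2)"
  proof (rule antisymmetric_minorization[OF lin lin(1) iter_weighted[OF fD] survival_weighted
        weighted_space_scale[OF V_weighted]])
    fix x y assume "x \<in> space E" "y \<in> space E"
    from contraction[OF f this, of r]
    show "\<bar>(P ^^ r) f x * ?m y - ?m x * (P ^^ r) f y\<bar>
        \<le> ?b * s r * V x * ?m y + ?m x * (?b * s r * V y) + ?b * (?m x * ?m y)"
      by (simp add: pair_weight_def algebra_simps)
  qed (auto intro: pos_linear_nonneg[OF lin(1)] pos_linear_nonneg[OF lin(2)])
  also have "\<dots> = ?b * ((s r * p V) * p' ?m + p ?m * (s r * p' V) + p ?m * p' ?m)"
    unfolding pos_linear_scale[OF lin(1) V_weighted] pos_linear_scale[OF lin(2) V_weighted]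
    by (simp add: algebra_simps)
  also have "\<dots> \<le> ?b * ((c * p ?m) * p' ?m + p ?m * (c' * p' ?m) + p ?m * p' ?m)"
    using p p' m b
    by (intro mult_left_mono add_mono mult_right_mono) (auto simp: persistent_def)
  also have "\<dots> = C * (c + c' + 1) * \<beta> ^ r * (p ?m * p' ?m)" by (simp add: algebra_simps)
  finally have "\<bar>p ((P ^^ r) f) * p' ?m - p ?m * p' ((P ^^ r) f)\<bar> / (p ?m * p' ?m)
      \<le> C * (c + c' + 1) * \<beta> ^ r"
    using m by (simp add: divide_le_eq)
  moreover have "normalized P p r f - normalized P p' r f
      = (p ((P ^^ r) f) * p' ?m - p ?m * p' ((P ^^ r) f)) / (p ?m * p' ?m)"
    using m by (simp add: normalized_survival field_simps)
  ultimately show ?thesis using m by (simp add: abs_mult)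
qed

text \<open>
  Once \<open>\<theta>\<^sub>2\<^sup>n \<mu>(\<psi>)\<close> is twice \<open>\<theta>\<^sub>1\<^sup>n \<mu>(V)\<close>, the lower bound \<open>\<theta>\<^sub>2\<^sup>n \<mu>(\<psi>) \<le> \<mu>(P\<^sup>n V)\<close> forces at least half of \<open>\<mu>(P\<^sup>n V)\<close> to
  come from visits to \<open>K\<close>, and these are bounded by survival. The resulting constant is independent of \<open>\<mu>\<close> and \<open>n\<close>.
\<close>

lemma persistent_iter_of_late:
  assumes \<mu>: "pos_linear E V \<mu>" and \<mu>V: "0 < \<mu> V" and late: "2 * (\<theta>\<^sub>1 ^ n * \<mu> V) \<le> \<theta>\<^sub>2 ^ n * \<mu> \<psi>"
  shows "persistent (2 * L) (\<lambda>f. \<mu> ((P ^^ n) f))"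
proof -
  have "\<mu> (\<lambda>x. \<theta>\<^sub>2 ^ n * \<psi> x) \<le> \<mu> ((P ^^ n) \<psi>)"
    by (intro pos_linear_mono[OF \<mu>] weighted_space_scale \<psi>_weighted iter_weighted iter_\<psi>)
  then have \<psi>: "\<theta>\<^sub>2 ^ n * \<mu> \<psi> \<le> \<mu> ((P ^^ n) \<psi>)"
    by (simp add: pos_linear_scale[OF \<mu> \<psi>_weighted])
  also have "\<dots> \<le> \<mu> ((P ^^ n) V)"
    by (intro pos_linear_mono[OF pos_linear_iter[OF \<mu>]] \<psi>_weighted V_weighted order_trans[OF \<psi>_le_1 V_ge_1])
  finally have lower: "\<theta>\<^sub>2 ^ n * \<mu> \<psi> \<le> \<mu> ((P ^^ n) V)" .
  have "\<mu> ((P ^^ n) V) \<le> \<mu> (\<lambda>x. \<theta>\<^sub>1 ^ n * V x + c\<^sub>2 * occupation n x)"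
    by (intro pos_linear_mono[OF \<mu>] iter_weighted V_weighted weighted_space_add weighted_space_scale
        occupation_weighted iter_V_le)
  also have "\<dots> = \<theta>\<^sub>1 ^ n * \<mu> V + c\<^sub>2 * \<mu> (occupation n)"
    by (rule pos_linear_combination[OF \<mu> V_weighted occupation_weighted])
  finally have upper: "\<mu> ((P ^^ n) V) \<le> \<theta>\<^sub>1 ^ n * \<mu> V + c\<^sub>2 * \<mu> (occupation n)" .
  have PV: "\<mu> ((P ^^ n) V) \<le> 2 * (c\<^sub>2 * \<mu> (occupation n))" using lower upper late by linarith
  show ?thesis
    unfolding persistent_def
  proof (intro conjI allI)
    have "0 < 2 * (\<theta>\<^sub>1 ^ n * \<mu> V)" using \<mu>V constants by simp
    then show "0 < \<mu> ((P ^^ n) V)" using lower late by linarith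
    fix r
    have "s r * \<mu> ((P ^^ n) V) \<le> 2 * (s r * (c\<^sub>2 * \<mu> (occupation n)))"
      using mult_left_mono[OF PV, of "s r"] s_pos[of r] by simp
    also have "s r * (c\<^sub>2 * \<mu> (occupation n)) = \<mu> (\<lambda>x. s r * c\<^sub>2 * occupation n x)"
      using pos_linear_scale[OF \<mu> occupation_weighted, of "s r * c\<^sub>2"] by simp
    also have "\<dots> \<le> \<mu> (\<lambda>x. L * survival (n + r) x)"
      using occupation[of _ r n]
      by (intro pos_linear_mono[OF \<mu>] weighted_space_scale occupation_weighted survival_weighted)
         (auto simp: mult.assoc)
    also have "\<dots> = L * \<mu> (survival (n + r))"
      by (rule pos_linear_scale[OF \<mu> survival_weighted])
    finally show "s r * \<mu> ((P ^^ n) V) \<le> 2 * L * \<mu> ((P ^^ n) (survival r))"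
      by (simp add: iter_survival)
  qed (rule pos_linear_iter[OF \<mu>])
qed

definition G :: real where "G = a * V z + L"

lemma G_pos: "0 < G"
  using a V_ge_1[OF z_space] L by (auto simp: G_def intro!: add_nonneg_pos)

lemma persistent_iter_z: "persistent G (\<lambda>f. (P ^^ k) f z)"
  unfolding persistent_def
proof (intro conjI allI)
  show "pos_linear E V (\<lambda>f. (P ^^ k) f z)" by (rule iter_pos_linear[OF z_space])
  have "survival k z \<le> (P ^^ k) V z"
    unfolding survival_def
    by (intro pos_linear_mono[OF iter_pos_linear[OF z_space]] one_weighted V_weighted V_ge_1)
  then show "0 < (P ^^ k) V z" using s_pos[of k] by (simp add: s_def)
  fix r
  have "a * \<tau> ^ k * (s (r + k) * V z) \<le> a * 1 * (s (r + k) * V z)"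
    using a \<tau> V_nonneg[OF z_space] s_pos[of "r + k"] power_le_one[of \<tau> k]
    by (intro mult_right_mono mult_left_mono) auto
  with lyapunov[OF z_space, of r k]
  have "s r * (P ^^ k) V z \<le> a * (s (r + k) * V z) + L * survival (k + r) z" by simp
  also have "\<dots> = G * survival (k + r) z"
    by (simp add: G_def s_def algebra_simps)
  finally show "s r * (P ^^ k) V z \<le> G * (P ^^ k) (survival r) z" by (simp add: iter_survival)
qed

text \<open>
  The law at time \<open>n\<close> of the process started at \<open>z\<close> and conditioned to survive; \<open>\<xi>\<close> below is its limit.
\<close>

definition \<zeta> :: "nat \<Rightarrow> ('a \<Rightarrow> real) \<Rightarrow> real" where "\<zeta> n f = (P ^^ n) f z / s n"

definition \<xi> :: "('a \<Rightarrow> real) \<Rightarrow> real" where "\<xi> f = lim (\<lambda>n. \<zeta> n f)"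

lemma \<zeta>_pos_linear: "pos_linear E V (\<zeta> n)"
  unfolding \<zeta>_def[abs_def] using s_pos[of n]
  by (intro pos_linear_divide iter_pos_linear[OF z_space]) simp

text \<open>
  After \<open>k\<close> steps from \<open>z\<close> the law is still persistent with a constant that does not depend on \<open>k\<close>, so running both laws for
  \<open>n\<close> more steps brings them together at a rate uniform in \<open>k\<close>.
\<close>

lemma \<zeta>_shift:
  assumes f: "f \<in> borel_measurable E" "\<And>x. x \<in> space E \<Longrightarrow> \<bar>f x\<bar> \<le> V x"
  shows "\<bar>\<zeta> (k + n) f - \<zeta> n f\<bar> \<le> C * (G + G + 1) * \<beta> ^ n"
proof -
  have "normalized P (\<lambda>f. (P ^^ i) f z) n f = \<zeta> (i + n) f" for i
    by (simp add: normalized_survival \<zeta>_def s_def iter_survival iter_add)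
  from this[of k] this[of 0] show ?thesis
    using normalized_contraction[OF persistent_iter_z[of k] persistent_iter_z[of 0] f, of n] by simp
qed

lemma \<zeta>_tendsto_of_bounded:
  assumes f: "f \<in> borel_measurable E" "\<And>x. x \<in> space E \<Longrightarrow> \<bar>f x\<bar> \<le> V x"
  shows "(\<lambda>n. \<zeta> n f) \<longlonglongrightarrow> \<xi> f"
proof -
  have "Cauchy (\<lambda>n. \<zeta> n f)"
  proof (rule metric_CauchyI)
    fix e :: real assume "0 < e"
    have "(\<lambda>n. C * (G + G + 1) * \<beta> ^ n) \<longlonglongrightarrow> C * (G + G + 1) * 0"
      using \<beta> by (intro tendsto_intros LIMSEQ_power_zero) auto
    then have "eventually (\<lambda>n. C * (G + G + 1) * \<beta> ^ n < e / 2) at_top"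
      using \<open>0 < e\<close> by (intro order_tendstoD(2)[where y = 0]) auto
    then obtain M where M: "C * (G + G + 1) * \<beta> ^ M < e / 2"
      by (auto simp: eventually_at_top_linorder)
    have "dist (\<zeta> m f) (\<zeta> M f) < e / 2" if "M \<le> m" for m
      using \<zeta>_shift[OF f, of "m - M" M] that M by (simp add: dist_real_def)
    then show "\<exists>M. \<forall>m\<ge>M. \<forall>n\<ge>M. dist (\<zeta> m f) (\<zeta> n f) < e"
      by (meson dist_triangle_half_l)
  qed
  then show ?thesis
    by (simp add: \<xi>_def Cauchy_convergent_iff convergent_LIMSEQ_iff)
qed

lemma \<zeta>_tendsto:
  assumes f: "f \<in> D" shows "(\<lambda>n. \<zeta> n f) \<longlonglongrightarrow> \<xi> f"
proof -
  obtain c where c: "\<And>x. x \<in> space E \<Longrightarrow> \<bar>f x\<bar> \<le> c * V x" and [measurable]: "f \<in> borel_measurable E"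
    using f by (auto simp: weighted_space_def)
  define b where "b = max c 1"
  have b: "0 < b" "c \<le> b" by (auto simp: b_def)
  define g where "g x = (1 / b) * f x" for x
  have "\<bar>g x\<bar> \<le> V x" if "x \<in> space E" for x
  proof -
    have "\<bar>f x\<bar> \<le> b * V x"
      using c[OF that] mult_right_mono[OF b(2) V_nonneg[OF that]] by linarith
    then show ?thesis using b by (simp add: g_def abs_mult field_simps)
  qed
  moreover have "g \<in> borel_measurable E" by (simp add: g_def[abs_def])
  ultimately have "(\<lambda>n. b * \<zeta> n g) \<longlonglongrightarrow> b * \<xi> g"
    by (intro tendsto_mult_left \<zeta>_tendsto_of_bounded)
  moreover have "b * \<zeta> n g = \<zeta> n f" for n
    using pos_linear_scale[OF \<zeta>_pos_linear f, of n "1 / b"] b by (simp add: g_def[abs_def])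
  ultimately have "(\<lambda>n. \<zeta> n f) \<longlonglongrightarrow> b * \<xi> g" by simp
  then show ?thesis unfolding \<xi>_def by (simp add: limI)
qed

lemma \<xi>_pos_linear: "pos_linear E V \<xi>"
  unfolding pos_linear_def
proof (intro conjI ballI allI impI)
  fix f g assume fg: "f \<in> D" "g \<in> D"
  have "(\<lambda>n. \<zeta> n f + \<zeta> n g) \<longlonglongrightarrow> \<xi> f + \<xi> g" by (intro tendsto_add \<zeta>_tendsto fg)
  moreover have "(\<lambda>n. \<zeta> n f + \<zeta> n g) \<longlonglongrightarrow> \<xi> (\<lambda>x. f x + g x)"
    using \<zeta>_tendsto[OF weighted_space_add[OF fg]] fg by (simp add: pos_linear_add[OF \<zeta>_pos_linear])
  ultimately show "\<xi> (\<lambda>x. f x + g x) = \<xi> f + \<xi> g" by (rule LIMSEQ_unique[symmetric])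
next
  fix f and c :: real assume f: "f \<in> D"
  have "(\<lambda>n. c * \<zeta> n f) \<longlonglongrightarrow> c * \<xi> f" by (intro tendsto_mult_left \<zeta>_tendsto f)
  moreover have "(\<lambda>n. c * \<zeta> n f) \<longlonglongrightarrow> \<xi> (\<lambda>x. c * f x)"
    using \<zeta>_tendsto[OF weighted_space_scale[OF f]] f by (simp add: pos_linear_scale[OF \<zeta>_pos_linear])
  ultimately show "\<xi> (\<lambda>x. c * f x) = c * \<xi> f" by (rule LIMSEQ_unique[symmetric])
next
  fix f g assume fg: "f \<in> D" "g \<in> D" "\<forall>x\<in>space E. f x \<le> g x"
  show "\<xi> f \<le> \<xi> g"
    by (rule LIMSEQ_le[OF \<zeta>_tendsto[OF fg(1)] \<zeta>_tendsto[OF fg(2)]])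
       (use fg in \<open>auto intro!: pos_linear_mono[OF \<zeta>_pos_linear]\<close>)
qed

lemma \<xi>_one: "\<xi> (\<lambda>_. 1) = 1"
proof -
  have "\<zeta> n (\<lambda>_. 1) = 1" for n
    using s_pos[of n] by (simp add: \<zeta>_def s_def survival_def)
  then show ?thesis using LIMSEQ_unique[OF \<zeta>_tendsto[OF one_weighted]] by simp
qed

text \<open>
  The eigenvalue relation of a quasi-stationary distribution, inherited from the semigroup identity
  \<open>\<zeta> k (P\<^sup>n f) = \<zeta> k (m\<^sub>n) * \<zeta> (k + n) f\<close>.
\<close>

lemma \<xi>_iter:
  assumes f: "f \<in> D" shows "\<xi> ((P ^^ n) f) = \<xi> (survival n) * \<xi> f"
proof -
  have "\<zeta> k ((P ^^ n) f) = \<zeta> k (survival n) * \<zeta> (k + n) f" for k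
    using s_pos[of k] s_pos[of "k + n"] by (simp add: \<zeta>_def iter_survival iter_add s_def)
  moreover have "(\<lambda>k. \<zeta> k (survival n) * \<zeta> (k + n) f) \<longlonglongrightarrow> \<xi> (survival n) * \<xi> f"
    by (intro tendsto_mult \<zeta>_tendsto survival_weighted LIMSEQ_ignore_initial_segment f)
  ultimately have "(\<lambda>k. \<zeta> k ((P ^^ n) f)) \<longlonglongrightarrow> \<xi> (survival n) * \<xi> f" by simp
  with \<zeta>_tendsto[OF iter_weighted[OF f]] show ?thesis by (rule LIMSEQ_unique)
qed

lemma \<xi>_V_ge_1: "1 \<le> \<xi> V"
  using pos_linear_mono[OF \<xi>_pos_linear one_weighted V_weighted V_ge_1] \<xi>_one by simp

lemma \<xi>_persistent: "persistent G \<xi>"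
  unfolding persistent_def
proof (intro conjI allI \<xi>_pos_linear)
  show "0 < \<xi> V" using \<xi>_V_ge_1 by simp
  fix r
  have "s r * \<zeta> k V \<le> G * \<zeta> k (survival r)" for k
    using persistent_iter_z[of k] s_pos[of k] by (simp add: persistent_def \<zeta>_def divide_right_mono)
  then show "s r * \<xi> V \<le> G * \<xi> (survival r)"
    by (intro LIMSEQ_le[OF tendsto_mult_left[OF \<zeta>_tendsto[OF V_weighted]]
          tendsto_mult_left[OF \<zeta>_tendsto[OF survival_weighted]]]) auto
qed

lemma \<xi>_V_le: "\<xi> V \<le> G"
  using \<xi>_persistent \<xi>_one by (auto simp: persistent_def s_0 survival_def dest: spec[of _ 0])

text \<open>
  If the limit did not charge \<open>K\<close>, it would never visit \<open>K\<close>, and the Lyapunov inequality would make its survival decay at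
  rate \<open>\<theta>\<^sub>1\<close>, faster than \<open>s\<close> does.
\<close>

lemma \<xi>_K_pos: "0 < \<xi> (indicator K)"
proof (rule ccontr)
  assume "\<not> ?thesis"
  moreover have "0 \<le> \<xi> (indicator K)"
    by (rule pos_linear_nonneg[OF \<xi>_pos_linear indicator_K_weighted]) simp
  ultimately have K0: "\<xi> (indicator K) = 0" by simp
  have "1 \<le> G * (a * \<tau> ^ T)" for T
  proof -
    have occ: "\<xi> (occupation T) = 0"
    proof -
      have "\<xi> (occupation T) = (\<Sum>j<T. \<xi> (\<lambda>x. \<theta>\<^sub>1 ^ (T - 1 - j) * (P ^^ j) (indicator K) x))"
        unfolding occupation_def[abs_def]
        by (intro pos_linear_sum[OF \<xi>_pos_linear] weighted_space_scale iter_weighted indicator_K_weighted)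
      also have "\<dots> = 0"
        by (simp add: pos_linear_scale[OF \<xi>_pos_linear] iter_weighted indicator_K_weighted \<xi>_iter K0)
      finally show ?thesis .
    qed
    have "\<xi> (survival T) * \<xi> V \<le> \<xi> (\<lambda>x. \<theta>\<^sub>1 ^ T * V x + c\<^sub>2 * occupation T x)"
      unfolding \<xi>_iter[OF V_weighted, symmetric]
      by (intro pos_linear_mono[OF \<xi>_pos_linear] iter_weighted V_weighted weighted_space_add
          weighted_space_scale occupation_weighted iter_V_le)
    also have "\<dots> = \<theta>\<^sub>1 ^ T * \<xi> V"
      by (simp add: pos_linear_combination[OF \<xi>_pos_linear V_weighted occupation_weighted] occ)
    finally have decay: "\<xi> (survival T) \<le> \<theta>\<^sub>1 ^ T" using \<xi>_V_ge_1 by simp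
    have "s T * 1 \<le> s T * \<xi> V" using \<xi>_V_ge_1 s_pos[of T] by (intro mult_left_mono) auto
    also have "\<dots> \<le> G * \<xi> (survival T)" using \<xi>_persistent by (simp add: persistent_def)
    also have "\<dots> \<le> G * \<theta>\<^sub>1 ^ T" using decay G_pos by (intro mult_left_mono) auto
    also have "\<dots> \<le> G * (a * \<tau> ^ T * s T)"
      using growth[of T 0] G_pos by (intro mult_left_mono) (auto simp: s_0)
    finally have "s T * 1 \<le> s T * (G * (a * \<tau> ^ T))" by (simp add: mult_ac)
    then show ?thesis using s_pos[of T] by simp
  qed
  moreover have "(\<lambda>T. G * (a * \<tau> ^ T)) \<longlonglongrightarrow> G * (a * 0)"
    using \<tau> by (intro tendsto_intros LIMSEQ_power_zero) auto
  ultimately have "1 \<le> G * (a * 0)" by (intro LIMSEQ_le_const) auto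
  then show False by simp
qed

text \<open>
  Let \<open>A = \<mu>(V)/\<mu>(\<psi>)\<close> and let \<open>k\<close> be the first time with \<open>(\<theta>\<^sub>2/\<theta>\<^sub>1)\<^sup>k \<ge> 2 A\<close>. From time \<open>k\<close> on the law is persistent and
  the contraction acts on the remaining \<open>n - k\<close> steps; the \<open>k\<close> steps lost cost \<open>\<alpha>\<^sup>-\<^sup>k\<close>, which is of order \<open>A\<close>
  because \<open>\<alpha> \<ge> \<theta>\<^sub>1/\<theta>\<^sub>2\<close>. Before time \<open>k\<close> the product \<open>\<alpha>\<^sup>n A\<close> is still at least \<open>1/2\<close>, so boundedness of the
  conditioned laws is enough.
\<close>

lemma convergence_to_\<xi>:
  obtains B \<alpha> where "0 < B" "0 < \<alpha>" "\<alpha> < 1"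
    "\<And>\<mu> n f. pos_linear E V \<mu> \<Longrightarrow> \<mu> (\<lambda>_. 1) = 1 \<Longrightarrow> 0 < \<mu> \<psi> \<Longrightarrow>
       f \<in> borel_measurable E \<Longrightarrow> (\<And>x. x \<in> space E \<Longrightarrow> \<bar>f x\<bar> \<le> V x) \<Longrightarrow>
       \<bar>normalized P \<mu> n f - \<xi> f\<bar> \<le> B * \<alpha> ^ n * (\<mu> V / \<mu> \<psi>)"
proof -
  define q where "q = \<theta>\<^sub>2 / \<theta>\<^sub>1"
  have q: "1 < q" using constants by (simp add: q_def)
  define \<alpha> where "\<alpha> = max \<beta> (1 / q)"
  have \<alpha>: "0 < \<alpha>" "\<alpha> < 1" "\<beta> \<le> \<alpha>" "1 \<le> \<alpha> * q"
    using \<beta> q by (auto simp: \<alpha>_def max_def field_simps)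
  define B where "B = C * (2 * L + G + 1) * (2 * q) + (1 + 2 * (L + G))"
  have C': "0 < C * (2 * L + G + 1)" using C L G_pos by simp
  have "0 < C * (2 * L + G + 1) * (2 * q)" using mult_pos_pos[OF C', of "2 * q"] q by simp
  moreover have "0 < 1 + 2 * (L + G)" using L G_pos by simp
  ultimately have "0 < B" unfolding B_def by (rule add_pos_pos)
  moreover have "\<bar>normalized P \<mu> n f - \<xi> f\<bar> \<le> B * \<alpha> ^ n * (\<mu> V / \<mu> \<psi>)"
    if \<mu>: "pos_linear E V \<mu>" and \<mu>1: "\<mu> (\<lambda>_. 1) = 1" and \<mu>\<psi>: "0 < \<mu> \<psi>"
      and f: "f \<in> borel_measurable E" "\<And>x. x \<in> space E \<Longrightarrow> \<bar>f x\<bar> \<le> V x" for \<mu> n f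
  proof -
    note fD = V_bounded_weighted[OF f]
    define A where "A = \<mu> V / \<mu> \<psi>"
    have \<psi>V: "\<mu> \<psi> \<le> \<mu> V"
      by (rule pos_linear_mono[OF \<mu> \<psi>_weighted V_weighted order_trans[OF \<psi>_le_1 V_ge_1]])
    then have A1: "1 \<le> A" and \<mu>V: "0 < \<mu> V" using \<mu>\<psi> by (auto simp: A_def)
    have ex: "\<exists>k. 2 * A \<le> q ^ k"
      using real_arch_pow[OF q, of "2 * A"] by (auto intro: less_imp_le)
    define k where "k = (LEAST k. 2 * A \<le> q ^ k)"
    have k: "2 * A \<le> q ^ k" unfolding k_def by (rule LeastI_ex[OF ex])
    have k_least: "q ^ j < 2 * A" if "j < k" for j
      using not_less_Least[OF that[unfolded k_def]] by simp
    have k_pos: "0 < k" using k A1 by (cases k) auto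
    have \<alpha>q: "1 \<le> \<alpha> ^ j * q ^ j" for j
      unfolding power_mult_distrib[symmetric] by (rule one_le_power[OF \<alpha>(4)])
    have \<alpha>n: "0 < \<alpha> ^ n" using \<alpha> by simp
    show ?thesis
    proof (cases "k \<le> n")
      case True
      have "2 * (\<theta>\<^sub>1 ^ k * \<mu> V) \<le> \<theta>\<^sub>2 ^ k * \<mu> \<psi>"
        using k \<mu>\<psi> constants by (simp add: A_def q_def power_divide field_simps)
      then have late: "persistent (2 * L) (\<lambda>f. \<mu> ((P ^^ k) f))"
        by (rule persistent_iter_of_late[OF \<mu> \<mu>V])
      have "normalized P \<mu> n f = normalized P (\<lambda>f. \<mu> ((P ^^ k) f)) (n - k) f"
        using True by (simp add: normalized_def flip: iter_add)
      moreover have "\<xi> f = normalized P \<xi> (n - k) f"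
        using persistent_survival_pos[OF \<xi>_persistent, of "n - k"]
        by (simp add: normalized_survival \<xi>_iter[OF fD])
      ultimately have "\<bar>normalized P \<mu> n f - \<xi> f\<bar> \<le> C * (2 * L + G + 1) * \<beta> ^ (n - k)"
        using normalized_contraction[OF late \<xi>_persistent f, of "n - k"] by simp
      also have "\<dots> \<le> C * (2 * L + G + 1) * (\<alpha> ^ n * (2 * q * A))"
      proof (rule mult_left_mono)
        have "q ^ (k - 1) \<le> 2 * A" using k_least[of "k - 1"] k_pos by simp
        then have "q ^ k \<le> 2 * q * A" using k_pos q by (cases k) auto
        have "\<beta> ^ (n - k) \<le> \<alpha> ^ (n - k)" using \<beta> \<alpha> by (intro power_mono) auto
        also have "\<dots> \<le> \<alpha> ^ (n - k) * (\<alpha> ^ k * q ^ k)"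
          using mult_left_mono[OF \<alpha>q[of k], of "\<alpha> ^ (n - k)"] \<alpha> by simp
        also have "\<dots> = \<alpha> ^ n * q ^ k" using True by (simp flip: power_add mult.assoc)
        also have "\<dots> \<le> \<alpha> ^ n * (2 * q * A)" using \<open>q ^ k \<le> 2 * q * A\<close> \<alpha>n by (intro mult_left_mono) auto
        finally show "\<beta> ^ (n - k) \<le> \<alpha> ^ n * (2 * q * A)" .
      qed (use C' in simp)
      also have "\<dots> = C * (2 * L + G + 1) * (2 * q) * (\<alpha> ^ n * A)" by simp
      also have "\<dots> \<le> B * (\<alpha> ^ n * A)"
        using L G_pos \<alpha>n A1 unfolding B_def by (intro mult_right_mono) auto
      finally show ?thesis by (simp add: A_def mult.assoc)
    next
      case False
      have "q ^ n \<le> 2 * A" using k_least[of n] False by simp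
      then have "\<alpha> ^ n * q ^ n \<le> \<alpha> ^ n * (2 * A)" using \<alpha>n by (intro mult_left_mono) auto
      with \<alpha>q[of n] have unit: "1 \<le> 2 * (\<alpha> ^ n * A)" by simp
      have "\<mu> (\<lambda>x. \<theta>\<^sub>2 ^ n * \<psi> x) \<le> \<mu> (survival n)"
        by (intro pos_linear_mono[OF \<mu>] weighted_space_scale \<psi>_weighted survival_weighted survival_ge_\<psi>)
      then have surv: "\<theta>\<^sub>2 ^ n * \<mu> \<psi> \<le> \<mu> (survival n)"
        by (simp add: pos_linear_scale[OF \<mu> \<psi>_weighted])
      have surv_pos: "0 < \<mu> (survival n)"
        using surv \<mu>\<psi> constants by (meson less_le_trans mult_pos_pos order.strict_trans zero_less_power)
      have "(P ^^ n) V x \<le> \<theta>\<^sub>1 ^ n * V x + L * survival n x" if x: "x \<in> space E" for x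
        using iter_V_le[OF x, of n] occupation[OF x, of 0 n] by (simp add: s_0)
      then have "\<mu> ((P ^^ n) V) \<le> \<mu> (\<lambda>x. \<theta>\<^sub>1 ^ n * V x + L * survival n x)"
        by (intro pos_linear_mono[OF \<mu>] iter_weighted V_weighted weighted_space_add weighted_space_scale
            survival_weighted)
      then have PV: "\<mu> ((P ^^ n) V) \<le> \<theta>\<^sub>1 ^ n * \<mu> V + L * \<mu> (survival n)"
        by (simp add: pos_linear_combination[OF \<mu> V_weighted survival_weighted])
      have "\<bar>\<mu> ((P ^^ n) f)\<bar> \<le> \<mu> ((P ^^ n) V)"
        by (rule pos_linear_abs_le[OF pos_linear_iter[OF \<mu>] fD V_weighted f(2)])
      then have "\<bar>normalized P \<mu> n f\<bar> \<le> \<mu> ((P ^^ n) V) / \<mu> (survival n)"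
        using surv_pos by (simp add: normalized_survival divide_right_mono)
      also have "\<dots> \<le> (\<theta>\<^sub>1 ^ n * \<mu> V + L * \<mu> (survival n)) / \<mu> (survival n)"
        using PV surv_pos by (intro divide_right_mono) auto
      also have "\<dots> = \<theta>\<^sub>1 ^ n * \<mu> V / \<mu> (survival n) + L"
        using surv_pos by (simp add: add_divide_distrib)
      also have "\<theta>\<^sub>1 ^ n * \<mu> V / \<mu> (survival n) \<le> \<theta>\<^sub>1 ^ n * \<mu> V / (\<theta>\<^sub>2 ^ n * \<mu> \<psi>)"
        using surv surv_pos \<mu>\<psi> \<mu>V constants by (intro divide_left_mono mult_pos_pos) auto
      also have "\<dots> = (1 / q) ^ n * A" by (simp add: A_def q_def power_divide)
      also have "\<dots> \<le> \<alpha> ^ n * A"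
        using q A1 by (intro mult_right_mono power_mono) (auto simp: \<alpha>_def)
      finally have "\<bar>normalized P \<mu> n f\<bar> \<le> \<alpha> ^ n * A + L" by simp
      moreover have "\<bar>\<xi> f\<bar> \<le> G"
        using pos_linear_abs_le[OF \<xi>_pos_linear fD V_weighted f(2)] \<xi>_V_le by simp
      ultimately have "\<bar>normalized P \<mu> n f - \<xi> f\<bar> \<le> \<alpha> ^ n * A + (L + G) * 1" by simp
      also have "\<dots> \<le> \<alpha> ^ n * A + (L + G) * (2 * (\<alpha> ^ n * A))"
        using L G_pos unit by (intro add_left_mono mult_left_mono) auto
      also have "\<dots> = (1 + 2 * (L + G)) * (\<alpha> ^ n * A)" by (simp add: algebra_simps)
      also have "\<dots> \<le> B * (\<alpha> ^ n * A)"
        using C' q \<alpha>n A1 unfolding B_def by (intro mult_right_mono) auto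
      finally show ?thesis by (simp add: A_def mult.assoc)
    qed
  qed
  ultimately show thesis using that \<alpha> by blast
qed

end

lemma (in lyapunov_doeblin_operator) exponential_convergence:
  obtains B \<alpha> \<xi> where "0 < B" "0 < \<alpha>" "\<alpha> < 1" "pos_linear E V \<xi>" "\<xi> (\<lambda>_. 1) = 1" "0 < \<xi> (indicator K)"
    "\<And>n. 0 < \<xi> (survival n)"
    "\<And>n f. f \<in> D \<Longrightarrow> \<xi> ((P ^^ n) f) = \<xi> (survival n) * \<xi> f"
    "\<And>\<mu> n f. pos_linear E V \<mu> \<Longrightarrow> \<mu> (\<lambda>_. 1) = 1 \<Longrightarrow> 0 < \<mu> \<psi> \<Longrightarrow>
       f \<in> borel_measurable E \<Longrightarrow> (\<And>x. x \<in> space E \<Longrightarrow> \<bar>f x\<bar> \<le> V x) \<Longrightarrow>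
       \<bar>normalized P \<mu> n f - \<xi> f\<bar> \<le> B * \<alpha> ^ n * (\<mu> V / \<mu> \<psi>)"
proof -
  obtain a \<tau> where growth: "1 \<le> a" "0 < \<tau>" "\<tau> < 1" "\<And>n i. \<theta>\<^sub>1 ^ i * s n \<le> a * \<tau> ^ i * s (n + i)"
    using survival_growth by metis
  obtain C \<beta> where contraction: "0 < C" "0 < \<beta>" "\<beta> < 1"
    "\<And>r f x y. f \<in> borel_measurable E \<Longrightarrow> (\<And>x. x \<in> space E \<Longrightarrow> \<bar>f x\<bar> \<le> V x) \<Longrightarrow> x \<in> space E \<Longrightarrow> y \<in> space E \<Longrightarrow>
      \<bar>(P ^^ r) f x * survival r y - survival r x * (P ^^ r) f y\<bar> \<le> C * \<beta> ^ r * pair_weight 1 r x y"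
    using geometric_contraction[OF growth] by metis
  interpret contracting_operator E V \<psi> K z P \<nu> \<theta>\<^sub>1 \<theta>\<^sub>2 c\<^sub>1 c\<^sub>2 c\<^sub>3 \<delta> n\<^sub>1 N a \<tau> "c\<^sub>L a \<tau>" C \<beta>
    by unfold_locales (fact growth contraction(1-3) c\<^sub>L_pos[OF growth] occupation_le_survival[OF growth]
      normalized_lyapunov[OF growth] contraction(4))+
  show thesis
  proof (rule convergence_to_\<xi>, goal_cases)
    case (1 B \<alpha>)
    show ?case
      by (rule that[OF 1(1-3) \<xi>_pos_linear \<xi>_one \<xi>_K_pos
          persistent_survival_pos[OF \<xi>_persistent] \<xi>_iter 1(4)])
  qed
qed

section \<open>Representation of functionals by measures\<close>

lemma integrable_weighted:
  assumes M: "sets M = sets E" and V: "integrable M V" and f: "f \<in> weighted_space E V"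
  shows "integrable M f"
proof -
  obtain c where c: "\<And>x. x \<in> space E \<Longrightarrow> \<bar>f x\<bar> \<le> c * V x" and f_meas: "f \<in> borel_measurable E"
    using f by (auto simp: weighted_space_def)
  show ?thesis
  proof (rule Bochner_Integration.integrable_bound)
    show "integrable M (\<lambda>x. c * V x)" using V by simp
    show "f \<in> borel_measurable M" using f_meas M by (simp cong: measurable_cong_sets)
    show "AE x in M. norm (f x) \<le> norm (c * V x)"
    proof (rule AE_I2)
      fix x assume "x \<in> space M"
      then have "x \<in> space E" using sets_eq_imp_space_eq[OF M] by simp
      from c[OF this] show "norm (f x) \<le> norm (c * V x)" by simp
    qed
  qed
qed

lemma integral_pos_linear:
  assumes M: "sets M = sets E" and V: "integrable M V"
  shows "pos_linear E V (\<lambda>f. integral\<^sup>L M f)"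
  using integrable_weighted[OF M V] sets_eq_imp_space_eq[OF M]
  by (auto simp: pos_linear_def intro!: integral_mono)

text \<open>
  Splitting into positive and negative part reduces the identification of a functional with an
  integral to nonnegative functions, for which the extended integral composes with kernels freely.
\<close>

lemma integral_eq_pos_linear:
  assumes M: "sets M = sets E" and p: "pos_linear E V p" and f: "f \<in> weighted_space E V"
    and nonneg: "\<And>f. f \<in> weighted_space E V \<Longrightarrow> (\<And>x. 0 \<le> f x) \<Longrightarrow>
          (\<integral>\<^sup>+ x. ennreal (f x) \<partial>M) = ennreal (p f)"
  shows "integrable M f" "integral\<^sup>L M f = p f"
proof -
  let ?f1 = "\<lambda>x. max 0 (f x)" and ?f2 = "\<lambda>x. max 0 (- f x)"
  obtain c where c: "\<And>x. x \<in> space E \<Longrightarrow> \<bar>f x\<bar> \<le> c * V x" and f_meas[measurable]: "f \<in> borel_measurable E"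
    using f by (auto simp: weighted_space_def)
  have [measurable]: "f \<in> borel_measurable M" using f_meas M by (simp cong: measurable_cong_sets)
  have w: "?f1 \<in> weighted_space E V" "?f2 \<in> weighted_space E V"
    using c by (intro weighted_spaceI[where c = c]; force simp: abs_le_iff max_def)+
  have part: "integrable M g \<and> integral\<^sup>L M g = p g"
    if g: "g \<in> weighted_space E V" "\<And>x. 0 \<le> g x" and [measurable]: "g \<in> borel_measurable M" for g
  proof -
    have "0 \<le> p g" using g by (intro pos_linear_nonneg[OF p]) auto
    with nonneg[OF g] show ?thesis
      using g by (subst (asm) nn_integral_eq_integrable) auto
  qed
  have i: "integrable M ?f1 \<and> integral\<^sup>L M ?f1 = p ?f1" "integrable M ?f2 \<and> integral\<^sup>L M ?f2 = p ?f2"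
    by (intro part w; simp)+
  have eq: "f = (\<lambda>x. 1 * ?f1 x + - 1 * ?f2 x)" by (auto simp: max_def)
  show "integrable M f" using i by (subst eq) simp
  have "p f = p ?f1 - p ?f2"
    using pos_linear_combination[OF p w, of 1 "-1"] eq by simp
  moreover have "integral\<^sup>L M f = integral\<^sup>L M ?f1 - integral\<^sup>L M ?f2"
    using i by (subst eq) simp
  ultimately show "integral\<^sup>L M f = p f" using i by simp
qed

text \<open>
  Continuity under dominated pointwise convergence gives countable additivity on indicators, applied to
  the tails of a disjoint union, and extends the identity to increasing limits.
\<close>

lemma daniell_representation:
  assumes p: "pos_linear E V p" and V: "V \<in> borel_measurable E" "\<And>x. x \<in> space E \<Longrightarrow> 1 \<le> V x"
    and p1: "p (\<lambda>_. 1) = 1"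
    and cont: "\<And>F. (\<And>i. F i \<in> borel_measurable E) \<Longrightarrow> (\<And>i x. x \<in> space E \<Longrightarrow> \<bar>F i x\<bar> \<le> V x) \<Longrightarrow>
        (\<And>x. x \<in> space E \<Longrightarrow> (\<lambda>i. F i x) \<longlonglongrightarrow> 0) \<Longrightarrow> (\<lambda>i. p (F i)) \<longlonglongrightarrow> 0"
  obtains M where "M \<in> space (prob_algebra E)"
    "\<And>f. f \<in> weighted_space E V \<Longrightarrow> integrable M f \<and> integral\<^sup>L M f = p f"
proof -
  have ind: "indicator A \<in> weighted_space E V" if "A \<in> sets E" for A
    using that V(2) by (intro weighted_space_bounded[where c = 1]) (auto simp: indicator_def)
  have ind_nonneg: "0 \<le> p (indicator A)" if "A \<in> sets E" for A
    by (rule pos_linear_nonneg[OF p ind[OF that]]) simp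
  define \<mu> where "\<mu> A = ennreal (p (indicator A))" for A
  have pos: "positive (sets E) \<mu>"
  proof -
    have "indicator {} = (\<lambda>x::'a. 0::real)" by (auto simp: fun_eq_iff)
    then show ?thesis using pos_linear_zero[OF p] by (simp add: positive_def \<mu>_def)
  qed
  have ca: "countably_additive (sets E) \<mu>"
  proof (rule countably_additiveI)
    fix A :: "nat \<Rightarrow> 'a set" assume A: "range A \<subseteq> sets E" "disjoint_family A" "(\<Union>i. A i) \<in> sets E"
    have Ai[measurable]: "A i \<in> sets E" for i using A(1) by auto
    have "(\<lambda>n. p (indicator (\<Union>i\<in>{n..}. A i))) \<longlonglongrightarrow> 0"
    proof (rule cont)
      show "\<bar>indicator (\<Union>i\<in>{n..}. A i) x\<bar> \<le> V x" if "x \<in> space E" for n x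
        using V(2)[OF that] by (auto simp: indicator_def)
      show "(\<lambda>n. indicator (\<Union>i\<in>{n..}. A i) x :: real) \<longlonglongrightarrow> 0" for x
      proof (cases "\<exists>j. x \<in> A j")
        case True
        then obtain j where j: "x \<in> A j" by blast
        have "i = j" if "x \<in> A i" for i
          using A(2) j that unfolding disjoint_family_on_def by blast
        then have "eventually (\<lambda>n. indicator (\<Union>i\<in>{n..}. A i) x = (0::real)) sequentially"
          unfolding eventually_sequentially
          by (intro exI[of _ "Suc j"]) (auto simp: indicator_def)
        then show ?thesis by (rule tendsto_eventually)
      qed (auto simp: indicator_def)
    qed measurable
    moreover have "p (indicator (\<Union>i\<in>{n..}. A i)) = p (indicator (\<Union>i. A i)) - (\<Sum>i<n. p (indicator (A i)))" for n
    proof -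
      have split: "indicator (\<Union>i. A i) x = (\<Sum>i<n. indicator (A i) x) + (indicator (\<Union>i\<in>{n..}. A i) x :: real)" for x
      proof (cases "\<exists>j. x \<in> A j")
        case True
        then obtain j where j: "x \<in> A j" by blast
        have u: "x \<in> A i \<longleftrightarrow> i = j" for i
          using A(2) j unfolding disjoint_family_on_def by blast
        have "(\<Sum>i<n. indicator (A i) x :: real) = (\<Sum>i<n. if i = j then 1 else 0)"
          by (intro sum.cong) (auto simp: indicator_def u)
        also have "\<dots> = (if j < n then 1 else 0)" by simp
        finally show ?thesis using j by (auto simp: indicator_def u not_less)
      qed (auto simp: indicator_def)
      have "p (indicator (\<Union>i. A i)) = p (\<lambda>x. (\<Sum>i<n. indicator (A i) x) + indicator (\<Union>i\<in>{n..}. A i) x)"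
        by (rule arg_cong[where f = p]) (simp add: fun_eq_iff split[of _])
      also have "\<dots> = p (\<lambda>x. \<Sum>i<n. indicator (A i) x) + p (indicator (\<Union>i\<in>{n..}. A i))"
        by (intro pos_linear_add[OF p] weighted_space_sum ind) measurable
      also have "p (\<lambda>x. \<Sum>i<n. indicator (A i) x) = (\<Sum>i<n. p (indicator (A i)))"
        by (intro pos_linear_sum[OF p] ind) measurable
      finally show ?thesis by simp
    qed
    ultimately have "(\<lambda>n. p (indicator (\<Union>i. A i)) - (p (indicator (\<Union>i. A i)) - (\<Sum>i<n. p (indicator (A i)))))
        \<longlonglongrightarrow> p (indicator (\<Union>i. A i)) - 0"
      by (intro tendsto_diff tendsto_const) simp
    then have sums: "(\<lambda>i. p (indicator (A i))) sums p (indicator (\<Union>i. A i))"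
      by (simp add: sums_def)
    then show "(\<Sum>i. \<mu> (A i)) = \<mu> (\<Union>i. A i)"
      unfolding \<mu>_def using ind_nonneg[OF Ai]
      by (subst suminf_ennreal2) (auto simp: sums_iff)
  qed
  define M where "M = measure_of (space E) (sets E) \<mu>"
  have sets_M: "sets M = sets E" by (simp add: M_def)
  have em: "emeasure M A = ennreal (p (indicator A))" if "A \<in> sets E" for A
    using emeasure_measure_of_sigma[OF sets.sigma_algebra_axioms pos ca that] by (simp add: M_def \<mu>_def)
  have "p (indicator (space E)) = p (\<lambda>_. 1)"
    using V(2) by (intro pos_linear_cong[OF p] ind weighted_space_bounded[where c = 1]) auto
  then have "emeasure M (space M) = 1"
    using em[of "space E"] sets_eq_imp_space_eq[OF sets_M] p1 by simp
  then have M: "M \<in> space (prob_algebra E)"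
    by (auto simp: space_prob_algebra sets_M intro: prob_spaceI)
  have nn: "f \<in> weighted_space E V \<longrightarrow> (\<integral>\<^sup>+ x. ennreal (f x) \<partial>M) = ennreal (p f)"
    if "f \<in> borel_measurable E" "\<And>x. 0 \<le> f x" for f
    using that
  proof (induction f rule: borel_measurable_induct_real)
    case (set A)
    then show ?case by (simp add: em sets_M ennreal_indicator)
  next
    case (mult u c)
    show ?case
    proof
      assume cu: "(\<lambda>x. c * u x) \<in> weighted_space E V"
      have [measurable]: "u \<in> borel_measurable M" using mult sets_M by (simp cong: measurable_cong_sets)
      show "(\<integral>\<^sup>+ x. ennreal (c * u x) \<partial>M) = ennreal (p (\<lambda>x. c * u x))"
      proof (cases "c = 0")
        case True then show ?thesis by (simp add: pos_linear_zero[OF p])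
      next
        case False
        then have u: "u \<in> weighted_space E V" using weighted_space_scale[OF cu, of "1 / c"] by simp
        have "0 \<le> p u" by (rule pos_linear_nonneg[OF p u mult(3)])
        have "(\<integral>\<^sup>+ x. ennreal (c * u x) \<partial>M) = ennreal c * (\<integral>\<^sup>+ x. ennreal (u x) \<partial>M)"
          using mult by (simp add: ennreal_mult nn_integral_cmult)
        then show ?thesis
          using mult u \<open>0 \<le> p u\<close> by (simp add: pos_linear_scale[OF p u] ennreal_mult)
      qed
    qed
  next
    case (add u v)
    show ?case
    proof
      assume uv: "(\<lambda>x. v x + u x) \<in> weighted_space E V"
      then obtain c where c: "\<And>x. x \<in> space E \<Longrightarrow> \<bar>v x + u x\<bar> \<le> c * V x" by (auto simp: weighted_space_def)
      have uv_le: "\<bar>u x\<bar> \<le> c * V x \<and> \<bar>v x\<bar> \<le> c * V x" if "x \<in> space E" for x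
        using c[OF that] add.hyps(2,4)[of x] by linarith
      have w: "u \<in> weighted_space E V" "v \<in> weighted_space E V"
        using uv_le add.hyps(1,3) by (auto intro!: weighted_spaceI[where c = c])
      have [measurable]: "u \<in> borel_measurable M" "v \<in> borel_measurable M"
        using add sets_M by (auto cong: measurable_cong_sets)
      have "0 \<le> p u" "0 \<le> p v" using w add by (auto intro!: pos_linear_nonneg[OF p])
      then show "(\<integral>\<^sup>+ x. ennreal (v x + u x) \<partial>M) = ennreal (p (\<lambda>x. v x + u x))"
        using add w by (simp add: nn_integral_add pos_linear_add[OF p w(2,1)])
    qed
  next
    case (seq U)
    show ?case
    proof
      assume f: "f \<in> weighted_space E V"
      then obtain b where b: "\<And>x. x \<in> space E \<Longrightarrow> \<bar>f x\<bar> \<le> b * V x" by (auto simp: weighted_space_def)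
      define c where "c = max b 1"
      have "0 < c" by (simp add: c_def)
      have c: "\<bar>f x\<bar> \<le> c * V x" if "x \<in> space E" for x
      proof -
        have "b * V x \<le> c * V x" using V(2)[OF that] by (intro mult_right_mono) (auto simp: c_def)
        with b[OF that] show ?thesis by linarith
      qed
      have Uf: "U i x \<le> f x" if "x \<in> space E" for i x
        by (rule LIMSEQ_le_const[OF seq.hyps(4)[OF that]])
           (use seq.hyps(3) in \<open>auto simp: incseq_def le_fun_def intro!: exI[of _ i]\<close>)
      have U: "U i \<in> weighted_space E V" for i
      proof (rule weighted_spaceI[OF seq.hyps(1)])
        show "\<bar>U i x\<bar> \<le> c * V x" if "x \<in> space E" for x
          using Uf[OF that, of i] c[OF that] seq.hyps(2)[of i x] by linarith
      qed
      have [measurable]: "U i \<in> borel_measurable M" for i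
        using seq sets_M by (simp cong: measurable_cong_sets)
      have "(\<lambda>i. p (\<lambda>x. 1 / c * f x + - 1 / c * U i x)) \<longlonglongrightarrow> 0"
      proof (rule cont)
        have [measurable]: "f \<in> borel_measurable E" "\<And>i. U i \<in> borel_measurable E"
          using f seq by (auto simp: weighted_space_def)
        show "(\<lambda>x. 1 / c * f x + - 1 / c * U i x) \<in> borel_measurable E" for i by measurable
        show "\<bar>1 / c * f x + - 1 / c * U i x\<bar> \<le> V x" if x: "x \<in> space E" for i x
        proof -
          have "\<bar>f x - U i x\<bar> \<le> c * V x" using Uf[OF x, of i] c[OF x] seq.hyps(2)[of i x] by linarith
          then show ?thesis using \<open>0 < c\<close> by (simp add: diff_divide_distrib[symmetric] divide_le_eq mult.commute)
        qed
        show "(\<lambda>i. 1 / c * f x + - 1 / c * U i x) \<longlonglongrightarrow> 0" if x: "x \<in> space E" for x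
        proof -
          have "(\<lambda>i. 1 / c * f x + - 1 / c * U i x) \<longlonglongrightarrow> 1 / c * f x + - 1 / c * f x"
            by (intro tendsto_intros seq.hyps(4) x)
          then show ?thesis by simp
        qed
      qed
      then have "(\<lambda>i. 1 / c * p f + - 1 / c * p (U i)) \<longlonglongrightarrow> 0"
        by (simp only: pos_linear_combination[OF p f U])
      then have "(\<lambda>i. p f - c * (1 / c * p f + - 1 / c * p (U i))) \<longlonglongrightarrow> p f - c * 0"
        by (intro tendsto_intros)
      then have lim_p: "(\<lambda>i. p (U i)) \<longlonglongrightarrow> p f" using \<open>0 < c\<close> by (simp add: field_simps)
      have inc: "incseq (\<lambda>i x. ennreal (U i x))"
        using seq.hyps(3) by (auto simp: incseq_def le_fun_def intro!: ennreal_leI)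
      have "(\<integral>\<^sup>+ x. ennreal (f x) \<partial>M) = (\<integral>\<^sup>+ x. (SUP i. ennreal (U i x)) \<partial>M)"
      proof (rule nn_integral_cong)
        fix x assume "x \<in> space M"
        then have "x \<in> space E" using sets_eq_imp_space_eq[OF sets_M] by simp
        from tendsto_ennrealI[OF seq.hyps(4)[OF this]]
        show "ennreal (f x) = (SUP i. ennreal (U i x))"
          by (rule LIMSEQ_unique) (use inc in \<open>auto simp: incseq_def le_fun_def intro!: LIMSEQ_SUP\<close>)
      qed
      also have "\<dots> = (SUP i. \<integral>\<^sup>+ x. ennreal (U i x) \<partial>M)"
        by (rule nn_integral_monotone_convergence_SUP[OF inc]) measurable
      finally have "(\<lambda>i. \<integral>\<^sup>+ x. ennreal (U i x) \<partial>M) \<longlonglongrightarrow> (\<integral>\<^sup>+ x. ennreal (f x) \<partial>M)"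
        using LIMSEQ_SUP[OF incseq_nn_integral[OF inc], of M] by simp
      moreover have "(\<lambda>i. \<integral>\<^sup>+ x. ennreal (U i x) \<partial>M) = (\<lambda>i. ennreal (p (U i)))"
        using seq.IH U by auto
      ultimately show "(\<integral>\<^sup>+ x. ennreal (f x) \<partial>M) = ennreal (p f)"
        using tendsto_ennrealI[OF lim_p] LIMSEQ_unique by fastforce
    qed
  qed
  show thesis
  proof (rule that[OF M])
    fix f assume f: "f \<in> weighted_space E V"
    show "integrable M f \<and> integral\<^sup>L M f = p f"
      using integral_eq_pos_linear[OF sets_M p f] nn weighted_space_measurable by blast
  qed
qed

section \<open>The transition kernels of the absorbed process\<close>

context absorbed_markov_process
begin

lemma space_with_cemetery: "space (with_cemetery E cem) = insert cem (space E)"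
  by (simp add: with_cemetery_def space_measure_of_conv)

lemma sets_with_cemetery:
  "sets (with_cemetery E cem) = sigma_sets (insert cem (space E)) (insert {cem} (sets E))"
  unfolding with_cemetery_def using sets.sets_into_space by (intro sets_measure_of) blast

lemma sets_E_subset: "A \<in> sets E \<Longrightarrow> A \<in> sets (with_cemetery E cem)"
  by (auto simp: sets_with_cemetery)

lemma space_E_inter: "A \<in> sets (with_cemetery E cem) \<Longrightarrow> space E \<inter> A \<in> sets E"
  unfolding sets_with_cemetery
proof (induction rule: sigma_sets.induct)
  case (Basic A)
  then show ?case using cem_notin by auto
next
  case (Compl A)
  have "space E \<inter> (insert cem (space E) - A) = space E - space E \<inter> A" by auto
  then show ?case using Compl by auto
next
  case (Union A)
  have "space E \<inter> (\<Union>i. A i) = (\<Union>i. space E \<inter> A i)" by auto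
  moreover have "(\<Union>i. space E \<inter> A i) \<in> sets E"
    using Union.IH by (intro sets.countable_UN image_subsetI)
  ultimately show ?case by simp
qed simp

lemma space_E_sets: "space E \<in> sets (with_cemetery E cem)"
  by (simp add: sets_E_subset)

lemma space_E_inter_sets: "space E \<inter> space (with_cemetery E cem) \<in> sets (with_cemetery E cem)"
proof -
  have "space E \<inter> space (with_cemetery E cem) = space E" by (auto simp: space_with_cemetery)
  then show ?thesis by (simp add: space_E_sets)
qed

lemma inclusion_measurable: "(\<lambda>x. x) \<in> measurable E (with_cemetery E cem)"
proof (rule measurableI)
  fix A assume "A \<in> sets (with_cemetery E cem)"
  then show "(\<lambda>x. x) -` A \<inter> space E \<in> sets E" using space_E_inter[of A] by (simp add: Int_commute)
qed (simp add: space_with_cemetery)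

lemma sets_restrict_with_cemetery: "sets (restrict_space (with_cemetery E cem) (space E)) = sets E"
proof
  show "sets (restrict_space (with_cemetery E cem) (space E)) \<subseteq> sets E"
    by (auto simp: sets_restrict_space space_E_inter)
  show "sets E \<subseteq> sets (restrict_space (with_cemetery E cem) (space E))"
  proof
    fix A assume "A \<in> sets E"
    moreover from this have "A = space E \<inter> A" using sets.sets_into_space by blast
    ultimately show "A \<in> sets (restrict_space (with_cemetery E cem) (space E))"
      unfolding sets_restrict_space using sets_E_subset by blast
  qed
qed

lemma nat_in_time_set: "real n \<in> I"
  using time_set
proof
  assume "\<exists>k::nat. k \<ge> 1 \<and> I = range (\<lambda>m::nat. real m / real k)"
  then obtain k :: nat where "k \<ge> 1" "I = range (\<lambda>m::nat. real m / real k)" by blast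
  then show ?thesis by (auto intro!: image_eqI[of _ _ "n * k"])
qed simp

lemma E_into: "x \<in> space E \<Longrightarrow> x \<in> space (with_cemetery E cem)"
  by (simp add: space_with_cemetery)

lemma law:
  assumes "x \<in> space E"
  shows "prob_space (P x)" "sets (P x) = sets \<Omega>" "space (P x) = space \<Omega>"
  using measurable_space[OF P_kernel E_into[OF assms]] sets_eq_imp_space_eq[of "P x" \<Omega>]
  by (auto simp: space_prob_algebra)

lemma X_measurable_law:
  assumes "x \<in> space E" shows "X (real n) \<in> measurable (P x) (with_cemetery E cem)"
  using X_measurable[OF nat_in_time_set] law(2)[OF assms] by (simp cong: measurable_cong_sets)

text \<open>
  Absorption lets the survival event be read off from the position at time \<open>n\<close>.
\<close>

lemma survives_iff:
  assumes x: "x \<in> space E"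
  shows "AE \<omega> in P x. survives n \<omega> \<longleftrightarrow> X (real n) \<omega> \<in> space E"
  using absorbing[OF E_into[OF x]] AE_space
proof eventually_elim
  case (elim \<omega>)
  have "X (real n) \<omega> \<in> insert cem (space E)"
    using measurable_space[OF X_measurable_law[OF x] elim(2)] by (simp add: space_with_cemetery)
  moreover have "\<not> survives n \<omega>" if "X (real n) \<omega> = cem"
    using that nat_in_time_set unfolding absorption_time_def not_less by (intro Inf_lower) auto
  moreover have "X (real n) \<omega> = cem" if "\<not> survives n \<omega>"
    using that elim(1) nat_in_time_set[of n] by (auto simp: not_less)
  ultimately show ?case using cem_notin by auto
qed

text \<open>
  The sub-Markov kernel of the process at time \<open>n\<close>: mass that has reached the cemetery is dropped.
\<close>

definition kernel :: "nat \<Rightarrow> 'a \<Rightarrow> 'a measure" where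
  "kernel n x = restrict_space (distr (P x) (with_cemetery E cem) (X (real n))) (space E)"

lemma sets_kernel: "sets (kernel n x) = sets E"
  unfolding kernel_def using sets_restrict_with_cemetery by (simp add: sets_restrict_space)

lemma space_kernel: "space (kernel n x) = space E"
  by (rule sets_eq_imp_space_eq[OF sets_kernel])

lemma emeasure_kernel:
  assumes x: "x \<in> space E" and A: "A \<in> sets E"
  shows "emeasure (kernel n x) A = emeasure (P x) {\<omega> \<in> space (P x). X (real n) \<omega> \<in> A}"
proof -
  have "emeasure (kernel n x) A = emeasure (distr (P x) (with_cemetery E cem) (X (real n))) A"
    unfolding kernel_def using sets.sets_into_space[OF A] space_E_inter_sets
    by (intro emeasure_restrict_space) auto
  also have "\<dots> = emeasure (P x) (X (real n) -` A \<inter> space (P x))"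
    by (rule emeasure_distr[OF X_measurable_law[OF x] sets_E_subset[OF A]])
  also have "X (real n) -` A \<inter> space (P x) = {\<omega> \<in> space (P x). X (real n) \<omega> \<in> A}" by auto
  finally show ?thesis .
qed

lemma kernel_measurable [measurable]:
  assumes "space E \<noteq> {}" shows "kernel n \<in> measurable E (subprob_algebra E)"
proof -
  have "P \<in> measurable (with_cemetery E cem) (subprob_algebra \<Omega>)"
    by (rule measurable_prob_algebraD[OF P_kernel])
  from measurable_compose[OF inclusion_measurable this]
  have "(\<lambda>x. P x) \<in> measurable E (subprob_algebra \<Omega>)" .
  from measurable_compose[OF this measurable_distr[OF X_measurable[OF nat_in_time_set]]]
  have "(\<lambda>x. distr (P x) (with_cemetery E cem) (X (real n))) \<in> measurable E (subprob_algebra (with_cemetery E cem))" .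
  from restrict_space_measurable[OF assms space_E_sets this]
  show ?thesis
    unfolding kernel_def[abs_def] by (simp only: subprob_algebra_cong[OF sets_restrict_with_cemetery])
qed

lemma kernel_subprob: "x \<in> space E \<Longrightarrow> subprob_space (kernel n x)"
  using measurable_space[OF kernel_measurable, of x n] by (auto simp: space_subprob_algebra)

lemma nn_integral_kernel:
  assumes x: "x \<in> space E" and f: "f \<in> borel_measurable E"
  shows "(\<integral>\<^sup>+ y. f y \<partial>kernel n x) = Pn n f x"
proof -
  have fS: "(\<lambda>y. f y * indicator (space E) y) \<in> borel_measurable (with_cemetery E cem)"
    using f sets_restrict_with_cemetery
    by (subst borel_measurable_restrict_space_iff_ennreal[OF space_E_inter_sets, symmetric])
       (simp cong: measurable_cong_sets)
  have "(\<integral>\<^sup>+ y. f y \<partial>kernel n x)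
      = (\<integral>\<^sup>+ y. f y * indicator (space E) y \<partial>distr (P x) (with_cemetery E cem) (X (real n)))"
    unfolding kernel_def using space_E_inter_sets by (intro nn_integral_restrict_space) simp
  also have "\<dots> = (\<integral>\<^sup>+ \<omega>. f (X (real n) \<omega>) * indicator (space E) (X (real n) \<omega>) \<partial>P x)"
    using X_measurable_law[OF x] fS by (intro nn_integral_distr) auto
  also have "\<dots> = Pn n f x"
    unfolding Pn_def using survives_iff[OF x, of n]
    by (intro nn_integral_cong_AE) (auto simp: indicator_def)
  finally show ?thesis .
qed

lemma emeasure_survives:
  assumes x: "x \<in> space E"
  shows "emeasure (P x) {\<omega> \<in> space (P x). survives n \<omega>} = emeasure (kernel n x) (space E)"
proof -
  have "emeasure (P x) {\<omega> \<in> space (P x). survives n \<omega>} = emeasure (P x) {\<omega> \<in> space (P x). X (real n) \<omega> \<in> space E}"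
  proof (rule emeasure_eq_AE)
    show "AE \<omega> in P x. \<omega> \<in> {\<omega> \<in> space (P x). survives n \<omega>} \<longleftrightarrow> \<omega> \<in> {\<omega> \<in> space (P x). X (real n) \<omega> \<in> space E}"
      using survives_iff[OF x, of n] by eventually_elim auto
    show "{\<omega> \<in> space (P x). survives n \<omega>} \<in> sets (P x)"
      using absorption_event[of n] law[OF x] by simp
    show "{\<omega> \<in> space (P x). X (real n) \<omega> \<in> space E} \<in> sets (P x)"
      using measurable_sets[OF X_measurable_law[OF x] space_E_sets, of n] by (simp add: vimage_def Int_def conj_commute)
  qed
  then show ?thesis by (simp add: emeasure_kernel[OF x])
qed

lemma kernel_0:
  assumes x: "x \<in> space E" shows "kernel 0 x = return E x"
proof (rule measure_eqI)
  fix A assume "A \<in> sets (kernel 0 x)"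
  then have A: "A \<in> sets E" by (simp add: sets_kernel)
  have "emeasure (kernel 0 x) A = emeasure (return (with_cemetery E cem) x) A"
    unfolding kernel_def using sets.sets_into_space[OF A] space_E_inter_sets initial_law[OF E_into[OF x]]
    by (subst emeasure_restrict_space) auto
  then show "emeasure (kernel 0 x) A = emeasure (return E x) A"
    using A by (simp add: sets_E_subset)
qed (simp add: sets_kernel)

lemma natural_sigma_subalgebra:
  assumes x: "x \<in> space E"
  shows "subalgebra (P x) (natural_sigma (with_cemetery E cem) I \<Omega> X s)"
proof -
  let ?G = "{X u -` A \<inter> space \<Omega> | u A. u \<in> I \<and> u \<le> s \<and> A \<in> sets (with_cemetery E cem)}"
  have G: "?G \<subseteq> sets \<Omega>" using measurable_sets[OF X_measurable] by blast
  moreover have "?G \<subseteq> Pow (space \<Omega>)" by blast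
  ultimately have "sets (natural_sigma (with_cemetery E cem) I \<Omega> X s) \<subseteq> sets \<Omega>"
    unfolding natural_sigma_def by (simp only: sets_measure_of sets.sigma_sets_subset)
  then show ?thesis
    by (simp add: subalgebra_def natural_sigma_def space_measure_of_conv law[OF x])
qed

text \<open>
  The Markov property, integrated over the event that \<open>X\<^sub>n\<close> is in \<open>E\<close>. This event contains \<open>X\<^sub>n\<^sub>+\<^sub>m \<in> A\<close> up to
  a null set, because the cemetery is absorbing.
\<close>

lemma chapman_kolmogorov:
  assumes x: "x \<in> space E" and A: "A \<in> sets E"
  shows "emeasure (kernel (n + m) x) A = (\<integral>\<^sup>+ y. emeasure (kernel m y) A \<partial>kernel n x)"
proof -
  interpret Px: prob_space "P x" by (rule law(1)[OF x])
  let ?S = "with_cemetery E cem"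
  let ?F = "natural_sigma ?S I \<Omega> X (real n)"
  interpret finite_measure_subalgebra "P x" ?F
    by unfold_locales (rule natural_sigma_subalgebra[OF x])
  define B where "B = X (real n + real m) -` A \<inter> space \<Omega>"
  define C where "C = X (real n) -` space E \<inter> space \<Omega>"
  have nm: "real n + real m = real (n + m)" by simp
  have B: "B \<in> sets (P x)"
    unfolding B_def nm law(2)[OF x]
    by (rule measurable_sets[OF X_measurable[OF nat_in_time_set] sets_E_subset[OF A]])
  have C_F: "C \<in> sets ?F"
    unfolding C_def natural_sigma_def using nat_in_time_set space_E_sets by auto
  have C: "C \<in> sets (P x)" using C_F subalg by (auto simp: subalgebra_def)
  define g where "g y = measure (kernel m y) A" for y
  have g_meas: "g \<in> borel_measurable E"
    unfolding g_def using x A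
    by (intro measurable_compose[OF kernel_measurable measurable_measure_subprob_algebra]) auto
  have g_kernel: "ennreal (g y) = emeasure (kernel m y) A" and g_le_1: "g y \<le> 1" if "y \<in> space E" for y
  proof -
    interpret Q: subprob_space "kernel m y" by (rule kernel_subprob[OF that])
    show "ennreal (g y) = emeasure (kernel m y) A" "g y \<le> 1"
      by (simp_all add: g_def Q.emeasure_eq_measure Q.subprob_measure_le_1)
  qed
  have gS: "(\<lambda>y. indicator (space E) y * g y) \<in> borel_measurable ?S"
  proof -
    have "g \<in> borel_measurable (restrict_space ?S (space E))"
      using g_meas sets_restrict_with_cemetery by (simp cong: measurable_cong_sets)
    then show ?thesis
      by (simp add: borel_measurable_restrict_space_iff[OF space_E_inter_sets])
  qed
  have h_meas: "(\<lambda>\<omega>. indicator (space E) (X (real n) \<omega>) * g (X (real n) \<omega>)) \<in> borel_measurable (P x)"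
    by (rule measurable_compose[OF X_measurable_law[OF x] gS])
  have g_X: "\<P>(\<omega>' in P y. X (real m) \<omega>' \<in> A) = g y" if "y \<in> space E" for y
    using emeasure_kernel[OF that A, of m] by (simp add: g_def measure_def)
  have "emeasure (kernel (n + m) x) A = emeasure (P x) B"
    unfolding emeasure_kernel[OF x A] B_def nm using law[OF x] by (intro arg_cong2[where f = emeasure]) auto
  also have "\<dots> = emeasure (P x) (C \<inter> B)"
  proof (rule emeasure_eq_AE)
    have "ereal (real n) \<le> ereal (real (n + m))" by simp
    show "AE \<omega> in P x. \<omega> \<in> B \<longleftrightarrow> \<omega> \<in> C \<inter> B"
      using survives_iff[OF x, of n] survives_iff[OF x, of "n + m"]
    proof eventually_elim
      case (elim \<omega>)
      have "\<omega> \<in> C" if "\<omega> \<in> B"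
      proof -
        have "survives (n + m) \<omega>" using that elim(2) sets.sets_into_space[OF A] by (auto simp: B_def)
        then have "survives n \<omega>" using \<open>ereal (real n) \<le> ereal (real (n + m))\<close> by (rule order.strict_trans1[rotated])
        then show ?thesis using elim(1) that by (auto simp: B_def C_def)
      qed
      then show ?case by auto
    qed
  qed (use B C in auto)
  also have "\<dots> = ennreal (\<integral>\<omega>\<in>C. indicator B \<omega> \<partial>P x)"
    using B C by (simp add: set_lebesgue_integral_def Px.emeasure_eq_measure flip: indicator_inter_arith)
  also have "(\<integral>\<omega>\<in>C. indicator B \<omega> \<partial>P x) = (\<integral>\<omega>\<in>C. real_cond_exp (P x) ?F (indicator B) \<omega> \<partial>P x)"
    using B by (intro real_cond_exp_intA C_F) (auto intro: Px.integrable_const_bound[where B = 1] simp: indicator_def)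
  also have "\<dots> = (\<integral>\<omega>. indicator (space E) (X (real n) \<omega>) * g (X (real n) \<omega>) \<partial>P x)"
    unfolding set_lebesgue_integral_def
  proof (rule integral_cong_AE)
    show "(\<lambda>\<omega>. indicator (space E) (X (real n) \<omega>) * g (X (real n) \<omega>)) \<in> borel_measurable (P x)"
      by (rule h_meas)
    show "(\<lambda>\<omega>. indicat_real C \<omega> *\<^sub>R real_cond_exp (P x) ?F (indicator B) \<omega>) \<in> borel_measurable (P x)"
      using C by measurable
    have "AE \<omega> in P x. real_cond_exp (P x) ?F (indicator B) \<omega> = \<P>(\<omega>' in P (X (real n) \<omega>). X (real m) \<omega>' \<in> A)"
      unfolding B_def by (rule markov[OF E_into[OF x] nat_in_time_set nat_in_time_set sets_E_subset[OF A]])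
    then show "AE \<omega> in P x. indicat_real C \<omega> *\<^sub>R real_cond_exp (P x) ?F (indicator B) \<omega>
        = indicator (space E) (X (real n) \<omega>) * g (X (real n) \<omega>)"
      using AE_space
      by eventually_elim (auto simp: C_def g_X indicator_def law[OF x])
  qed
  also have "ennreal \<dots> = (\<integral>\<^sup>+ \<omega>. ennreal (indicator (space E) (X (real n) \<omega>) * g (X (real n) \<omega>)) \<partial>P x)"
  proof (rule nn_integral_eq_integral[symmetric])
    show "integrable (P x) (\<lambda>\<omega>. indicator (space E) (X (real n) \<omega>) * g (X (real n) \<omega>))"
      using h_meas g_le_1
      by (intro Px.integrable_const_bound[where B = 1]) (auto simp: indicator_def g_def)
  qed (simp add: g_def)
  also have "\<dots> = Pn n (\<lambda>y. emeasure (kernel m y) A) x"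
    unfolding Pn_def
  proof (rule nn_integral_cong_AE)
    show "AE \<omega> in P x. ennreal (indicator (space E) (X (real n) \<omega>) * g (X (real n) \<omega>))
        = emeasure (kernel m (X (real n) \<omega>)) A * indicator {\<omega>. survives n \<omega>} \<omega>"
      using survives_iff[OF x, of n] by eventually_elim (auto simp: indicator_def g_kernel)
  qed
  also have "\<dots> = (\<integral>\<^sup>+ y. emeasure (kernel m y) A \<partial>kernel n x)"
    using x A
    by (intro nn_integral_kernel[symmetric] measurable_compose[OF kernel_measurable measurable_emeasure_subprob_algebra]) auto
  finally show ?thesis .
qed

end

section \<open>The one-step operator under the assumptions\<close>

lemma (in absorbed_markov_process) kernel_bind:
  assumes x: "x \<in> space E"
  shows "kernel (n + m) x = kernel n x \<bind> kernel m"
proof (rule measure_eqI)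
  have m: "kernel m \<in> measurable (kernel n x) (subprob_algebra E)"
  proof -
    have "space E \<noteq> {}" using x by blast
    from kernel_measurable[OF this] show ?thesis
      using sets_kernel[of n x] by (simp cong: measurable_cong_sets)
  qed
  have ne: "space (kernel n x) \<noteq> {}" using x by (auto simp: space_kernel)
  show "sets (kernel (n + m) x) = sets (kernel n x \<bind> kernel m)"
    using ne by (simp add: sets_kernel)
  fix A assume "A \<in> sets (kernel (n + m) x)"
  then have A: "A \<in> sets E" by (simp add: sets_kernel)
  show "emeasure (kernel (n + m) x) A = emeasure (kernel n x \<bind> kernel m) A"
    using emeasure_bind[OF ne m A] chapman_kolmogorov[OF x A] by simp
qed

context assumption_E
begin

lemma K_into_E: "x \<in> K \<Longrightarrow> x \<in> space E"
  using sets.sets_into_space[OF K_sets] by auto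

lemma K_nonempty: "K \<noteq> {}"
proof -
  have "prob_space \<nu>" "space \<nu> = K"
    using nu_prob sets_eq_imp_space_eq[of \<nu> "restrict_space E K"] K_sets by (auto simp: space_prob_algebra)
  then show ?thesis using prob_space.not_empty by blast
qed

lemma E_nonempty: "space E \<noteq> {}"
  using K_nonempty K_into_E by blast

lemmas kernel_meas = kernel_measurable[OF E_nonempty]

text \<open>
  On functions of growth \<open>\<phi>\<^sub>1\<close> this is \<open>P\<^sub>1\<close> as an operator on real functions; its powers are the \<open>P\<^sub>n\<close>.
\<close>

definition step :: "('a \<Rightarrow> real) \<Rightarrow> 'a \<Rightarrow> real" where
  "step f x = (\<integral>y. f y \<partial>kernel 1 x)"

lemma step_\<phi>\<^sub>1:
  assumes x: "x \<in> space E"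
  shows "integrable (kernel 1 x) \<phi>\<^sub>1" "step \<phi>\<^sub>1 x \<le> \<theta>\<^sub>1 * \<phi>\<^sub>1 x + c\<^sub>2 * indicator K x"
proof -
  let ?r = "\<theta>\<^sub>1 * \<phi>\<^sub>1 x + c\<^sub>2 * indicator K x"
  have r: "0 \<le> ?r" using constants_pos phi_nonneg(1)[OF x] by simp
  have meas: "\<phi>\<^sub>1 \<in> borel_measurable (kernel 1 x)"
    using phi_measurable(1) sets_kernel[of 1 x] by (simp cong: measurable_cong_sets)
  have nonneg: "AE y in kernel 1 x. 0 \<le> \<phi>\<^sub>1 y" by (rule AE_I2) (simp add: phi_nonneg space_kernel)
  have bound: "(\<integral>\<^sup>+ y. ennreal (\<phi>\<^sub>1 y) \<partial>kernel 1 x) \<le> ennreal ?r"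
    using E2_upper[OF x] nn_integral_kernel[OF x, of "\<lambda>y. ennreal (\<phi>\<^sub>1 y)" 1] phi_measurable(1) by simp
  show int: "integrable (kernel 1 x) \<phi>\<^sub>1"
    using le_less_trans[OF bound ennreal_less_top] by (intro integrableI_nonneg meas nonneg) simp
  show "step \<phi>\<^sub>1 x \<le> ?r"
    using bound r unfolding step_def nn_integral_eq_integral[OF int nonneg] by simp
qed

lemma step_pos_linear: "x \<in> space E \<Longrightarrow> pos_linear E \<phi>\<^sub>1 (\<lambda>f. step f x)"
  unfolding step_def by (rule integral_pos_linear[OF sets_kernel step_\<phi>\<^sub>1(1)])

lemma \<phi>\<^sub>1_weighted: "\<phi>\<^sub>1 \<in> weighted_space E \<phi>\<^sub>1"
  using phi_measurable(1) phi_nonneg(1) by (intro weighted_spaceI[where c = 1]) auto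

lemma step_weighted:
  assumes f: "f \<in> weighted_space E \<phi>\<^sub>1" shows "step f \<in> weighted_space E \<phi>\<^sub>1"
proof -
  obtain c where c: "\<And>x. x \<in> space E \<Longrightarrow> \<bar>f x\<bar> \<le> c * \<phi>\<^sub>1 x" and f_meas: "f \<in> borel_measurable E"
    using f by (auto simp: weighted_space_def)
  obtain x\<^sub>0 where "x\<^sub>0 \<in> space E" using E_nonempty by blast
  with c[of x\<^sub>0] E2_phi1(1)[of x\<^sub>0] have "0 \<le> c" by (smt (verit) mult_neg_pos)
  show ?thesis
  proof (rule weighted_spaceI[where c = "c * (\<theta>\<^sub>1 + c\<^sub>2)"])
    show "step f \<in> borel_measurable E"
      unfolding step_def[abs_def]
      by (rule measurable_compose[OF kernel_meas integral_measurable_subprob_algebra[OF f_meas]])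
    fix x assume x: "x \<in> space E"
    have "\<bar>step f x\<bar> \<le> step (\<lambda>y. c * \<phi>\<^sub>1 y) x"
      by (intro pos_linear_abs_le[OF step_pos_linear[OF x]] f weighted_space_scale \<phi>\<^sub>1_weighted c)
    also have "\<dots> = c * step \<phi>\<^sub>1 x"
      by (rule pos_linear_scale[OF step_pos_linear[OF x] \<phi>\<^sub>1_weighted])
    also have "\<dots> \<le> c * ((\<theta>\<^sub>1 + c\<^sub>2) * \<phi>\<^sub>1 x)"
    proof (rule mult_left_mono[OF _ \<open>0 \<le> c\<close>])
      have "c\<^sub>2 * indicator K x \<le> c\<^sub>2 * \<phi>\<^sub>1 x"
        using constants_pos E2_phi1(1)[OF x] by (intro mult_left_mono) (auto simp: indicator_def)
      then show "step \<phi>\<^sub>1 x \<le> (\<theta>\<^sub>1 + c\<^sub>2) * \<phi>\<^sub>1 x" using step_\<phi>\<^sub>1(2)[OF x] by (simp add: distrib_right)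
    qed
    finally show "\<bar>step f x\<bar> \<le> c * (\<theta>\<^sub>1 + c\<^sub>2) * \<phi>\<^sub>1 x" by (simp add: mult.assoc)
  qed
qed

lemma step_iter_weighted: "f \<in> weighted_space E \<phi>\<^sub>1 \<Longrightarrow> (step ^^ n) f \<in> weighted_space E \<phi>\<^sub>1"
  by (induction n) (auto intro: step_weighted)

lemma step_iter_nonneg:
  assumes "f \<in> weighted_space E \<phi>\<^sub>1" "\<And>x. x \<in> space E \<Longrightarrow> 0 \<le> f x" "x \<in> space E"
  shows "0 \<le> (step ^^ n) f x"
  using assms(3)
  by (induction n arbitrary: x) (auto simp: assms intro!: pos_linear_nonneg[OF step_pos_linear] step_iter_weighted)

lemma nn_integral_kernel_eq_iter:
  assumes f: "f \<in> weighted_space E \<phi>\<^sub>1" "\<And>x. x \<in> space E \<Longrightarrow> 0 \<le> f x" and x: "x \<in> space E"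
  shows "(\<integral>\<^sup>+ y. ennreal (f y) \<partial>kernel n x) = ennreal ((step ^^ n) f x)"
  using x
proof (induction n arbitrary: x)
  case 0
  then show ?case
    using weighted_space_measurable[OF f(1)] by (simp add: kernel_0 nn_integral_return)
next
  case (Suc n)
  let ?g = "(step ^^ n) f"
  have meas: "kernel n \<in> measurable (kernel 1 x) (subprob_algebra E)"
    using kernel_meas[of n] sets_kernel[of 1 x] by (simp cong: measurable_cong_sets)
  have f_meas: "(\<lambda>y. ennreal (f y)) \<in> borel_measurable E"
    using weighted_space_measurable[OF f(1)] by simp
  have int: "integrable (kernel 1 x) ?g"
    by (rule integrable_weighted[OF sets_kernel step_\<phi>\<^sub>1(1)[OF Suc.prems] step_iter_weighted[OF f(1)]])
  have "(\<integral>\<^sup>+ y. ennreal (f y) \<partial>kernel (Suc n) x) = (\<integral>\<^sup>+ y. \<integral>\<^sup>+ w. ennreal (f w) \<partial>kernel n y \<partial>kernel 1 x)"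
    using kernel_bind[OF Suc.prems, of 1 n] nn_integral_bind[OF f_meas meas] by simp
  also have "\<dots> = (\<integral>\<^sup>+ y. ennreal (?g y) \<partial>kernel 1 x)"
    by (intro nn_integral_cong Suc.IH) (simp add: space_kernel)
  also have "\<dots> = ennreal (\<integral>y. ?g y \<partial>kernel 1 x)"
    using int by (intro nn_integral_eq_integral AE_I2) (auto simp: space_kernel step_iter_nonneg f)
  also have "(\<integral>y. ?g y \<partial>kernel 1 x) = step ?g x"
    by (rule step_def[symmetric])
  finally show ?case by simp
qed

lemma indicator_weighted: "A \<in> sets E \<Longrightarrow> indicator A \<in> weighted_space E \<phi>\<^sub>1"
  using E2_phi1(1) by (intro weighted_space_bounded[where c = 1]) (auto simp: indicator_def)

lemma one_weighted: "(\<lambda>_. 1) \<in> weighted_space E \<phi>\<^sub>1"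
  using E2_phi1(1) by (intro weighted_space_bounded[where c = 1]) auto

lemma \<phi>\<^sub>2_weighted: "\<phi>\<^sub>2 \<in> weighted_space E \<phi>\<^sub>1"
  using E2_phi1(1) E2_phi2(2) phi_nonneg(2) phi_measurable(2) by (intro weighted_space_bounded[where c = 1]) auto

lemma emeasure_kernel_eq_iter:
  assumes x: "x \<in> space E" and A: "A \<in> sets E"
  shows "emeasure (kernel n x) A = ennreal ((step ^^ n) (indicator A) x)"
  using nn_integral_kernel_eq_iter[OF indicator_weighted[OF A] _ x, of n] A
  by (simp add: ennreal_indicator sets_kernel)

lemma emeasure_kernel_space:
  assumes x: "x \<in> space E"
  shows "emeasure (kernel n x) (space E) = ennreal ((step ^^ n) (\<lambda>_. 1) x)"
  using nn_integral_kernel_eq_iter[OF one_weighted _ x, of n] by (simp add: space_kernel)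

text \<open>
  (E3) with the quotient of supremum and infimum resolved; a vanishing infimum would make the quotient infinite
  unless the supremum vanishes as well.
\<close>

lemma survival_comparable_on_K:
  assumes x: "x \<in> K" and y: "y \<in> K"
  shows "(step ^^ n) (\<lambda>_. 1) x \<le> c\<^sub>3 * (step ^^ n) (\<lambda>_. 1) y"
proof -
  define u where "u y = emeasure (P y) {\<omega> \<in> space (P y). survives n \<omega>}" for y
  have u: "u y = ennreal ((step ^^ n) (\<lambda>_. 1) y)" if "y \<in> K" for y
    using emeasure_survives[OF K_into_E[OF that]] emeasure_kernel_space[OF K_into_E[OF that]] by (simp add: u_def)
  define a where "a = (SUP y\<in>K. u y)"
  define b where "b = (INF y\<in>K. u y)"
  have "a / b \<le> ennreal c\<^sub>3"
    using order_trans[OF SUP_upper E3] unfolding a_def b_def u_def by blast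
  moreover have "b \<noteq> top"
  proof -
    have "b \<le> u y" unfolding b_def by (rule INF_lower[OF y])
    also have "u y < top" using u[OF y] by simp
    finally show ?thesis by simp
  qed
  ultimately have "a \<le> ennreal c\<^sub>3 * b"
  proof (cases "b = 0")
    case True
    then show ?thesis using \<open>a / b \<le> ennreal c\<^sub>3\<close>
      by (cases "a = 0") (auto simp: ennreal_divide_zero top_unique)
  next
    case False
    then have "a = a / b * b" using \<open>b \<noteq> top\<close>
      by (simp add: ennreal_divide_times ennreal_divide_self less_top)
    then show ?thesis using mult_right_mono[OF \<open>a / b \<le> ennreal c\<^sub>3\<close>, of b] by simp
  qed
  have "u x \<le> a" unfolding a_def by (rule SUP_upper[OF x])
  also note \<open>a \<le> ennreal c\<^sub>3 * b\<close>
  also have "ennreal c\<^sub>3 * b \<le> ennreal c\<^sub>3 * u y"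
    unfolding b_def by (intro mult_left_mono INF_lower y) simp
  finally have "ennreal ((step ^^ n) (\<lambda>_. 1) x) \<le> ennreal (c\<^sub>3 * (step ^^ n) (\<lambda>_. 1) y)"
    using constants_pos step_iter_nonneg[OF one_weighted _ K_into_E[OF y]] by (simp add: u x y ennreal_mult)
  then show ?thesis
    using constants_pos step_iter_nonneg[OF one_weighted _ K_into_E[OF y]] by (subst (asm) ennreal_le_iff) auto
qed

text \<open>
  The minorizing probability, carried from \<open>K\<close> to \<open>E\<close>.
\<close>

definition \<nu>E :: "'a measure" where "\<nu>E = distr \<nu> E (\<lambda>x. x)"

lemma \<nu>E: "sets \<nu>E = sets E" "prob_space \<nu>E" "\<And>A. A \<in> sets E \<Longrightarrow> emeasure \<nu>E A = emeasure \<nu> (A \<inter> K)"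
proof -
  have \<nu>: "sets \<nu> = sets (restrict_space E K)" "prob_space \<nu>" "space \<nu> = K"
    using nu_prob sets_eq_imp_space_eq[of \<nu> "restrict_space E K"] K_sets by (auto simp: space_prob_algebra)
  have "(\<lambda>x. x) \<in> measurable (restrict_space E K) E" by (rule measurable_restrict_space1) simp
  then have id: "(\<lambda>x. x) \<in> measurable \<nu> E" using \<nu>(1) by (simp cong: measurable_cong_sets)
  show "sets \<nu>E = sets E" by (simp add: \<nu>E_def)
  show "prob_space \<nu>E" unfolding \<nu>E_def by (rule prob_space.prob_space_distr[OF \<nu>(2) id])
  show "emeasure \<nu>E A = emeasure \<nu> (A \<inter> K)" if "A \<in> sets E" for A
    using emeasure_distr[OF id that] \<nu>(3) by (simp add: \<nu>E_def vimage_def Int_def conj_commute)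
qed

lemma \<nu>E_minorizes:
  assumes x: "x \<in> K" and f: "f \<in> borel_measurable E"
  shows "ennreal c\<^sub>1 * (\<integral>\<^sup>+ y. f y \<partial>\<nu>E) \<le> (\<integral>\<^sup>+ y. f y \<partial>kernel n\<^sub>1 x)"
proof -
  interpret \<nu>: prob_space \<nu> using nu_prob by (simp add: space_prob_algebra)
  have "scale_measure (ennreal c\<^sub>1) \<nu>E \<le> kernel n\<^sub>1 x"
  proof (rule le_measure[THEN iffD2])
    show "sets (scale_measure (ennreal c\<^sub>1) \<nu>E) = sets (kernel n\<^sub>1 x)" by (simp add: \<nu>E sets_kernel)
    show "\<forall>A\<in>sets (scale_measure (ennreal c\<^sub>1) \<nu>E). emeasure (scale_measure (ennreal c\<^sub>1) \<nu>E) A \<le> emeasure (kernel n\<^sub>1 x) A"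
    proof
      fix A assume "A \<in> sets (scale_measure (ennreal c\<^sub>1) \<nu>E)"
      then have A: "A \<in> sets E" by (simp add: \<nu>E)
      interpret Px: prob_space "P x" by (rule law(1)[OF K_into_E[OF x]])
      have "ennreal (c\<^sub>1 * measure \<nu> (A \<inter> K)) \<le> ennreal (\<P>(\<omega> in P x. X (real n\<^sub>1) \<omega> \<in> A))"
        by (intro ennreal_leI E1 x A)
      also have "\<dots> = emeasure (kernel n\<^sub>1 x) A"
        by (simp add: emeasure_kernel[OF K_into_E[OF x] A] Px.emeasure_eq_measure)
      finally show "emeasure (scale_measure (ennreal c\<^sub>1) \<nu>E) A \<le> emeasure (kernel n\<^sub>1 x) A"
        using constants_pos by (simp add: \<nu>E(3)[OF A] \<nu>.emeasure_eq_measure ennreal_mult)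
    qed
  qed
  then have "(\<integral>\<^sup>+ y. f y \<partial>scale_measure (ennreal c\<^sub>1) \<nu>E) \<le> (\<integral>\<^sup>+ y. f y \<partial>kernel n\<^sub>1 x)"
    by (intro nn_integral_mono_measure) (simp_all add: \<nu>E sets_kernel)
  moreover have "f \<in> borel_measurable \<nu>E" using f \<nu>E(1) by (simp cong: measurable_cong_sets)
  ultimately show ?thesis by (simp add: nn_integral_scale_measure)
qed

lemma \<phi>\<^sub>1_\<nu>E_integrable: "integrable \<nu>E \<phi>\<^sub>1"
proof (rule integrableI_nonneg)
  obtain x where x: "x \<in> K" using K_nonempty by blast
  have "ennreal c\<^sub>1 * (\<integral>\<^sup>+ y. ennreal (\<phi>\<^sub>1 y) \<partial>\<nu>E) \<le> ennreal ((step ^^ n\<^sub>1) \<phi>\<^sub>1 x)"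
    using \<nu>E_minorizes[OF x, of "\<lambda>y. ennreal (\<phi>\<^sub>1 y)"] phi_measurable(1)
      nn_integral_kernel_eq_iter[OF \<phi>\<^sub>1_weighted phi_nonneg(1) K_into_E[OF x]] by simp
  then have "ennreal c\<^sub>1 * (\<integral>\<^sup>+ y. ennreal (\<phi>\<^sub>1 y) \<partial>\<nu>E) < \<infinity>" by (simp add: le_less_trans)
  then show "(\<integral>\<^sup>+ y. ennreal (\<phi>\<^sub>1 y) \<partial>\<nu>E) < \<infinity>"
    using constants_pos by (auto simp: ennreal_mult_less_top)
  show "\<phi>\<^sub>1 \<in> borel_measurable \<nu>E" using phi_measurable(1) \<nu>E(1) by (simp cong: measurable_cong_sets)
  show "AE x in \<nu>E. 0 \<le> \<phi>\<^sub>1 x"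
    using sets_eq_imp_space_eq[OF \<nu>E(1)] phi_nonneg(1) by (intro AE_I2) auto
qed

text \<open>
  In (E4) the time after which \<open>K\<close> is charged depends on the starting point. By countable additivity, one such time
  works for a set of starting points of positive \<open>\<nu>\<close>-measure, which suffices after averaging
  over \<open>\<nu>\<close>.
\<close>

lemma eventually_returns_to_K:
  obtains N where "\<And>n. N \<le> n \<Longrightarrow> 0 < (\<integral>x. (step ^^ n) (indicator K) x \<partial>\<nu>E)"
proof -
  interpret \<nu>E: prob_space \<nu>E by (rule \<nu>E(2))
  let ?r = "\<lambda>n. (step ^^ n) (indicator K)"
  define B where "B N = {x \<in> space E. x \<in> K \<and> (\<forall>n\<in>{N..}. 0 < ?r n x)}" for N
  have [measurable]: "K \<in> sets E" by (rule K_sets)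
  have [measurable]: "?r n \<in> borel_measurable E" for n
    by (rule weighted_space_measurable[OF step_iter_weighted[OF indicator_weighted[OF K_sets]]])
  have B_sets: "B N \<in> sets E" for N unfolding B_def by measurable
  have return: "0 < ?r n x \<longleftrightarrow> 0 < \<P>(\<omega> in P x. X (real n) \<omega> \<in> K)" if x: "x \<in> K" for x n
  proof -
    interpret Px: prob_space "P x" by (rule law(1)[OF K_into_E[OF x]])
    have "ennreal (?r n x) = ennreal (\<P>(\<omega> in P x. X (real n) \<omega> \<in> K))"
      using emeasure_kernel_eq_iter[OF K_into_E[OF x] K_sets, of n] emeasure_kernel[OF K_into_E[OF x] K_sets, of n]
      by (simp add: Px.emeasure_eq_measure)
    then have "?r n x = \<P>(\<omega> in P x. X (real n) \<omega> \<in> K)"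
      using step_iter_nonneg[OF indicator_weighted[OF K_sets] _ K_into_E[OF x], of n]
      by (subst (asm) ennreal_inj) auto
    then show ?thesis by simp
  qed
  have "K \<subseteq> (\<Union>N. B N)"
    using E4 return K_into_E by (fastforce simp: B_def)
  have "\<exists>N. emeasure \<nu>E (B N) \<noteq> 0"
  proof (rule ccontr)
    assume "\<not> ?thesis"
    then have "emeasure \<nu>E (\<Union>N. B N) = 0"
      using B_sets \<nu>E(1) by (intro emeasure_UN_eq_0) auto
    then have "emeasure \<nu>E K = 0"
      using emeasure_mono[OF \<open>K \<subseteq> (\<Union>N. B N)\<close>, of \<nu>E] B_sets \<nu>E(1) by auto
    moreover have "emeasure \<nu>E K = emeasure \<nu>E (space \<nu>E)"
      using \<nu>E(3)[OF K_sets] \<nu>E(3)[of "space E"] sets_eq_imp_space_eq[OF \<nu>E(1)] sets.sets_into_space[OF K_sets]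
      by (simp add: Int_absorb1)
    ultimately show False using \<nu>E.emeasure_space_1 by simp
  qed
  then obtain N where N: "emeasure \<nu>E (B N) \<noteq> 0" by blast
  show thesis
  proof (rule that)
    fix n assume n: "N \<le> n"
    have nonneg: "AE x in \<nu>E. 0 \<le> ?r n x"
      using sets_eq_imp_space_eq[OF \<nu>E(1)] step_iter_nonneg[OF indicator_weighted[OF K_sets]]
      by (intro AE_I2) auto
    have int: "integrable \<nu>E (?r n)"
      by (rule integrable_weighted[OF \<nu>E(1) \<phi>\<^sub>1_\<nu>E_integrable step_iter_weighted[OF indicator_weighted[OF K_sets]]])
    have "(\<integral>x. ?r n x \<partial>\<nu>E) \<noteq> 0"
    proof
      assume "(\<integral>x. ?r n x \<partial>\<nu>E) = 0"
      then have "AE x in \<nu>E. ?r n x = 0"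
        using integral_nonneg_eq_0_iff_AE[OF int nonneg] by simp
      then have "AE x in \<nu>E. x \<notin> B N"
        by eventually_elim (use n in \<open>auto simp: B_def intro!: bexI[of _ n]\<close>)
      then have "emeasure \<nu>E (B N) = 0"
        using B_sets[of N] \<nu>E(1) sets.sets_into_space[OF B_sets[of N]] sets_eq_imp_space_eq[OF \<nu>E(1)]
        by (subst (asm) AE_iff_measurable[of "B N"]) auto
      with N show False by simp
    qed
    then show "0 < (\<integral>x. ?r n x \<partial>\<nu>E)"
      using integral_nonneg_AE[OF nonneg] by simp
  qed
qed

lemma step_lyapunov_doeblin:
  obtains z N where "lyapunov_doeblin_operator E \<phi>\<^sub>1 \<phi>\<^sub>2 K z step (\<lambda>f. integral\<^sup>L \<nu>E f) \<theta>\<^sub>1 \<theta>\<^sub>2 c\<^sub>1 c\<^sub>2 c\<^sub>3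
      (INF x\<in>K. \<phi>\<^sub>2 x) n\<^sub>1 N"
proof -
  obtain z where z: "z \<in> K" using K_nonempty by blast
  obtain N where N: "\<And>n. N \<le> n \<Longrightarrow> 0 < (\<integral>x. (step ^^ n) (indicator K) x \<partial>\<nu>E)"
    using eventually_returns_to_K by blast
  have "lyapunov_doeblin_operator E \<phi>\<^sub>1 \<phi>\<^sub>2 K z step (\<lambda>f. integral\<^sup>L \<nu>E f) \<theta>\<^sub>1 \<theta>\<^sub>2 c\<^sub>1 c\<^sub>2 c\<^sub>3
      (INF x\<in>K. \<phi>\<^sub>2 x) n\<^sub>1 N"
  proof
    show "(INF x\<in>K. \<phi>\<^sub>2 x) \<le> \<phi>\<^sub>2 x" if "x \<in> K" for x
      using that phi_nonneg(2) K_into_E by (intro cINF_lower bdd_belowI2[where m = 0]) auto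
    show "step (\<lambda>_. 1) x \<le> 1" if "x \<in> space E" for x
    proof -
      interpret subprob_space "kernel 1 x" by (rule kernel_subprob[OF that])
      show ?thesis using subprob_measure_le_1[of "space (kernel 1 x)"] by (simp add: step_def)
    qed
    show "\<theta>\<^sub>2 * \<phi>\<^sub>2 x \<le> step \<phi>\<^sub>2 x" if x: "x \<in> space E" for x
    proof -
      have "ennreal (\<theta>\<^sub>2 * \<phi>\<^sub>2 x) \<le> ennreal (step \<phi>\<^sub>2 x)"
        using E2_lower[OF x] nn_integral_kernel[OF x, of "\<lambda>y. ennreal (\<phi>\<^sub>2 y)" 1] phi_measurable(2)
          nn_integral_kernel_eq_iter[OF \<phi>\<^sub>2_weighted phi_nonneg(2) x, of 1] by simp
      then show ?thesis
        using step_iter_nonneg[OF \<phi>\<^sub>2_weighted phi_nonneg(2) x, of 1] by (subst (asm) ennreal_le_iff) auto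
    qed
    show "pos_linear E \<phi>\<^sub>1 (\<lambda>f. integral\<^sup>L \<nu>E f)"
      by (rule integral_pos_linear[OF \<nu>E(1) \<phi>\<^sub>1_\<nu>E_integrable])
    show "integral\<^sup>L \<nu>E (indicator K :: 'a \<Rightarrow> real) = 1"
    proof -
      interpret \<nu>E: prob_space \<nu>E by (rule \<nu>E(2))
      have "emeasure \<nu>E K = emeasure \<nu>E (space \<nu>E)"
        using \<nu>E(3)[OF K_sets] \<nu>E(3)[of "space E"] sets_eq_imp_space_eq[OF \<nu>E(1)] sets.sets_into_space[OF K_sets]
        by (simp add: Int_absorb1)
      then have "measure \<nu>E K = 1" by (simp add: \<nu>E.emeasure_space_1 measure_def)
      moreover have "K \<inter> space \<nu>E = K"
        using sets_eq_imp_space_eq[OF \<nu>E(1)] sets.sets_into_space[OF K_sets] by auto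
      ultimately show ?thesis by simp
    qed
    show "c\<^sub>1 * integral\<^sup>L \<nu>E f \<le> (step ^^ n\<^sub>1) f x"
      if x: "x \<in> K" and f: "f \<in> weighted_space E \<phi>\<^sub>1" and f0: "\<And>y. y \<in> space E \<Longrightarrow> 0 \<le> f y" for x f
    proof -
      have "(\<integral>\<^sup>+ y. ennreal (f y) \<partial>\<nu>E) = ennreal (integral\<^sup>L \<nu>E f)"
        using sets_eq_imp_space_eq[OF \<nu>E(1)] f0
        by (intro nn_integral_eq_integral integrable_weighted[OF \<nu>E(1) \<phi>\<^sub>1_\<nu>E_integrable f] AE_I2) auto
      then have "ennreal (c\<^sub>1 * integral\<^sup>L \<nu>E f) \<le> ennreal ((step ^^ n\<^sub>1) f x)"
        using \<nu>E_minorizes[OF x, of "\<lambda>y. ennreal (f y)"] weighted_space_measurable[OF f] constants_pos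
          nn_integral_kernel_eq_iter[OF f f0 K_into_E[OF x], of n\<^sub>1]
        by (simp add: ennreal_mult')
      then show ?thesis
        using step_iter_nonneg[OF f f0 K_into_E[OF x], of n\<^sub>1] by (subst (asm) ennreal_le_iff) auto
    qed
  qed (use phi_measurable phi_nonneg K_sets z E2_phi1 E2_phi2 E2_theta constants_pos step_weighted
        step_pos_linear step_\<phi>\<^sub>1 survival_comparable_on_K N in auto)
  then show thesis by (rule that)
qed

end

section \<open>Quasi-stationary distributions\<close>

context assumption_E
begin

lemma muPn_eq_bind:
  assumes \<mu>: "\<mu> \<in> space (prob_algebra E)" shows "muPn \<mu> n = \<mu> \<bind> kernel n"
proof -
  have sets: "sets \<mu> = sets E" "space \<mu> = space E"
    using \<mu> sets_eq_imp_space_eq[of \<mu> E] by (auto simp: space_prob_algebra)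
  have meas: "kernel n \<in> measurable \<mu> (subprob_algebra E)"
    using kernel_meas sets by (simp cong: measurable_cong_sets)
  have ne: "space \<mu> \<noteq> {}" using sets E_nonempty by simp
  have bind_sets: "sets (\<mu> \<bind> kernel n) = sets E" using ne by (simp add: sets_kernel)
  have em: "emeasure (\<mu> \<bind> kernel n) A = (\<integral>\<^sup>+ x. Pn n (indicator A) x \<partial>\<mu>)" if "A \<in> sets E" for A
    unfolding emeasure_bind[OF ne meas that]
  proof (rule nn_integral_cong)
    fix x assume "x \<in> space \<mu>"
    then show "emeasure (kernel n x) A = Pn n (indicator A) x"
      using nn_integral_kernel[of x "indicator A" n] that sets by (simp add: sets_kernel)
  qed
  have "muPn \<mu> n = measure_of (space E) (sets E) (emeasure (\<mu> \<bind> kernel n))"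
    unfolding muPn_def by (rule measure_of_eq[OF sets.space_closed]) (simp add: em sets.sigma_sets_eq)
  also have "\<dots> = \<mu> \<bind> kernel n"
    using measure_of_of_measure[of "\<mu> \<bind> kernel n"] bind_sets sets_eq_imp_space_eq[OF bind_sets] by simp
  finally show ?thesis .
qed

lemma nn_integral_bind_kernel:
  assumes \<mu>: "\<mu> \<in> space (prob_algebra E)" "integrable \<mu> \<phi>\<^sub>1"
    and f: "f \<in> weighted_space E \<phi>\<^sub>1" "\<And>x. x \<in> space E \<Longrightarrow> 0 \<le> f x"
  shows "(\<integral>\<^sup>+ x. ennreal (f x) \<partial>(\<mu> \<bind> kernel n)) = ennreal (\<integral>x. (step ^^ n) f x \<partial>\<mu>)"
proof -
  have sets: "sets \<mu> = sets E" "space \<mu> = space E"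
    using \<mu> sets_eq_imp_space_eq[of \<mu> E] by (auto simp: space_prob_algebra)
  have meas: "kernel n \<in> measurable \<mu> (subprob_algebra E)"
    using kernel_meas sets by (simp cong: measurable_cong_sets)
  have "(\<integral>\<^sup>+ x. ennreal (f x) \<partial>(\<mu> \<bind> kernel n)) = (\<integral>\<^sup>+ x. \<integral>\<^sup>+ y. ennreal (f y) \<partial>kernel n x \<partial>\<mu>)"
    using weighted_space_measurable[OF f(1)] by (intro nn_integral_bind[OF _ meas]) simp
  also have "\<dots> = (\<integral>\<^sup>+ x. ennreal ((step ^^ n) f x) \<partial>\<mu>)"
    using sets by (intro nn_integral_cong nn_integral_kernel_eq_iter f) auto
  also have "\<dots> = ennreal (\<integral>x. (step ^^ n) f x \<partial>\<mu>)"
    using sets by (intro nn_integral_eq_integral integrable_weighted[OF sets(1) \<mu>(2)] step_iter_weighted f AE_I2)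
      (auto simp: step_iter_nonneg f)
  finally show ?thesis .
qed

lemma measure_bind_law:
  assumes \<mu>: "\<mu> \<in> space (prob_algebra E)" "integrable \<mu> \<phi>\<^sub>1"
    and A: "A \<in> sets E" and B: "B \<in> sets \<Omega>"
    and AB: "\<And>x. x \<in> space E \<Longrightarrow> AE \<omega> in P x. \<omega> \<in> B \<longleftrightarrow> X (real n) \<omega> \<in> A"
  shows "measure (\<mu> \<bind> P) B = (\<integral>x. (step ^^ n) (indicator A) x \<partial>\<mu>)"
proof -
  have sets: "sets \<mu> = sets E" "space \<mu> = space E"
    using \<mu> sets_eq_imp_space_eq[of \<mu> E] by (auto simp: space_prob_algebra)
  have ne: "space \<mu> \<noteq> {}" using sets E_nonempty by simp
  have P_meas: "P \<in> measurable \<mu> (subprob_algebra \<Omega>)"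
    using measurable_compose[OF inclusion_measurable measurable_prob_algebraD[OF P_kernel]] sets
    by (simp cong: measurable_cong_sets)
  have "emeasure (\<mu> \<bind> P) B = (\<integral>\<^sup>+ x. emeasure (P x) B \<partial>\<mu>)"
    by (rule emeasure_bind[OF ne P_meas B])
  also have "\<dots> = (\<integral>\<^sup>+ x. ennreal ((step ^^ n) (indicator A) x) \<partial>\<mu>)"
  proof (rule nn_integral_cong)
    fix x assume "x \<in> space \<mu>"
    then have x: "x \<in> space E" using sets by simp
    have "emeasure (P x) B = emeasure (P x) {\<omega> \<in> space (P x). X (real n) \<omega> \<in> A}"
    proof (rule emeasure_eq_AE)
      show "AE \<omega> in P x. \<omega> \<in> B \<longleftrightarrow> \<omega> \<in> {\<omega> \<in> space (P x). X (real n) \<omega> \<in> A}"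
        using AB[OF x] AE_space by eventually_elim auto
      show "{\<omega> \<in> space (P x). X (real n) \<omega> \<in> A} \<in> sets (P x)"
        using measurable_sets[OF X_measurable_law[OF x] sets_E_subset[OF A]]
        by (simp add: vimage_def Int_def conj_commute)
    qed (use B in \<open>simp add: law[OF x]\<close>)
    then show "emeasure (P x) B = ennreal ((step ^^ n) (indicator A) x)"
      by (simp add: emeasure_kernel[OF x A, symmetric] emeasure_kernel_eq_iter[OF x A])
  qed
  also have "\<dots> = ennreal (\<integral>x. (step ^^ n) (indicator A) x \<partial>\<mu>)"
    using sets by (intro nn_integral_eq_integral integrable_weighted[OF sets(1) \<mu>(2)] step_iter_weighted
        indicator_weighted A AE_I2) (auto simp: step_iter_nonneg indicator_weighted A)
  finally have "emeasure (\<mu> \<bind> P) B = ennreal (\<integral>x. (step ^^ n) (indicator A) x \<partial>\<mu>)" .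
  moreover have "0 \<le> (\<integral>x. (step ^^ n) (indicator A) x \<partial>\<mu>)"
    using sets by (intro integral_nonneg_AE AE_I2) (auto simp: step_iter_nonneg indicator_weighted A)
  ultimately show ?thesis by (simp add: measure_def)
qed

text \<open>
  Under this identity, being quasi-stationary means being fixed by \<open>normalized step\<close> at all times.
\<close>

lemma conditional_law:
  assumes \<mu>: "\<mu> \<in> space (prob_algebra E)" "integrable \<mu> \<phi>\<^sub>1" and A: "A \<in> sets E"
  shows "\<P>(\<omega> in \<mu> \<bind> P. X (real n) \<omega> \<in> A \<bar> survives n \<omega>)
    = normalized step (\<lambda>f. integral\<^sup>L \<mu> f) n (indicator A)"
proof -
  have sets: "space \<mu> = space E"
    using \<mu> sets_eq_imp_space_eq[of \<mu> E] by (auto simp: space_prob_algebra)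
  have "sets (\<mu> \<bind> P) = sets \<Omega>"
    using E_nonempty law(2) sets by (intro sets_bind) auto
  then have space_bind: "space (\<mu> \<bind> P) = space \<Omega>" by (rule sets_eq_imp_space_eq)
  have "{\<omega> \<in> space \<Omega>. X (real n) \<omega> \<in> A} \<in> sets \<Omega>"
    using measurable_sets[OF X_measurable[OF nat_in_time_set] sets_E_subset[OF A]]
    by (simp add: vimage_def Int_def conj_commute)
  then have "{\<omega> \<in> space \<Omega>. X (real n) \<omega> \<in> A} \<inter> {\<omega> \<in> space \<Omega>. survives n \<omega>} \<in> sets \<Omega>"
    using absorption_event[of n] by blast
  also have "{\<omega> \<in> space \<Omega>. X (real n) \<omega> \<in> A} \<inter> {\<omega> \<in> space \<Omega>. survives n \<omega>}
      = {\<omega> \<in> space \<Omega>. X (real n) \<omega> \<in> A \<and> survives n \<omega>}" by auto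
  finally have joint: "\<P>(\<omega> in \<mu> \<bind> P. X (real n) \<omega> \<in> A \<and> survives n \<omega>) = (\<integral>x. (step ^^ n) (indicator A) x \<partial>\<mu>)"
    unfolding space_bind
  proof (rule measure_bind_law[OF \<mu> A])
    fix x assume x: "x \<in> space E"
    show "AE \<omega> in P x. \<omega> \<in> {\<omega> \<in> space \<Omega>. X (real n) \<omega> \<in> A \<and> survives n \<omega>} \<longleftrightarrow> X (real n) \<omega> \<in> A"
      using survives_iff[OF x, of n] AE_space
      by eventually_elim (use sets.sets_into_space[OF A] in \<open>auto simp: law[OF x]\<close>)
  qed
  have "\<P>(\<omega> in \<mu> \<bind> P. survives n \<omega>) = (\<integral>x. (step ^^ n) (indicator (space E)) x \<partial>\<mu>)"
    unfolding space_bind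
  proof (rule measure_bind_law[OF \<mu> sets.top absorption_event])
    fix x assume x: "x \<in> space E"
    show "AE \<omega> in P x. \<omega> \<in> {\<omega> \<in> space \<Omega>. survives n \<omega>} \<longleftrightarrow> X (real n) \<omega> \<in> space E"
      using survives_iff[OF x, of n] AE_space by eventually_elim (auto simp: law[OF x])
  qed
  also have "\<dots> = (\<integral>x. (step ^^ n) (\<lambda>_. 1) x \<partial>\<mu>)"
  proof (rule Bochner_Integration.integral_cong)
    fix x assume "x \<in> space \<mu>"
    then have x: "x \<in> space E" using sets by simp
    have "ennreal ((step ^^ n) (indicator (space E)) x) = ennreal ((step ^^ n) (\<lambda>_. 1) x)"
      using emeasure_kernel_eq_iter[OF x sets.top, of n] emeasure_kernel_space[OF x, of n] by simp
    then show "(step ^^ n) (indicator (space E)) x = (step ^^ n) (\<lambda>_. 1) x"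
      using x by (subst (asm) ennreal_inj) (auto simp: step_iter_nonneg indicator_weighted one_weighted)
  qed simp
  finally show ?thesis
    unfolding cond_prob_def joint by (simp add: normalized_def)
qed

lemma integral_normalized_muPn:
  assumes \<mu>: "\<mu> \<in> space (prob_algebra E)" "integrable \<mu> \<phi>\<^sub>1" and \<mu>\<phi>\<^sub>2: "0 < integral\<^sup>L \<mu> \<phi>\<^sub>2"
    and f: "f \<in> weighted_space E \<phi>\<^sub>1"
  shows "integral\<^sup>L (normalized_muPn \<mu> n) f = normalized step (\<lambda>f. integral\<^sup>L \<mu> f) n f"
proof -
  obtain z N where "lyapunov_doeblin_operator E \<phi>\<^sub>1 \<phi>\<^sub>2 K z step (\<lambda>f. integral\<^sup>L \<nu>E f) \<theta>\<^sub>1 \<theta>\<^sub>2 c\<^sub>1 c\<^sub>2 c\<^sub>3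
      (INF x\<in>K. \<phi>\<^sub>2 x) n\<^sub>1 N"
    by (rule step_lyapunov_doeblin)
  then interpret L: lyapunov_doeblin_operator E \<phi>\<^sub>1 \<phi>\<^sub>2 K z step "\<lambda>f. integral\<^sup>L \<nu>E f" \<theta>\<^sub>1 \<theta>\<^sub>2 c\<^sub>1 c\<^sub>2 c\<^sub>3
      "INF x\<in>K. \<phi>\<^sub>2 x" n\<^sub>1 N .
  have sets: "sets \<mu> = sets E" "space \<mu> = space E"
    using \<mu> sets_eq_imp_space_eq[of \<mu> E] by (auto simp: space_prob_algebra)
  note lin = integral_pos_linear[OF sets(1) \<mu>(2)]
  define d where "d = (\<integral>x. (step ^^ n) (\<lambda>_. 1) x \<partial>\<mu>)"
  have "(\<integral>x. \<theta>\<^sub>2 ^ n * \<phi>\<^sub>2 x \<partial>\<mu>) \<le> (\<integral>x. L.survival n x \<partial>\<mu>)"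
    by (intro pos_linear_mono[OF lin] weighted_space_scale \<phi>\<^sub>2_weighted L.survival_weighted L.survival_ge_\<psi>)
  moreover have "0 < \<theta>\<^sub>2 ^ n * integral\<^sup>L \<mu> \<phi>\<^sub>2" using \<mu>\<phi>\<^sub>2 constants_pos by simp
  ultimately have d: "0 < d" by (simp add: d_def L.survival_def)
  have bind_sets: "sets (\<mu> \<bind> kernel n) = sets E"
    using E_nonempty sets by (simp add: sets_kernel)
  have norm_sets: "sets (normalized_muPn \<mu> n) = sets E"
    by (simp add: normalized_muPn_def muPn_eq_bind[OF \<mu>(1)] bind_sets)
  have mass: "emeasure (\<mu> \<bind> kernel n) (space E) = ennreal d"
    using nn_integral_bind_kernel[OF \<mu> one_weighted, of n] sets_eq_imp_space_eq[OF bind_sets] by (simp add: d_def)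
  have "integral\<^sup>L (normalized_muPn \<mu> n) f = integral\<^sup>L \<mu> ((step ^^ n) f) / d"
  proof (rule integral_eq_pos_linear(2)[OF norm_sets pos_linear_divide[OF L.pos_linear_iter[OF lin]] f])
    show "0 \<le> d" using d by simp
    fix g assume g: "g \<in> weighted_space E \<phi>\<^sub>1" "\<And>x. 0 \<le> g x"
    have "(\<lambda>x. ennreal (g x)) \<in> borel_measurable (\<mu> \<bind> kernel n)"
      using weighted_space_measurable[OF g(1)] bind_sets by (simp cong: measurable_cong_sets)
    then have "(\<integral>\<^sup>+ x. ennreal (g x) \<partial>normalized_muPn \<mu> n)
        = inverse (ennreal d) * ennreal (integral\<^sup>L \<mu> ((step ^^ n) g))"
      unfolding normalized_muPn_def muPn_eq_bind[OF \<mu>(1)] mass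
      by (simp add: nn_integral_scale_measure nn_integral_bind_kernel[OF \<mu> g])
    also have "\<dots> = ennreal (integral\<^sup>L \<mu> ((step ^^ n) g) / d)"
    proof -
      have "0 \<le> integral\<^sup>L \<mu> ((step ^^ n) g)"
        using g by (intro pos_linear_nonneg[OF lin] step_iter_weighted step_iter_nonneg) auto
      then show ?thesis
        using d by (simp add: inverse_ennreal divide_inverse mult.commute flip: ennreal_mult)
    qed
    finally show "(\<integral>\<^sup>+ x. ennreal (g x) \<partial>normalized_muPn \<mu> n) = ennreal (integral\<^sup>L \<mu> ((step ^^ n) g) / d)" .
  qed
  then show ?thesis by (simp add: normalized_def d_def)
qed

lemma integral_of_nn_integral:
  assumes M: "sets M = sets E" and f: "f \<in> borel_measurable E" "\<And>x. x \<in> space E \<Longrightarrow> 0 \<le> f x"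
    and fin: "(\<integral>\<^sup>+ x. ennreal (f x) \<partial>M) < \<infinity>"
  shows "integrable M f" "(\<integral>\<^sup>+ x. ennreal (f x) \<partial>M) = ennreal (integral\<^sup>L M f)" "0 \<le> integral\<^sup>L M f"
proof -
  have nonneg: "AE x in M. 0 \<le> f x" using sets_eq_imp_space_eq[OF M] f(2) by (intro AE_I2) auto
  show int: "integrable M f"
    using f(1) M nonneg fin by (intro integrableI_nonneg) (simp_all cong: measurable_cong_sets)
  show "(\<integral>\<^sup>+ x. ennreal (f x) \<partial>M) = ennreal (integral\<^sup>L M f)"
    by (rule nn_integral_eq_integral[OF int nonneg])
  show "0 \<le> integral\<^sup>L M f" by (rule integral_nonneg_AE[OF nonneg])
qed

text \<open>
  The limiting functional inherits from the laws started at \<open>z\<close> the continuity that its representation needs: it is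
  uniformly close to \<open>f \<mapsto> \<integral> f d(kernel n z)\<close>, normalized, to which dominated convergence applies.
\<close>

lemma quasi_stationary_convergence:
  "\<exists>(C::real) (\<alpha>::real) \<nu>QSD.
    C > 0 \<and> 0 < \<alpha> \<and> \<alpha> < 1 \<and> \<nu>QSD \<in> space (prob_algebra E) \<and> measure \<nu>QSD K > 0 \<and>
    (\<forall>\<mu> \<in> space (prob_algebra E).
       (\<integral>\<^sup>+ x. ennreal (\<phi>\<^sub>1 x) \<partial>\<mu>) < \<infinity> \<and> (\<integral>\<^sup>+ x. ennreal (\<phi>\<^sub>2 x) \<partial>\<mu>) > 0 \<longrightarrow>
       (\<forall>n::nat. tv_dist E \<phi>\<^sub>1 (normalized_muPn \<mu> n) \<nu>QSD
          \<le> ennreal (C * \<alpha> ^ n) *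
             ((\<integral>\<^sup>+ x. ennreal (\<phi>\<^sub>1 x) \<partial>\<mu>) / (\<integral>\<^sup>+ x. ennreal (\<phi>\<^sub>2 x) \<partial>\<mu>)))) \<and>
    quasi_stationary \<nu>QSD \<and>
    (\<integral>\<^sup>+ x. ennreal (\<phi>\<^sub>2 x) \<partial>\<nu>QSD) > 0 \<and> (\<integral>\<^sup>+ x. ennreal (\<phi>\<^sub>1 x) \<partial>\<nu>QSD) < \<infinity> \<and>
    (\<forall>\<nu>'. quasi_stationary \<nu>' \<and>
       (\<integral>\<^sup>+ x. ennreal (\<phi>\<^sub>2 x) \<partial>\<nu>') > 0 \<and> (\<integral>\<^sup>+ x. ennreal (\<phi>\<^sub>1 x) \<partial>\<nu>') < \<infinity> \<longrightarrow> \<nu>' = \<nu>QSD)"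
proof -
  obtain z N where "lyapunov_doeblin_operator E \<phi>\<^sub>1 \<phi>\<^sub>2 K z step (\<lambda>f. integral\<^sup>L \<nu>E f) \<theta>\<^sub>1 \<theta>\<^sub>2 c\<^sub>1 c\<^sub>2 c\<^sub>3
      (INF x\<in>K. \<phi>\<^sub>2 x) n\<^sub>1 N"
    by (rule step_lyapunov_doeblin)
  then interpret L: lyapunov_doeblin_operator E \<phi>\<^sub>1 \<phi>\<^sub>2 K z step "\<lambda>f. integral\<^sup>L \<nu>E f" \<theta>\<^sub>1 \<theta>\<^sub>2 c\<^sub>1 c\<^sub>2 c\<^sub>3
      "INF x\<in>K. \<phi>\<^sub>2 x" n\<^sub>1 N .
  let ?D = "weighted_space E \<phi>\<^sub>1"
  obtain C \<alpha> \<xi> where C: "0 < C" and \<alpha>: "0 < \<alpha>" "\<alpha> < 1" and \<xi>: "pos_linear E \<phi>\<^sub>1 \<xi>" "\<xi> (\<lambda>_. 1) = 1" "0 < \<xi> (indicator K)"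
    "\<And>n. 0 < \<xi> (L.survival n)" "\<And>n f. f \<in> ?D \<Longrightarrow> \<xi> ((step ^^ n) f) = \<xi> (L.survival n) * \<xi> f"
    and conv: "\<And>\<mu> n f. pos_linear E \<phi>\<^sub>1 \<mu> \<Longrightarrow> \<mu> (\<lambda>_. 1) = 1 \<Longrightarrow> 0 < \<mu> \<phi>\<^sub>2 \<Longrightarrow>
       f \<in> borel_measurable E \<Longrightarrow> (\<And>x. x \<in> space E \<Longrightarrow> \<bar>f x\<bar> \<le> \<phi>\<^sub>1 x) \<Longrightarrow>
       \<bar>normalized step \<mu> n f - \<xi> f\<bar> \<le> C * \<alpha> ^ n * (\<mu> \<phi>\<^sub>1 / \<mu> \<phi>\<^sub>2)"
  proof (rule L.exponential_convergence, goal_cases)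
    case (1 B \<alpha> \<xi>)
    show ?case by (rule that[OF 1(2-10)])
  qed
  have geometric_0: "(\<lambda>n. C * \<alpha> ^ n * A) \<longlonglongrightarrow> 0" for A
  proof -
    have "(\<lambda>n. C * \<alpha> ^ n * A) \<longlonglongrightarrow> C * 0 * A"
      using \<alpha> by (intro tendsto_intros LIMSEQ_power_zero) auto
    then show ?thesis by simp
  qed
  have \<phi>\<^sub>2z: "0 < \<phi>\<^sub>2 z" using L.\<psi>_on_K[OF L.z_in_K] L.constants by simp
  have iter_integral: "integrable (kernel n z) f \<and> integral\<^sup>L (kernel n z) f = (step ^^ n) f z" if "f \<in> ?D" for n f
    using integral_eq_pos_linear[OF sets_kernel L.iter_pos_linear[OF L.z_space] that, of n z n]
      nn_integral_kernel_eq_iter[OF _ _ L.z_space] by blast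
  obtain M where M: "M \<in> space (prob_algebra E)" and M_int: "\<And>f. f \<in> ?D \<Longrightarrow> integrable M f \<and> integral\<^sup>L M f = \<xi> f"
  proof (rule daniell_representation[OF \<xi>(1) phi_measurable(1) E2_phi1(1) \<xi>(2)])
    fix F :: "nat \<Rightarrow> 'a \<Rightarrow> real"
    assume F: "\<And>i. F i \<in> borel_measurable E" "\<And>i x. x \<in> space E \<Longrightarrow> \<bar>F i x\<bar> \<le> \<phi>\<^sub>1 x"
      "\<And>x. x \<in> space E \<Longrightarrow> (\<lambda>i. F i x) \<longlonglongrightarrow> 0"
    have FD: "F i \<in> ?D" for i by (rule weighted_spaceI[where c = 1]) (use F in auto)
    show "(\<lambda>i. \<xi> (F i)) \<longlonglongrightarrow> 0"
    proof (rule LIMSEQ_I)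
      fix e :: real assume e: "0 < e"
      let ?A = "\<phi>\<^sub>1 z / \<phi>\<^sub>2 z"
      have "eventually (\<lambda>n. C * \<alpha> ^ n * ?A < e / 2) sequentially"
        using e by (intro order_tendstoD(2)[OF geometric_0]) auto
      then obtain n where n: "C * \<alpha> ^ n * ?A < e / 2" by (auto simp: eventually_sequentially)
      let ?\<zeta> = "normalized step (\<lambda>f. f z) n"
      have "(\<lambda>i. integral\<^sup>L (kernel n z) (F i)) \<longlonglongrightarrow> integral\<^sup>L (kernel n z) (\<lambda>_. 0)"
      proof (rule integral_dominated_convergence[where w = \<phi>\<^sub>1])
        show "F i \<in> borel_measurable (kernel n z)" for i
          using F(1) sets_kernel[of n z] by (simp cong: measurable_cong_sets)
        show "integrable (kernel n z) \<phi>\<^sub>1" using iter_integral[OF \<phi>\<^sub>1_weighted] by blast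
        show "AE x in kernel n z. (\<lambda>i. F i x) \<longlonglongrightarrow> 0" using F(3) by (intro AE_I2) (simp add: space_kernel)
        show "AE x in kernel n z. norm (F i x) \<le> \<phi>\<^sub>1 x" for i using F(2) by (intro AE_I2) (simp add: space_kernel)
      qed simp
      then have "(\<lambda>i. ?\<zeta> (F i)) \<longlonglongrightarrow> 0 / (step ^^ n) (\<lambda>_. 1) z"
        using iter_integral[OF FD] L.s_pos[of n]
        unfolding normalized_def by (intro tendsto_divide tendsto_const) (auto simp: L.s_def L.survival_def)
      then have "eventually (\<lambda>i. \<bar>?\<zeta> (F i)\<bar> < e / 2) sequentially"
        using e order_tendstoD(2)[OF tendsto_rabs_zero, of "\<lambda>i. ?\<zeta> (F i)" sequentially "e / 2"] by simp
      then obtain i\<^sub>0 where i0: "\<And>i. i\<^sub>0 \<le> i \<Longrightarrow> \<bar>?\<zeta> (F i)\<bar> < e / 2" by (auto simp: eventually_sequentially)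
      have "norm (\<xi> (F i) - 0) < e" if "i\<^sub>0 \<le> i" for i
      proof -
        have "\<bar>?\<zeta> (F i) - \<xi> (F i)\<bar> \<le> C * \<alpha> ^ n * ?A"
          by (rule conv[OF pos_linear_eval[OF L.z_space] refl \<phi>\<^sub>2z F(1) F(2)])
        then show ?thesis using i0[OF that] n unfolding real_norm_def diff_0_right by linarith
      qed
      then show "\<exists>no. \<forall>i\<ge>no. norm (\<xi> (F i) - 0) < e" by blast
    qed
  next
    fix M
    assume "M \<in> space (prob_algebra E)" "\<And>f. f \<in> ?D \<Longrightarrow> integrable M f \<and> integral\<^sup>L M f = \<xi> f"
    then show thesis by (rule that)
  qed
  have M_sets: "sets M = sets E" "space M = space E" and M_prob: "prob_space M"
    using M sets_eq_imp_space_eq[of M E] by (auto simp: space_prob_algebra)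
  have M_measure: "measure M A = \<xi> (indicator A)" if "A \<in> sets E" for A
    using M_int[OF indicator_weighted[OF that]] that M_sets sets.sets_into_space[OF that] by (simp add: Int_absorb2)
  have integrals: "integrable \<mu> \<phi>\<^sub>1" "pos_linear E \<phi>\<^sub>1 (\<lambda>f. integral\<^sup>L \<mu> f)" "integral\<^sup>L \<mu> (\<lambda>_. 1 :: real) = 1"
      "0 < integral\<^sup>L \<mu> \<phi>\<^sub>2" "(\<integral>\<^sup>+ x. ennreal (\<phi>\<^sub>1 x) \<partial>\<mu>) = ennreal (integral\<^sup>L \<mu> \<phi>\<^sub>1)"
      "(\<integral>\<^sup>+ x. ennreal (\<phi>\<^sub>2 x) \<partial>\<mu>) = ennreal (integral\<^sup>L \<mu> \<phi>\<^sub>2)" "0 \<le> integral\<^sup>L \<mu> \<phi>\<^sub>1"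
    if \<mu>: "\<mu> \<in> space (prob_algebra E)" "(\<integral>\<^sup>+ x. ennreal (\<phi>\<^sub>1 x) \<partial>\<mu>) < \<infinity>" "(\<integral>\<^sup>+ x. ennreal (\<phi>\<^sub>2 x) \<partial>\<mu>) > 0" for \<mu>
  proof -
    have sets: "sets \<mu> = sets E" "space \<mu> = space E" "prob_space \<mu>"
      using \<mu> sets_eq_imp_space_eq[of \<mu> E] by (auto simp: space_prob_algebra)
    note \<phi>\<^sub>1 = integral_of_nn_integral[OF sets(1) phi_measurable(1) phi_nonneg(1) \<mu>(2)]
    have "(\<integral>\<^sup>+ x. ennreal (\<phi>\<^sub>2 x) \<partial>\<mu>) \<le> (\<integral>\<^sup>+ x. ennreal (\<phi>\<^sub>1 x) \<partial>\<mu>)"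
      using sets order_trans[OF E2_phi2(2) E2_phi1(1)] by (intro nn_integral_mono ennreal_leI) auto
    then have fin: "(\<integral>\<^sup>+ x. ennreal (\<phi>\<^sub>2 x) \<partial>\<mu>) < \<infinity>" using \<mu>(2) by (rule le_less_trans)
    note \<phi>\<^sub>2 = integral_of_nn_integral[OF sets(1) phi_measurable(2) phi_nonneg(2) fin]
    show "integrable \<mu> \<phi>\<^sub>1" "(\<integral>\<^sup>+ x. ennreal (\<phi>\<^sub>1 x) \<partial>\<mu>) = ennreal (integral\<^sup>L \<mu> \<phi>\<^sub>1)" "0 \<le> integral\<^sup>L \<mu> \<phi>\<^sub>1"
      "(\<integral>\<^sup>+ x. ennreal (\<phi>\<^sub>2 x) \<partial>\<mu>) = ennreal (integral\<^sup>L \<mu> \<phi>\<^sub>2)"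
      using \<phi>\<^sub>1 \<phi>\<^sub>2 by blast+
    show "pos_linear E \<phi>\<^sub>1 (\<lambda>f. integral\<^sup>L \<mu> f)" by (rule integral_pos_linear[OF sets(1) \<phi>\<^sub>1(1)])
    show "integral\<^sup>L \<mu> (\<lambda>_. 1 :: real) = 1" using sets(3) by (simp add: prob_space.prob_space)
    have "0 < ennreal (integral\<^sup>L \<mu> \<phi>\<^sub>2)" by (rule less_le_trans[OF \<mu>(3)]) (rule eq_refl[OF \<phi>\<^sub>2(2)])
    then show "0 < integral\<^sup>L \<mu> \<phi>\<^sub>2" by simp
  qed
  have tv: "tv_dist E \<phi>\<^sub>1 (normalized_muPn \<mu> n) M
      \<le> ennreal (C * \<alpha> ^ n) * ((\<integral>\<^sup>+ x. ennreal (\<phi>\<^sub>1 x) \<partial>\<mu>) / (\<integral>\<^sup>+ x. ennreal (\<phi>\<^sub>2 x) \<partial>\<mu>))"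
    if \<mu>: "\<mu> \<in> space (prob_algebra E)" "(\<integral>\<^sup>+ x. ennreal (\<phi>\<^sub>1 x) \<partial>\<mu>) < \<infinity>" "(\<integral>\<^sup>+ x. ennreal (\<phi>\<^sub>2 x) \<partial>\<mu>) > 0" for \<mu> n
    unfolding tv_dist_def
  proof (rule SUP_least)
    note i = integrals[OF \<mu>]
    fix f assume "f \<in> {f \<in> borel_measurable E. \<forall>x\<in>space E. \<bar>f x\<bar> \<le> \<phi>\<^sub>1 x}"
    then have f: "f \<in> borel_measurable E" "\<And>x. x \<in> space E \<Longrightarrow> \<bar>f x\<bar> \<le> \<phi>\<^sub>1 x" by auto
    have fD: "f \<in> ?D" by (rule weighted_spaceI[where c = 1]) (use f in auto)
    have "\<bar>integral\<^sup>L (normalized_muPn \<mu> n) f - integral\<^sup>L M f\<bar> \<le> C * \<alpha> ^ n * (integral\<^sup>L \<mu> \<phi>\<^sub>1 / integral\<^sup>L \<mu> \<phi>\<^sub>2)"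
      using conv[OF i(2-4) f, of n] M_int[OF fD] integral_normalized_muPn[OF \<mu>(1) i(1,4) fD] by simp
    then have "ennreal \<bar>integral\<^sup>L (normalized_muPn \<mu> n) f - integral\<^sup>L M f\<bar>
        \<le> ennreal (C * \<alpha> ^ n * (integral\<^sup>L \<mu> \<phi>\<^sub>1 / integral\<^sup>L \<mu> \<phi>\<^sub>2))"
      by (rule ennreal_leI)
    also have "\<dots> = ennreal (C * \<alpha> ^ n) * ((\<integral>\<^sup>+ x. ennreal (\<phi>\<^sub>1 x) \<partial>\<mu>) / (\<integral>\<^sup>+ x. ennreal (\<phi>\<^sub>2 x) \<partial>\<mu>))"
      unfolding i(5,6) using C \<alpha> i(4,7) by (simp add: divide_ennreal flip: ennreal_mult)
    finally show "ennreal \<bar>integral\<^sup>L (normalized_muPn \<mu> n) f - integral\<^sup>L M f\<bar>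
        \<le> ennreal (C * \<alpha> ^ n) * ((\<integral>\<^sup>+ x. ennreal (\<phi>\<^sub>1 x) \<partial>\<mu>) / (\<integral>\<^sup>+ x. ennreal (\<phi>\<^sub>2 x) \<partial>\<mu>))" .
  qed
  have M\<phi>\<^sub>1: "integrable M \<phi>\<^sub>1" using M_int[OF \<phi>\<^sub>1_weighted] by blast
  have "\<xi> (\<lambda>x. (INF x\<in>K. \<phi>\<^sub>2 x) * indicator K x) \<le> \<xi> \<phi>\<^sub>2"
    using L.\<psi>_on_K phi_nonneg(2)
    by (intro pos_linear_mono[OF \<xi>(1)] weighted_space_scale indicator_weighted K_sets \<phi>\<^sub>2_weighted)
      (auto simp: indicator_def)
  moreover have "0 < (INF x\<in>K. \<phi>\<^sub>2 x) * \<xi> (indicator K)" using \<xi>(3) L.constants by simp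
  ultimately have \<xi>\<phi>\<^sub>2: "0 < \<xi> \<phi>\<^sub>2"
    by (simp add: pos_linear_scale[OF \<xi>(1)] indicator_weighted K_sets)
  have M\<phi>\<^sub>1_nn: "(\<integral>\<^sup>+ x. ennreal (\<phi>\<^sub>1 x) \<partial>M) < \<infinity>"
    using M_sets phi_nonneg(1) by (subst nn_integral_eq_integral[OF M\<phi>\<^sub>1]) auto
  have M\<phi>\<^sub>2_nn: "0 < (\<integral>\<^sup>+ x. ennreal (\<phi>\<^sub>2 x) \<partial>M)"
    using M_sets phi_nonneg(2) M_int[OF \<phi>\<^sub>2_weighted] \<xi>\<phi>\<^sub>2 by (subst nn_integral_eq_integral) auto
  have qsd: "quasi_stationary M"
    unfolding quasi_stationary_def
  proof (intro conjI M allI ballI)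
    fix n A assume A: "A \<in> sets E"
    have "\<P>(\<omega> in M \<bind> P. X (real n) \<omega> \<in> A \<bar> survives n \<omega>) = normalized step (\<lambda>f. integral\<^sup>L M f) n (indicator A)"
      by (rule conditional_law[OF M M\<phi>\<^sub>1 A])
    also have "\<dots> = \<xi> ((step ^^ n) (indicator A)) / \<xi> (L.survival n)"
      unfolding normalized_def L.survival_def
      using M_int[OF step_iter_weighted[OF indicator_weighted[OF A]], of n]
        M_int[OF step_iter_weighted[OF one_weighted], of n] by simp
    also have "\<dots> = measure M A"
      using \<xi>(4)[of n] \<xi>(5)[OF indicator_weighted[OF A], of n] M_measure[OF A] by simp
    finally show "\<P>(\<omega> in M \<bind> P. X (real n) \<omega> \<in> A \<bar> survives n \<omega>) = measure M A" .
  qed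
  have unique: "\<nu>' = M"
    if \<nu>': "quasi_stationary \<nu>'" "(\<integral>\<^sup>+ x. ennreal (\<phi>\<^sub>2 x) \<partial>\<nu>') > 0" "(\<integral>\<^sup>+ x. ennreal (\<phi>\<^sub>1 x) \<partial>\<nu>') < \<infinity>" for \<nu>'
  proof -
    have \<nu>'_prob: "\<nu>' \<in> space (prob_algebra E)" using \<nu>'(1) by (simp add: quasi_stationary_def)
    note i = integrals[OF \<nu>'_prob \<nu>'(3,2)]
    interpret \<nu>': prob_space \<nu>' using \<nu>'_prob by (simp add: space_prob_algebra)
    interpret M: prob_space M by (rule M_prob)
    have \<nu>'_sets: "sets \<nu>' = sets E" using \<nu>'_prob by (simp add: space_prob_algebra)
    have "measure \<nu>' A = measure M A" if A: "A \<in> sets E" for A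
    proof -
      have "\<bar>measure \<nu>' A - \<xi> (indicator A)\<bar> \<le> C * \<alpha> ^ n * (integral\<^sup>L \<nu>' \<phi>\<^sub>1 / integral\<^sup>L \<nu>' \<phi>\<^sub>2)" for n
      proof -
        have "measure \<nu>' A = normalized step (\<lambda>f. integral\<^sup>L \<nu>' f) n (indicator A)"
          using \<nu>'(1) A conditional_law[OF \<nu>'_prob i(1) A, of n] by (simp add: quasi_stationary_def)
        moreover have "\<bar>indicator A x\<bar> \<le> \<phi>\<^sub>1 x" if "x \<in> space E" for x
          using E2_phi1(1)[OF that] by (simp add: indicator_def)
        ultimately show ?thesis using conv[OF i(2-4), of "indicator A" n] A by simp
      qed
      then have "\<bar>measure \<nu>' A - \<xi> (indicator A)\<bar> \<le> 0"
        by (intro LIMSEQ_le_const[OF geometric_0]) blast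
      then show ?thesis using M_measure[OF A] by simp
    qed
    then show ?thesis
      by (intro measure_eqI) (auto simp: \<nu>'_sets M_sets \<nu>'.emeasure_eq_measure M.emeasure_eq_measure)
  qed
  have "0 < measure M K" using \<xi>(3) by (simp only: M_measure[OF K_sets])
  show ?thesis
  proof (rule exI[of _ C], rule exI[of _ \<alpha>], rule exI[of _ M], intro conjI ballI allI impI)
    fix \<mu> n
    assume "\<mu> \<in> space (prob_algebra E)"
      "(\<integral>\<^sup>+ x. ennreal (\<phi>\<^sub>1 x) \<partial>\<mu>) < \<infinity> \<and> (\<integral>\<^sup>+ x. ennreal (\<phi>\<^sub>2 x) \<partial>\<mu>) > 0"
    then show "tv_dist E \<phi>\<^sub>1 (normalized_muPn \<mu> n) M
        \<le> ennreal (C * \<alpha> ^ n) * ((\<integral>\<^sup>+ x. ennreal (\<phi>\<^sub>1 x) \<partial>\<mu>) / (\<integral>\<^sup>+ x. ennreal (\<phi>\<^sub>2 x) \<partial>\<mu>))"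
      by (intro tv) (elim conjE, assumption)+
  next
    fix \<nu>'
    assume "quasi_stationary \<nu>' \<and>
       (\<integral>\<^sup>+ x. ennreal (\<phi>\<^sub>2 x) \<partial>\<nu>') > 0 \<and> (\<integral>\<^sup>+ x. ennreal (\<phi>\<^sub>1 x) \<partial>\<nu>') < \<infinity>"
    then show "\<nu>' = M" by (elim conjE) (rule unique)
  qed (fact C \<alpha> M \<open>0 < measure M K\<close> qsd M\<phi>\<^sub>2_nn M\<phi>\<^sub>1_nn)+
qed

end

theorem theorem2p1:
  fixes E :: "'a measure" and cem :: 'a and I :: "real set"
    and \<Omega> :: "'w measure" and P :: "'a \<Rightarrow> 'w measure" and X :: "real \<Rightarrow> 'w \<Rightarrow> 'a"
    and K :: "'a set" and \<nu> :: "'a measure" and n\<^sub>1 :: nat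
    and \<theta>\<^sub>1 \<theta>\<^sub>2 c\<^sub>1 c\<^sub>2 c\<^sub>3 :: real and \<phi>\<^sub>1 \<phi>\<^sub>2 :: "'a \<Rightarrow> real"
  assumes "assumption_E E cem I \<Omega> P X K \<nu> n\<^sub>1 \<theta>\<^sub>1 \<theta>\<^sub>2 c\<^sub>1 c\<^sub>2 c\<^sub>3 \<phi>\<^sub>1 \<phi>\<^sub>2"
  shows "\<exists>(C::real) (\<alpha>::real) \<nu>QSD.
    C > 0 \<and> 0 < \<alpha> \<and> \<alpha> < 1 \<and> \<nu>QSD \<in> space (prob_algebra E) \<and> measure \<nu>QSD K > 0 \<and>
    (\<forall>\<mu> \<in> space (prob_algebra E).
       (\<integral>\<^sup>+ x. ennreal (\<phi>\<^sub>1 x) \<partial>\<mu>) < \<infinity> \<and> (\<integral>\<^sup>+ x. ennreal (\<phi>\<^sub>2 x) \<partial>\<mu>) > 0 \<longrightarrow>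
       (\<forall>n::nat. tv_dist E \<phi>\<^sub>1 (absorbed_markov_process.normalized_muPn E cem I P X \<mu> n) \<nu>QSD
          \<le> ennreal (C * \<alpha> ^ n) *
             ((\<integral>\<^sup>+ x. ennreal (\<phi>\<^sub>1 x) \<partial>\<mu>) / (\<integral>\<^sup>+ x. ennreal (\<phi>\<^sub>2 x) \<partial>\<mu>)))) \<and>
    absorbed_markov_process.quasi_stationary E cem I P X \<nu>QSD \<and>
    (\<integral>\<^sup>+ x. ennreal (\<phi>\<^sub>2 x) \<partial>\<nu>QSD) > 0 \<and> (\<integral>\<^sup>+ x. ennreal (\<phi>\<^sub>1 x) \<partial>\<nu>QSD) < \<infinity> \<and>
    (\<forall>\<nu>'. absorbed_markov_process.quasi_stationary E cem I P X \<nu>' \<and>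
       (\<integral>\<^sup>+ x. ennreal (\<phi>\<^sub>2 x) \<partial>\<nu>') > 0 \<and> (\<integral>\<^sup>+ x. ennreal (\<phi>\<^sub>1 x) \<partial>\<nu>') < \<infinity> \<longrightarrow> \<nu>' = \<nu>QSD)"
proof -
  interpret assumption_E E cem I \<Omega> P X K \<nu> n\<^sub>1 \<theta>\<^sub>1 \<theta>\<^sub>2 c\<^sub>1 c\<^sub>2 c\<^sub>3 \<phi>\<^sub>1 \<phi>\<^sub>2 by (rule assms)
  show ?thesis by (rule quasi_stationary_convergence)
qed

end
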